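(* Let $s'>2$ and $s\in(2,s')$. There exists a constant $C_1>0$, independent of $h$, $\varepsilon$, $T$ and the initial data, such that the following holds. Let $\varepsilon,h>0$ and assume that the initial data $(\rho_0^*,u_0^*,\rho_0)$ are $(s',h)$-truncated of order $\varepsilon^2$, with associated functions $\widetilde{\rho_0}\in H^{s'-2}(\mathbb R)$ and $\widetilde{\rho_0^*},\widetilde{u_0^*}\in H^{s'}(\mathbb R)$. Let $(\rho^\varepsilon,u^\varepsilon)$ be the solution of $$\partial_t\rho^\varepsilon+\mathcal D_hu^\varepsilon=0,\qquad \varepsilon^2\partial_tu^\varepsilon+\mathcal D_h\rho^\varepsilon+u^\varepsilon=0,\qquad (\rho^\varepsilon,u^\varepsilon)(0)=(\rho_0^*,u_0^* ),$$ and let $\rho$ be the solution of the discrete heat equation $$\partial_t\rho-\mathcal D_h^2\rho=0,\qquad \rho(0)=\rho_0.$$ Then, for every $T>0$, $$\|(\rho^\varepsilon-\rho)(T)\|_{\dot B^{s-2}_h}+\|\rho^\varepsilon-\rho\|_{L^1_T(\dot B^s_h)}+\|\mathcal D_h\rho^\varepsilon+u^\varepsilon\|_{L^1_T(\dot B^{s-1}_h)}\le C\varepsilon^2,$$ where $$C=C_1\Big(1+\|(\widetilde{\rho_0^*},\varepsilon\widetilde{u_0^*})\|_{H^{s'}(\mathbb R)}+\|\widetilde{u_0^*}\|_{H^{s'-1}(\mathbb R)}\Big).$$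
   Context: Let $h>0$. For a sequence $v=(v_n)_{n\in\mathbb Z}$ put $\|v\|_{\ell^2_h}^2:=h\sum_{n\in\mathbb Z}|v_n|^2$; $\ell^2_h$ is the set of sequences with finite norm. The central finite difference operator is $(\mathcal D_hv)_n:=\frac{v_{n+1}-v_{n-1}}{2h}$, bounded on $\ell^2_h$; the unknowns are functions of $(t,n)\in[0,\infty)\times\mathbb Z$ and solutions are the unique ones in $C^1([0,\infty);\ell^2_h)$. The discrete Fourier transform of $v\in\ell^2_h$ is $\hat v(\xi)=\frac{h}{\sqrt{2\pi}}\sum_{n\in\mathbb Z}e^{-i\xi nh}v_n$, $\xi\in[-\frac\pi h,\frac\pi h]$, with inverse $(\mathcal F^{-1}g)_n=\frac1{\sqrt{2\pi}}\int_{-\pi/h}^{\pi/h}e^{i\xi nh}g(\xi)\,d\xi$. Dyadic decomposition: for $j\in\mathbb Z$ let $F_h(j):=\{\xi\in[-\frac\pi h,\frac\pi h]:\ |\frac{\sin(\xi h)}{h}|\in[\frac34 2^j,\frac43 2^{j+1}]\}$. Fix a family of measurable functions $\varphi_j:[-\frac\pi h,\frac\pi h]\to[0,1]$, $j\in\mathbb Z$ (depending on $h$), with $\mathrm{supp}(\varphi_j)\subseteq F_h(j)$ for all $j$ and $\sum_{j\in\mathbb Z}\varphi_j(\xi)=1$ for all $\xi\in[-\frac\pi h,\frac\pi h]$ with $\sin(\xi h)\ne0$. The localization operators are $\delta_h^jv:=\mathcal F^{-1}(\hat v\,\varphi_j)$, and for $r\in\mathbb R$ the discrete Besov norm is $\|v\|_{\dot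 B^r_h}:=\sum_{j\in\mathbb Z}2^{jr}\|\delta_h^jv\|_{\ell^2_h}$. For a normed space $X$, $\|g\|_{L^1_T(X)}:=\int_0^T\|g(t)\|_X\,dt$. Truncation operator: $\mathcal T_h:L^2(\mathbb R)\to\ell^2_h$, $(\mathcal T_hv)_n=\frac1{\sqrt{2\pi}}\int_{-\pi/h}^{\pi/h}e^{i\xi nh}\hat v(\xi)\,d\xi$, where here $\hat v(\xi)=\frac1{\sqrt{2\pi}}\int_{\mathbb R}e^{-i\xi x}v(x)\,dx$ is the (unitary) Fourier transform on $L^2(\mathbb R)$. Definition: the data $(\rho_0^*,u_0^*,\rho_0)$ are $(s',h)$-truncated of order $\varepsilon^2$ ($s'>2$) if there exist $\widetilde{\rho_0}\in H^{s'-2}(\mathbb R)$ and $\widetilde{\rho_0^*},\widetilde{u_0^*}\in H^{s'}(\mathbb R)$ such that $\|\widetilde{\rho_0}-\widetilde{\rho_0^*}\|_{H^{s'-2}(\mathbb R)}<\varepsilon^2$, $\rho_0=\mathcal T_h(\widetilde{\rho_0})$, $\rho_0^*=\mathcal T_h(\widetilde{\rho_0^*})$ and $u_0^*=\mathcal T_h(\widetilde{u_0^*})$. $H^r(\mathbb R)$ is the usual Sobolev space. *)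

theory Defs
  imports "HOL-Analysis.Analysis"
begin

section \<open>Square-summable sequences\<close>

definition ell2 :: "(int \<Rightarrow> complex) set" where
  "ell2 = {v. (\<lambda>n. (cmod (v n))\<^sup>2) summable_on UNIV}"

text \<open>The norm is extended-valued, so that a sequence outside \<open>ell2\<close> has norm \<open>\<infinity>\<close>
  (a plain \<^const>\<open>infsum\<close> in the reals would silently give \<open>0\<close>).\<close>

definition ell2_norm :: "real \<Rightarrow> (int \<Rightarrow> complex) \<Rightarrow> ennreal" where
  "ell2_norm h v =
     (if v \<in> ell2 then ennreal (sqrt (h * (\<Sum>\<^sub>\<infinity>n. (cmod (v n))\<^sup>2))) else \<infinity>)"

definition Dh :: "real \<Rightarrow> (int \<Rightarrow> complex) \<Rightarrow> int \<Rightarrow> complex" where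
  "Dh h v n = (v (n + 1) - v (n - 1)) / complex_of_real (2 * h)"

text \<open>\<open>v\<close> belongs to \<open>C\<^sup>1([0,\<infinity>); \<ell>\<^sup>2\<^sub>h)\<close> with derivative \<open>v'\<close>;
  difference quotients and continuity are taken in the \<open>\<ell>\<^sup>2\<^sub>h\<close> norm, one-sided at \<open>t = 0\<close>.\<close>

definition C1_ell2 :: "real \<Rightarrow> (real \<Rightarrow> int \<Rightarrow> complex) \<Rightarrow> (real \<Rightarrow> int \<Rightarrow> complex) \<Rightarrow> bool" where
  "C1_ell2 h v v' \<longleftrightarrow>
     (\<forall>t\<ge>0. v t \<in> ell2 \<and> v' t \<in> ell2 \<and>
        ((\<lambda>r. ell2_norm h (\<lambda>n. (v r n - v t n) / complex_of_real (r - t) - v' t n)) \<longlongrightarrow> 0)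
          (at t within {0..}) \<and>
        ((\<lambda>r. ell2_norm h (\<lambda>n. v' r n - v' t n)) \<longlongrightarrow> 0) (at t within {0..}))"

definition damped_solution ::
  "real \<Rightarrow> real \<Rightarrow> (int \<Rightarrow> complex) \<Rightarrow> (int \<Rightarrow> complex)
    \<Rightarrow> (real \<Rightarrow> int \<Rightarrow> complex) \<Rightarrow> (real \<Rightarrow> int \<Rightarrow> complex) \<Rightarrow> bool" where
  "damped_solution h \<epsilon> \<rho>\<^sub>0 u\<^sub>0 \<rho> u \<longleftrightarrow>
     \<rho> 0 = \<rho>\<^sub>0 \<and> u 0 = u\<^sub>0 \<and>
     (\<exists>\<rho>' u'. C1_ell2 h \<rho> \<rho>' \<and> C1_ell2 h u u' \<and>
        (\<forall>t\<ge>0. \<forall>n. \<rho>' t n + Dh h (u t) n = 0 \<and>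
           complex_of_real (\<epsilon>\<^sup>2) * u' t n + Dh h (\<rho> t) n + u t n = 0))"

definition heat_solution ::
  "real \<Rightarrow> (int \<Rightarrow> complex) \<Rightarrow> (real \<Rightarrow> int \<Rightarrow> complex) \<Rightarrow> bool" where
  "heat_solution h \<rho>\<^sub>0 \<rho> \<longleftrightarrow>
     \<rho> 0 = \<rho>\<^sub>0 \<and>
     (\<exists>\<rho>'. C1_ell2 h \<rho> \<rho>' \<and> (\<forall>t\<ge>0. \<forall>n. \<rho>' t n - Dh h (Dh h (\<rho> t)) n = 0))"


section \<open>Fourier transforms in \<open>L\<^sup>2\<close>\<close>

definition L2 :: "real set \<Rightarrow> (real \<Rightarrow> complex) set" where
  "L2 S = {f. f \<in> borel_measurable (lebesgue_on S) \<and>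
              integrable (lebesgue_on S) (\<lambda>x. (cmod (f x))\<^sup>2)}"

definition tendsto_L2 ::
  "real set \<Rightarrow> ('i \<Rightarrow> real \<Rightarrow> complex) \<Rightarrow> (real \<Rightarrow> complex) \<Rightarrow> 'i filter \<Rightarrow> bool" where
  "tendsto_L2 S f g F \<longleftrightarrow>
     ((\<lambda>i. \<integral>\<^sup>+ x. ennreal ((cmod (f i x - g x))\<^sup>2) \<partial>lebesgue_on S) \<longlongrightarrow> 0) F"

definition freqs :: "real \<Rightarrow> real set" where
  "freqs h = {- pi / h..pi / h}"

text \<open>For \<open>v\<close> in \<open>\<ell>\<^sup>2\<^sub>h\<close> the series defining the discrete Fourier transform converges
  in \<open>L\<^sup>2\<close> of the frequency interval, in general not absolutely. The transform is unique
  up to null sets and is only ever used under integrals.\<close>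

definition has_dft :: "real \<Rightarrow> (int \<Rightarrow> complex) \<Rightarrow> (real \<Rightarrow> complex) \<Rightarrow> bool" where
  "has_dft h v g \<longleftrightarrow> g \<in> L2 (freqs h) \<and>
     tendsto_L2 (freqs h)
       (\<lambda>(N::nat) \<xi>. complex_of_real (h / sqrt (2 * pi)) *
          (\<Sum>n = - int N..int N. cis (- (\<xi> * of_int n * h)) * v n))
       g sequentially"

definition dft :: "real \<Rightarrow> (int \<Rightarrow> complex) \<Rightarrow> real \<Rightarrow> complex" where
  "dft h v = (SOME g. has_dft h v g)"

definition idft :: "real \<Rightarrow> (real \<Rightarrow> complex) \<Rightarrow> int \<Rightarrow> complex" where
  "idft h g n = complex_of_real (1 / sqrt (2 * pi)) *
     (LINT \<xi>|lebesgue_on (freqs h). cis (\<xi> * of_int n * h) * g \<xi>)"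

text \<open>The unitary Fourier transform on \<open>L\<^sup>2(\<real>)\<close>, as the \<open>L\<^sup>2\<close> limit of the transforms of
  the restrictions to \<open>[-R, R]\<close> (Plancherel). Again unique up to null sets.\<close>

definition has_fourier :: "(real \<Rightarrow> complex) \<Rightarrow> (real \<Rightarrow> complex) \<Rightarrow> bool" where
  "has_fourier v g \<longleftrightarrow> g \<in> L2 UNIV \<and>
     tendsto_L2 UNIV
       (\<lambda>(R::real) \<xi>. complex_of_real (1 / sqrt (2 * pi)) *
          (LINT x|lebesgue_on {- R..R}. cis (- (\<xi> * x)) * v x))
       g at_top"

definition fourier :: "(real \<Rightarrow> complex) \<Rightarrow> real \<Rightarrow> complex" where
  "fourier v = (SOME g. has_fourier v g)"

definition truncation :: "real \<Rightarrow> (real \<Rightarrow> complex) \<Rightarrow> int \<Rightarrow> complex" where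
  "truncation h v = idft h (fourier v)"

text \<open>Sobolev spaces of nonnegative order, as subspaces of \<open>L\<^sup>2(\<real>)\<close>. By Plancherel's theorem
  the clause \<open>has_fourier v (fourier v)\<close> holds for every \<open>v\<close> in \<open>L\<^sup>2(\<real>)\<close>;
  it says that \<^const>\<open>fourier\<close> denotes a genuine transform of \<open>v\<close>.\<close>

definition sobolev :: "real \<Rightarrow> (real \<Rightarrow> complex) set" where
  "sobolev r = {v \<in> L2 UNIV. has_fourier v (fourier v) \<and>
     integrable lebesgue (\<lambda>\<xi>. (1 + \<xi>\<^sup>2) powr r * (cmod (fourier v \<xi>))\<^sup>2)}"

definition sobolev_norm :: "real \<Rightarrow> (real \<Rightarrow> complex) \<Rightarrow> real" where
  "sobolev_norm r v = sqrt (LINT \<xi>|lebesgue. (1 + \<xi>\<^sup>2) powr r * (cmod (fourier v \<xi>))\<^sup>2)"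


section \<open>Dyadic decomposition and Besov norms\<close>

definition dyadic_shell :: "real \<Rightarrow> int \<Rightarrow> real set" where
  "dyadic_shell h j =
     {\<xi> \<in> freqs h. \<bar>sin (\<xi> * h) / h\<bar> \<in> {3 / 4 * 2 powi j..4 / 3 * 2 powi (j + 1)}}"

definition dyadic_partition :: "real \<Rightarrow> (int \<Rightarrow> real \<Rightarrow> real) \<Rightarrow> bool" where
  "dyadic_partition h \<phi> \<longleftrightarrow>
     (\<forall>j. \<phi> j \<in> borel_measurable (lebesgue_on (freqs h)) \<and>
          \<phi> j ` freqs h \<subseteq> {0..1} \<and>
          closure {\<xi> \<in> freqs h. \<phi> j \<xi> \<noteq> 0} \<subseteq> dyadic_shell h j) \<and>
     (\<forall>\<xi>\<in>freqs h. sin (\<xi> * h) \<noteq> 0 \<longrightarrow> ((\<lambda>j. \<phi> j \<xi>) has_sum 1) UNIV)"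

definition localize ::
  "real \<Rightarrow> (int \<Rightarrow> real \<Rightarrow> real) \<Rightarrow> int \<Rightarrow> (int \<Rightarrow> complex) \<Rightarrow> int \<Rightarrow> complex" where
  "localize h \<phi> j v = idft h (\<lambda>\<xi>. dft h v \<xi> * complex_of_real (\<phi> j \<xi>))"

definition besov_norm ::
  "real \<Rightarrow> (int \<Rightarrow> real \<Rightarrow> real) \<Rightarrow> real \<Rightarrow> (int \<Rightarrow> complex) \<Rightarrow> ennreal" where
  "besov_norm h \<phi> r v =
     (\<Sum>\<^sub>\<infinity>j. ennreal (2 powr (of_int j * r)) * ell2_norm h (localize h \<phi> j v))"

definition L1_besov_norm ::
  "real \<Rightarrow> (int \<Rightarrow> real \<Rightarrow> real) \<Rightarrow> real \<Rightarrow> real \<Rightarrow> (real \<Rightarrow> int \<Rightarrow> complex) \<Rightarrow> ennreal" where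
  "L1_besov_norm h \<phi> r T g = (\<integral>\<^sup>+ t. besov_norm h \<phi> r (g t) \<partial>lebesgue_on {0..T})"


section \<open>Truncated data\<close>

text \<open>The data \<open>\<rho>\<^sub>0\<^sup>*\<close>, \<open>u\<^sub>0\<^sup>*\<close>, \<open>\<rho>\<^sub>0\<close> (called \<open>\<rho>i\<close>, \<open>ui\<close>, \<open>\<rho>l\<close>) are \<open>(s', h)\<close>-truncated of
  order \<open>\<epsilon>\<^sup>2\<close>, with the associated functions on the line (called \<open>\<rho>I\<close>, \<open>uI\<close>, \<open>\<rho>L\<close>) as explicit
  witnesses.\<close>

definition truncated_data ::
  "real \<Rightarrow> real \<Rightarrow> real \<Rightarrow> (int \<Rightarrow> complex) \<Rightarrow> (int \<Rightarrow> complex) \<Rightarrow> (int \<Rightarrow> complex)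
    \<Rightarrow> (real \<Rightarrow> complex) \<Rightarrow> (real \<Rightarrow> complex) \<Rightarrow> (real \<Rightarrow> complex) \<Rightarrow> bool" where
  "truncated_data s' h \<epsilon> \<rho>i ui \<rho>l \<rho>I uI \<rho>L \<longleftrightarrow>
     \<rho>L \<in> sobolev (s' - 2) \<and> \<rho>I \<in> sobolev s' \<and> uI \<in> sobolev s' \<and>
     sobolev_norm (s' - 2) (\<lambda>x. \<rho>L x - \<rho>I x) < \<epsilon>\<^sup>2 \<and>
     \<rho>l = truncation h \<rho>L \<and> \<rho>i = truncation h \<rho>I \<and> ui = truncation h uI"

end

(*
  In frequency, Dh becomes multiplication by i \<eta> with \<eta> = sin (\<xi> h) / h (k and symb h x below; e is \<epsilon>),
  so every system is an ODE with the real parameter \<eta>. The damped variable w = i \<eta> \<rho> + u satisfies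
  |w(t)| <= C P (exp (- t / (40 \<epsilon>^2)) + \<epsilon>^2 \<eta>^2 exp (- \<eta>^2 t)),  P = |u(0)| + |\<eta>| (|\<rho>(0)| + \<epsilon> |u(0)|):
  for \<epsilon> |\<eta>| <= 1/4 this follows from the two exact decaying combinations of \<rho> and u, and for
  \<epsilon> |\<eta>| >= 1/4 from a hypocoercive Lyapunov function, a factor \<epsilon>^2 \<eta>^2 >= 1/16 being then affordable.
  Duhamel's formula turns this into a bound on the difference with the heat flow. These bounds are pointwise in time
  and frequency, so they can be squared and integrated over a dyadic shell, where |\<eta>| is comparable to 2^j,
  before they are integrated in time. Since |\<eta>| <= |\<xi>|, the sum over the shells of 2^(jr) ||f||_(L^2(shell)) is
  controlled by the H^(r') norm whenever 0 < r < r'; this is where s > 2 and s < s' enter.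
*)
theory Submission
  imports Defs
begin

section \<open>Square-integrable functions\<close>

text \<open>Each error mechanism yields one factor e^2 after integration in time: the initial layer
  exp (- t / (40 e^2)) has integral at most 40 e^2, and e^2 X^2 exp (- X^2 t / 2) with X = 2^j has
  integral at most 2 e^2, whatever T and j. Block j then retains e^2 times 2^(js) rho, 2^(j(s-1)) u
  and e 2^(js) u, the source of the three norms in the constant. The gap between the two initial
  densities is carried by the heat flow, whose smoothing in L^1 in time gains the two derivatives
  between s - 2 and s. The obstacle is the passage to frequency. \<open>dft\<close> and
  \<open>fourier\<close> are choices of L^2 limits, fixed only up to null sets, so
  \<open>localize\<close> can be evaluated only once \<open>dft h (idft h G)\<close> is known to
  equal \<open>G\<close> almost everywhere. This takes Riesz-Fischer for existence and completeness
  of the exponentials for uniqueness. The solutions are given merely as C^1 curves in l^2, without a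
  formula: an explicit frequency solution is synthesized and identified with them by uniqueness in
  the sup norm, with constants that may blow up in h and e because they never reach the
  estimates.\<close>

lemma cmod_add_square_le: "(cmod (a + b))^2 \<le> 2 * (cmod a)^2 + 2 * (cmod b)^2"
proof -
  have "(cmod (a + b))^2 \<le> (cmod a + cmod b)^2"
    by (intro power_mono norm_triangle_ineq) auto
  then show ?thesis using zero_le_power2[of "cmod a - cmod b"]
    by (simp add: power2_sum power2_diff)
qed

lemma L2_mult:
  assumes "f \<in> L2 S" "g \<in> L2 S"
  shows "integrable (lebesgue_on S) (\<lambda>x. f x * g x)"
proof (rule Bochner_Integration.integrable_bound)
  show "integrable (lebesgue_on S) (\<lambda>x. (cmod (f x))^2 + (cmod (g x))^2)"
    using assms by (auto simp: L2_def)
  show "(\<lambda>x. f x * g x) \<in> borel_measurable (lebesgue_on S)"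
    using assms by (auto simp: L2_def)
  have "cmod (f x * g x) \<le> norm ((cmod (f x))^2 + (cmod (g x))^2)" for x
  proof -
    have "2 * (cmod (f x) * cmod (g x)) \<le> (cmod (f x))^2 + (cmod (g x))^2"
      using zero_le_power2[of "cmod (f x) - cmod (g x)"] by (simp add: power2_diff)
    moreover have "0 \<le> cmod (f x) * cmod (g x)" by simp
    ultimately have "cmod (f x) * cmod (g x) \<le> (cmod (f x))^2 + (cmod (g x))^2" by linarith
    then show ?thesis by (simp add: norm_mult)
  qed
  then show "AE x in lebesgue_on S. cmod (f x * g x) \<le> norm ((cmod (f x))^2 + (cmod (g x))^2)" by simp
qed

lemma L2_bounded_mult:
  assumes f: "f \<in> L2 S" and c: "c \<in> borel_measurable (lebesgue_on S)" "\<And>x. x \<in> S \<Longrightarrow> cmod (c x) \<le> B"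
  shows "(\<lambda>x. c x * f x) \<in> L2 S"
  unfolding L2_def
proof safe
  show m: "(\<lambda>x. c x * f x) \<in> borel_measurable (lebesgue_on S)" using assms by (auto simp: L2_def)
  show "integrable (lebesgue_on S) (\<lambda>x. (cmod (c x * f x))^2)"
  proof (rule Bochner_Integration.integrable_bound)
    show "integrable (lebesgue_on S) (\<lambda>x. B^2 * (cmod (f x))^2)" using f by (auto simp: L2_def)
    show "(\<lambda>x. (cmod (c x * f x))^2) \<in> borel_measurable (lebesgue_on S)" using m by simp
    show "AE x in lebesgue_on S. norm ((cmod (c x * f x))^2) \<le> norm (B^2 * (cmod (f x))^2)"
    proof (rule AE_I2)
      fix x assume "x \<in> space (lebesgue_on S)"
      then have "cmod (c x) \<le> B" using c by simp
      then have "(cmod (c x))^2 * (cmod (f x))^2 \<le> B^2 * (cmod (f x))^2"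
        by (intro mult_right_mono power_mono) auto
      then show "norm ((cmod (c x * f x))^2) \<le> norm (B^2 * (cmod (f x))^2)"
        by (simp add: norm_mult power_mult_distrib)
    qed
  qed
qed

lemma L2_cmult: "f \<in> L2 S \<Longrightarrow> (\<lambda>x. c * f x) \<in> L2 S"
  by (rule L2_bounded_mult[where B = "cmod c"]) auto

lemma L2_add:
  assumes "f \<in> L2 S" "g \<in> L2 S"
  shows "(\<lambda>x. f x + g x) \<in> L2 S"
  unfolding L2_def
proof safe
  show m: "(\<lambda>x. f x + g x) \<in> borel_measurable (lebesgue_on S)" using assms by (auto simp: L2_def)
  show "integrable (lebesgue_on S) (\<lambda>x. (cmod (f x + g x))^2)"
  proof (rule Bochner_Integration.integrable_bound)
    show "integrable (lebesgue_on S) (\<lambda>x. 2 * (cmod (f x))^2 + 2 * (cmod (g x))^2)"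
      using assms by (auto simp: L2_def)
    show "(\<lambda>x. (cmod (f x + g x))^2) \<in> borel_measurable (lebesgue_on S)" using m by simp
    show "AE x in lebesgue_on S. norm ((cmod (f x + g x))^2) \<le> norm (2 * (cmod (f x))^2 + 2 * (cmod (g x))^2)"
      using cmod_add_square_le[of "f _" "g _"] by auto
  qed
qed

lemma L2_diff: "f \<in> L2 S \<Longrightarrow> g \<in> L2 S \<Longrightarrow> (\<lambda>x. f x - g x) \<in> L2 S"
  using L2_add[of f S "\<lambda>x. - 1 * g x"] L2_cmult[of g S "- 1"] by simp

lemma L2_zero: "(\<lambda>x. 0) \<in> L2 S"
  by (simp add: L2_def)

lemma L2_sum: "finite F \<Longrightarrow> (\<And>i. i \<in> F \<Longrightarrow> f i \<in> L2 S) \<Longrightarrow> (\<lambda>x. \<Sum>i\<in>F. f i x) \<in> L2 S"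
  by (induction F rule: finite_induct) (auto intro!: L2_zero L2_add)

lemma L2_mono:
  assumes "f \<in> L2 S" "T \<subseteq> S" "S \<in> sets lebesgue" "T \<in> sets lebesgue"
  shows "f \<in> L2 T"
proof -
  have "f \<in> borel_measurable (lebesgue_on T)"
    using assms measurable_restrict_mono by (auto simp: L2_def)
  moreover have "integrable (lebesgue_on T) (\<lambda>x. (cmod (f x))^2)"
    using assms set_integrable_subset[of lebesgue S "\<lambda>x. (cmod (f x))^2" T]
    by (simp add: L2_def integrable_restrict_space set_integrable_def)
  ultimately show ?thesis by (simp add: L2_def)
qed

section \<open>The frequency interval and its exponentials\<close>

abbreviation \<Omega> :: "real \<Rightarrow> real measure" where
  "\<Omega> h \<equiv> lebesgue_on (freqs h)"

lemma freqs_sets [simp]: "freqs h \<in> sets lebesgue" "freqs h \<inter> space lebesgue \<in> sets lebesgue"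
  by (auto simp: freqs_def)

lemma finite_measure_freqs: "finite_measure (\<Omega> h)"
  by (simp add: freqs_def finite_measure_lebesgue_on)

lemma L2_const: "finite_measure (lebesgue_on S) \<Longrightarrow> (\<lambda>x. c) \<in> L2 S"
  unfolding L2_def using finite_measure.integrable_const by auto

lemma L2_integrable:
  assumes "f \<in> L2 S" "finite_measure (lebesgue_on S)"
  shows "integrable (lebesgue_on S) f"
  using L2_mult[OF assms(1) L2_const[OF assms(2), of 1]] by simp

definition trig :: "real \<Rightarrow> int \<Rightarrow> real \<Rightarrow> complex" where
  "trig h n x = cis (x * of_int n * h)"

lemma trig_add: "trig h (m + n) x = trig h m x * trig h n x"
  by (simp add: trig_def cis_mult algebra_simps)

lemma norm_trig [simp]: "cmod (trig h n x) = 1"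
  by (simp add: trig_def)

lemma trig_measurable [measurable]: "trig h n \<in> borel_measurable (lebesgue_on S)"
proof -
  have "continuous_on UNIV (trig h n)"
    unfolding trig_def[abs_def] cis_conv_exp by (intro continuous_intros)
  then have "trig h n \<in> borel_measurable borel" by (rule borel_measurable_continuous_onI)
  then show ?thesis by (intro measurable_restrict_space1) (simp add: measurable_completion)
qed

lemma idft_trig: "idft h g n = of_real (1 / sqrt (2 * pi)) * (LINT x|\<Omega> h. trig h n x * g x)"
  by (simp add: idft_def trig_def)

lemma trig_mult_integrable:
  "integrable (lebesgue_on S) f \<Longrightarrow> integrable (lebesgue_on S) (\<lambda>x. trig h n x * f x)"
  by (rule Bochner_Integration.integrable_bound[of _ f]) (auto simp: norm_mult)

lemma freqs_integrable: "f \<in> L2 (freqs h) \<Longrightarrow> integrable (\<Omega> h) f"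
  by (rule L2_integrable[OF _ finite_measure_freqs])

section \<open>Completeness of the exponentials\<close>

text \<open>Vanishing of all coefficients is preserved by multiplication with trigonometric polynomials, which are
  the real polynomials on the unit circle; Stone-Weierstrass extends this to continuous factors.\<close>

lemma poly_mult_coefficients_zero:
  assumes p: "real_polynomial_function (p :: complex \<Rightarrow> real)"
    and f: "integrable (\<Omega> h) f" "\<And>n. (LINT x|\<Omega> h. trig h n x * f x) = 0"
  shows "integrable (\<Omega> h) (\<lambda>x. of_real (p (trig h 1 x)) * f x) \<and>
    (\<forall>n. (LINT x|\<Omega> h. trig h n x * (of_real (p (trig h 1 x)) * f x)) = 0)"
  using p f
proof (induction p arbitrary: f rule: real_polynomial_function.induct)
  case (linear p)
  interpret p: bounded_linear p by fact
  \<comment> \<open>A real-linear form on the complex plane is \<open>a * z + b * cnj z\<close>, and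
    on the unit circle \<open>cnj z\<close> is \<open>trig h (- 1) x\<close>. Multiplying by it
    therefore only shifts the index \<open>n\<close> by one in either direction.\<close>
  define a where "a = (of_real (p 1) - \<i> * of_real (p \<i>)) / 2"
  define b where "b = (of_real (p 1) + \<i> * of_real (p \<i>)) / 2"
  have p_eq: "of_real (p (trig h 1 x)) = a * trig h 1 x + b * trig h (- 1) x" for x
  proof -
    have "p (trig h 1 x) = p (cos (x * h) *\<^sub>R 1 + sin (x * h) *\<^sub>R \<i>)"
      by (intro arg_cong[of _ _ p]) (simp add: trig_def complex_eq_iff)
    then have "p (trig h 1 x) = cos (x * h) * p 1 + sin (x * h) * p \<i>" by (simp add: p.add p.scaleR)
    then show ?thesis by (simp add: a_def b_def trig_def complex_eq_iff field_simps)
  qed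
  have eq: "trig h n x * (of_real (p (trig h 1 x)) * f x)
      = a * (trig h (n + 1) x * f x) + b * (trig h (n - 1) x * f x)" for n x
    using trig_add[of h n 1 x] trig_add[of h n "- 1" x] by (simp add: p_eq algebra_simps)
  have eq1: "of_real (p (trig h 1 x)) * f x = a * (trig h 1 x * f x) + b * (trig h (- 1) x * f x)" for x
    by (simp add: p_eq algebra_simps)
  have i: "integrable (\<Omega> h) (\<lambda>x. c * (trig h n x * f x))" for c n
    using trig_mult_integrable[OF linear(2)] by simp
  show ?case using linear(3) i trig_mult_integrable[OF linear(2)] by (simp only: eq) (simp add: eq1)
next
  case (const c)
  have eq: "trig h n x * (of_real c * f x) = of_real c * (trig h n x * f x)" for n x by simp
  show ?case using const by (simp only: eq) simp
next
  case (add p q)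
  note pq = add.IH[OF add.prems]
  have eq: "of_real (p (trig h 1 x) + q (trig h 1 x)) * f x
      = of_real (p (trig h 1 x)) * f x + of_real (q (trig h 1 x)) * f x" for x
    by (simp add: algebra_simps)
  show ?case using pq trig_mult_integrable by (simp only: eq distrib_left) simp
next
  case (mult p q)
  from mult.IH(2)[OF mult.prems] have q: "integrable (\<Omega> h) (\<lambda>x. of_real (q (trig h 1 x)) * f x)"
    "\<And>n. (LINT x|\<Omega> h. trig h n x * (of_real (q (trig h 1 x)) * f x)) = 0" by auto
  from mult.IH(1)[OF q] show ?case by (simp add: mult.assoc)
qed

context
  fixes h :: real and f :: "real \<Rightarrow> complex"
  assumes h: "0 < h"
    and f_int: "integrable (\<Omega> h) f"
    and f_coeff: "\<And>n. (LINT x|\<Omega> h. trig h n x * f x) = 0"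
begin

text \<open>On the unit circle \<open>g\<close> is uniformly within \<open>e\<close> of a real
  polynomial, for which the integral vanishes. The replacement costs at most \<open>e\<close> times
  the integral of \<open>cmod (f x)\<close>.\<close>

lemma continuous_mult_integral_zero:
  assumes g: "continuous_on UNIV (g :: complex \<Rightarrow> real)"
  shows "(LINT x|\<Omega> h. of_real (g (trig h 1 x)) * f x) = 0"
proof -
  let ?f = "\<lambda>g x. of_real (g (trig h 1 x)) * f x"
  let ?I = "LINT x|\<Omega> h. ?f g x"
  have gm: "(?f g) \<in> borel_measurable (\<Omega> h)"
    using f_int borel_measurable_continuous_onI[OF g] by measurable
  obtain B where B: "\<And>z. z \<in> sphere 0 1 \<Longrightarrow> \<bar>g z\<bar> \<le> B"
  proof -
    have "compact (g ` sphere 0 1)"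
      using g by (intro compact_continuous_image) (auto intro: continuous_on_subset)
    then show ?thesis using that compact_imp_bounded by (metis bounded_iff imageI real_norm_def)
  qed
  have gi: "integrable (\<Omega> h) (?f g)"
  proof (rule Bochner_Integration.integrable_bound[OF _ gm])
    show "integrable (\<Omega> h) (\<lambda>x. of_real B * f x)" using f_int by simp
    show "AE x in \<Omega> h. cmod (?f g x) \<le> cmod (of_real B * f x)"
    proof (rule AE_I2)
      fix x
      have "\<bar>g (trig h 1 x)\<bar> \<le> \<bar>B\<bar>" using B[of "trig h 1 x"] by simp
      then show "cmod (?f g x) \<le> cmod (of_real B * f x)"
        by (simp add: norm_mult mult_right_mono)
    qed
  qed
  define F where "F = (LINT x|\<Omega> h. cmod (f x))"
  have F: "0 \<le> F" by (simp add: F_def)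
  have bound: "cmod ?I \<le> e * F" if e: "0 < e" for e
  proof -
    obtain p where p: "real_polynomial_function p" "\<And>z. z \<in> sphere 0 1 \<Longrightarrow> \<bar>g z - p z\<bar> < e"
      using Stone_Weierstrass_real_polynomial_function[of "sphere 0 1" g e] g e
      by (metis compact_sphere continuous_on_subset subset_UNIV)
    from poly_mult_coefficients_zero[OF p(1) f_int f_coeff]
    have pi: "integrable (\<Omega> h) (?f p)"
      and p0: "(LINT x|\<Omega> h. trig h 0 x * (?f p x)) = 0" by auto
    have p0': "(LINT x|\<Omega> h. ?f p x) = 0"
      using p0 by (simp add: trig_def)
    have "?I = (LINT x|\<Omega> h. ?f g x - ?f p x)"
      using gi pi p0' by simp
    also have "cmod \<dots> \<le> (LINT x|\<Omega> h. cmod (?f g x - ?f p x))"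
      by (rule integral_norm_bound)
    also have "\<dots> \<le> (LINT x|\<Omega> h. e * cmod (f x))"
    proof (rule integral_mono)
      fix x
      have "?f g x - ?f p x
          = of_real (g (trig h 1 x) - p (trig h 1 x)) * f x" by (simp add: algebra_simps)
      moreover have "\<bar>g (trig h 1 x) - p (trig h 1 x)\<bar> \<le> e" using p(2)[of "trig h 1 x"] by simp
      ultimately show "cmod (?f g x - ?f p x) \<le> e * cmod (f x)"
        by (simp only: norm_mult norm_of_real mult_right_mono norm_ge_zero)
    qed (use gi pi f_int in auto)
    finally show ?thesis by (simp add: F_def)
  qed
  have *: "cmod ?I \<le> e" if "0 < e" for e
  proof -
    have "cmod ?I \<le> (e / (F + 1)) * F" using that F by (intro bound) simp
    also have "\<dots> \<le> e" using that F by (simp add: field_simps)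
    finally show ?thesis .
  qed
  have "cmod ?I \<le> 0" by (rule field_le_epsilon) (use * in simp)
  then show ?thesis by simp
qed

text \<open>The tent functions \<open>g k\<close> are continuous, bounded by 1 and decrease to the
  indicator of \<open>K\<close>, so dominated convergence applies. The empty set is split off
  because \<open>infdist\<close> to it is 0, which would make every tent constantly 1.\<close>

lemma closed_integral_zero:
  assumes K: "closed (K :: complex set)"
  shows "(LINT x|\<Omega> h. indicator K (trig h 1 x) * f x) = 0"
proof (cases "K = {}")
  case False
  define g where "g k z = max 0 (1 - real k * infdist z K)" for k :: nat and z
  have g_cont: "continuous_on UNIV (g k)" for k
    unfolding g_def by (intro continuous_intros)
  have lim: "(\<lambda>k. g k z) \<longlonglongrightarrow> indicator K z" for z
  proof (cases "z \<in> K")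
    case True
    then show ?thesis by (simp add: g_def)
  next
    case z: False
    then have d: "0 < infdist z K" using K False by (simp add: infdist_pos_not_in_closed)
    obtain N where "1 / infdist z K < real N" using reals_Archimedean2 by blast
    then have "1 \<le> real k * infdist z K" if "N \<le> k" for k
      using d that by (simp add: pos_divide_less_eq) (smt (verit) d mult_right_mono of_nat_mono)
    then have "\<forall>k\<ge>N. g k z = indicator K z" using z by (auto simp: g_def)
    then show ?thesis by (intro tendsto_eventually) (auto simp: eventually_sequentially)
  qed
  have K_meas: "indicator K \<in> borel_measurable (borel :: complex measure)" using K by simp
  have "(\<lambda>k. LINT x|\<Omega> h. of_real (g k (trig h 1 x)) * f x) \<longlonglongrightarrow>
        (LINT x|\<Omega> h. of_real (indicator K (trig h 1 x)) * f x)"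
  proof (rule integral_dominated_convergence[where w = "\<lambda>x. cmod (f x)"])
    show "AE x in \<Omega> h. (\<lambda>k. of_real (g k (trig h 1 x)) * f x) \<longlonglongrightarrow> of_real (indicator K (trig h 1 x)) * f x"
      by (intro AE_I2 tendsto_intros lim)
    show "AE x in \<Omega> h. cmod (of_real (g k (trig h 1 x)) * f x) \<le> cmod (f x)" for k
    proof (rule AE_I2)
      fix x
      have "0 \<le> g k (trig h 1 x)" "g k (trig h 1 x) \<le> 1" by (auto simp: g_def infdist_nonneg)
      then show "cmod (of_real (g k (trig h 1 x)) * f x) \<le> cmod (f x)"
        by (simp add: norm_mult mult_left_le_one_le)
    qed
    show "(\<lambda>x. of_real (g k (trig h 1 x)) * f x) \<in> borel_measurable (\<Omega> h)" for k
      using f_int borel_measurable_continuous_onI[OF g_cont[of k]] by measurable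
    show "(\<lambda>x. of_real (indicator K (trig h 1 x)) * f x) \<in> borel_measurable (\<Omega> h)"
      using f_int K_meas by measurable
  qed (use f_int in auto)
  then show ?thesis
    by (simp add: continuous_mult_integral_zero[OF g_cont] LIMSEQ_const_iff of_real_indicator)
qed simp

text \<open>Pulls the statement back from the circle to the interval: \<open>trig h 1\<close> is
  injective on \<open>freqs h\<close> except that it identifies the two endpoints, and these form a
  null set.\<close>

lemma compact_integral_zero:
  assumes C: "compact C"
  shows "(LINT x|\<Omega> h. indicator C x * f x) = 0"
proof -
  define K where "K = trig h 1 ` (C \<inter> freqs h)"
  have "continuous_on (C \<inter> freqs h) (trig h 1)"
    unfolding trig_def[abs_def] cis_conv_exp by (intro continuous_intros)
  then have "compact K" unfolding K_def using C
    by (intro compact_continuous_image) (auto simp: freqs_def)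
  then have K: "closed K" by (rule compact_imp_closed)
  have "{- pi / h, pi / h} \<in> null_sets lebesgue" by (simp add: null_sets_completionI finite_imp_null_set_lborel)
  then have "AE x in lebesgue. x \<notin> {- pi / h, pi / h}" by (rule AE_not_in)
  then have ae: "AE x in \<Omega> h. x \<notin> {- pi / h, pi / h}"
    by (auto simp: AE_restrict_space_iff)
  have ind: "indicator K (trig h 1 x) = (indicator C x :: complex)" if x: "x \<in> freqs h" "x \<notin> {- pi / h, pi / h}" for x
  proof -
    have "x \<in> C" if K': "trig h 1 x \<in> K"
    proof -
      obtain y where y: "y \<in> C" "y \<in> freqs h" "trig h 1 x = trig h 1 y" using K' by (auto simp: K_def)
      have "cis (x * h) = cis (y * h)" using y by (simp add: trig_def)
      moreover have "- pi < x * h" "x * h < pi" using x h by (auto simp: freqs_def field_simps less_le)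
      moreover have "- pi \<le> y * h" "y * h \<le> pi" using y h by (auto simp: freqs_def field_simps)
      ultimately have "x * h = y * h"
      proof -
        assume A: "cis (x * h) = cis (y * h)" "- pi < x * h" "x * h < pi" "- pi \<le> y * h" "y * h \<le> pi"
        have "cis (x * h - y * h) = 1" by (simp add: A(1) cis_divide[symmetric])
        then obtain k :: int where k: "x * h - y * h = 2 * pi * k"
          by (auto simp: complex_eq_iff cos_one_2pi_int)
        have "\<bar>x * h - y * h\<bar> < 2 * pi" using A by linarith
        then have "\<bar>real_of_int k\<bar> < 1" unfolding k by (simp add: abs_mult)
        then have "k = 0" by linarith
        then show ?thesis using k by simp
      qed
      then show ?thesis using y h by simp
    qed
    moreover have "trig h 1 x \<in> K" if "x \<in> C" using that x by (auto simp: K_def)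
    ultimately show ?thesis by (auto simp: indicator_def)
  qed
  have "(LINT x|\<Omega> h. indicator C x * f x) = (LINT x|\<Omega> h. indicator K (trig h 1 x) * f x)"
  proof (rule integral_cong_AE)
    have "C \<in> sets lebesgue" using C by (simp add: borel_compact)
    then have "(indicator C :: real \<Rightarrow> complex) \<in> borel_measurable lebesgue" by simp
    then have "(indicator C :: real \<Rightarrow> complex) \<in> borel_measurable (\<Omega> h)" by (rule measurable_restrict_space1)
    then show "(\<lambda>x. indicator C x * f x) \<in> borel_measurable (\<Omega> h)" using f_int by measurable
    have "indicator K \<in> borel_measurable (borel :: complex measure)" using K by simp
    then show "(\<lambda>x. indicator K (trig h 1 x) * f x) \<in> borel_measurable (\<Omega> h)" using f_int by measurable
    show "AE x in \<Omega> h. indicator C x * f x = indicator K (trig h 1 x) * f x"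
      using ae AE_space by eventually_elim (use ind in simp)
  qed
  then show ?thesis using closed_integral_zero[OF K] by simp
qed

text \<open>Up to a null set, a Lebesgue set is a countable union of compact sets. Hence the
  integral of \<open>f\<close> over every measurable set vanishes, which forces \<open>f\<close> to
  be zero almost everywhere.\<close>

lemma coefficients_zero_imp_AE_zero: "AE x in \<Omega> h. f x = 0"
proof (rule sigma_finite_measure.density_unique_banach[OF _ f_int integrable_zero])
  show "sigma_finite_measure (\<Omega> h)"
    using finite_measure_freqs by (rule finite_measure.axioms)
  fix A assume "A \<in> sets (\<Omega> h)"
  then have A: "A \<in> sets lebesgue" "A \<subseteq> freqs h" by (auto simp: sets_restrict_space_iff)
  obtain C T where CT: "fsigma C" "T \<in> null_sets lebesgue" "C \<union> T = A" "disjnt C T"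
    using lebesgue_set_almost_fsigma[OF A(1)] .
  obtain F :: "nat \<Rightarrow> real set" where F: "range F \<subseteq> Collect compact" "C = \<Union> (range F)"
    using CT(1) fsigma_Union_compact by blast
  define G where "G n = (\<Union>i<n. F i)" for n
  have G: "compact (G n)" for n unfolding G_def using F by (intro compact_UN) auto
  have lim: "(\<lambda>n. indicator (G n) x :: complex) \<longlonglongrightarrow> indicator C x" for x
  proof -
    have "(\<lambda>n. indicator (\<Union>i<n. F i) x :: complex) \<longlonglongrightarrow> indicator (\<Union>i. F i) x"
      by (rule LIMSEQ_indicator_UN)
    then show ?thesis by (simp add: G_def F)
  qed
  have Cs: "C \<in> sets lebesgue"
    unfolding F(2) using F(1) by (intro sets.countable_UN) (auto intro!: sets_completionI_sets borel_compact)
  have ind_meas: "X \<in> sets lebesgue \<Longrightarrow> (indicator X :: real \<Rightarrow> complex) \<in> borel_measurable (\<Omega> h)" for X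
    by (intro measurable_restrict_space1) simp
  have "(\<lambda>n. LINT x|\<Omega> h. indicator (G n) x * f x) \<longlonglongrightarrow>
        (LINT x|\<Omega> h. indicator C x * f x)"
  proof (rule integral_dominated_convergence[where w = "\<lambda>x. cmod (f x)"])
    show "AE x in \<Omega> h. (\<lambda>n. indicator (G n) x * f x) \<longlonglongrightarrow> indicator C x * f x"
      by (intro AE_I2 tendsto_intros lim)
    show "AE x in \<Omega> h. cmod (indicator (G n) x * f x) \<le> cmod (f x)" for n
      by (auto simp: indicator_def)
    show "(\<lambda>x. indicator (G n) x * f x) \<in> borel_measurable (\<Omega> h)" for n
      using f_int ind_meas[of "G n"] G by (simp add: borel_compact)
    show "(\<lambda>x. indicator C x * f x) \<in> borel_measurable (\<Omega> h)"
      using f_int ind_meas[OF Cs] by simp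
  qed (use f_int in auto)
  then have C0: "(LINT x|\<Omega> h. indicator C x * f x) = 0"
    by (simp add: compact_integral_zero[OF G] LIMSEQ_const_iff)
  have "(LINT x|\<Omega> h. indicator A x *\<^sub>R f x) = (LINT x|\<Omega> h. indicator C x * f x)"
  proof (rule integral_cong_AE)
    show "(\<lambda>x. indicator A x *\<^sub>R f x) \<in> borel_measurable (\<Omega> h)"
      using f_int \<open>A \<in> sets (\<Omega> h)\<close> by measurable
    show "(\<lambda>x. indicator C x * f x) \<in> borel_measurable (\<Omega> h)"
      using f_int ind_meas[OF Cs] by simp
    have "AE x in lebesgue. x \<notin> T" using CT(2) by (rule AE_not_in)
    then have "AE x in \<Omega> h. x \<notin> T" by (auto simp: AE_restrict_space_iff)
    then show "AE x in \<Omega> h. indicator A x *\<^sub>R f x = indicator C x * f x"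
      by eventually_elim (use CT(3) in \<open>auto simp: indicator_def\<close>)
  qed
  then show "set_lebesgue_integral (\<Omega> h) A f = set_lebesgue_integral (\<Omega> h) A (\<lambda>x. 0)"
    using C0 by (simp add: set_lebesgue_integral_def)
qed

end

section \<open>Parseval and Riesz-Fischer on the frequency interval\<close>

definition sqint :: "real set \<Rightarrow> (real \<Rightarrow> complex) \<Rightarrow> real" where
  "sqint S f = (LINT x|lebesgue_on S. (cmod (f x))^2)"

lemma sqint_nonneg [simp]: "0 \<le> sqint S f"
  by (simp add: sqint_def)

lemma nn_integral_L2: "f \<in> L2 S \<Longrightarrow> (\<integral>\<^sup>+ x. ennreal ((cmod (f x))^2) \<partial>lebesgue_on S) = ennreal (sqint S f)"
  unfolding sqint_def by (rule nn_integral_eq_integral) (auto simp: L2_def)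

lemma trig_L2 [simp]: "trig h n \<in> L2 (freqs h')"
  unfolding L2_def using finite_measure.integrable_const[OF finite_measure_freqs] by auto

lemma trig_mult_L2: "f \<in> L2 S \<Longrightarrow> (\<lambda>x. trig h n x * f x) \<in> L2 S"
  by (rule L2_bounded_mult[where B = 1]) auto

lemma trig_orthogonal:
  assumes h: "0 < h"
  shows "(LINT x|\<Omega> h. trig h n x) = (if n = 0 then of_real (2 * pi / h) else 0)"
proof (cases "n = 0")
  case True
  have "measure (\<Omega> h) (freqs h) = 2 * pi / h"
    using h by (simp add: freqs_def measure_restrict_space)
  then show ?thesis using True by (simp add: trig_def) (simp add: scaleR_conv_of_real)
next
  case False
  define c where "c = \<i> * of_real (of_int n * h)"
  have c: "c \<noteq> 0" using False h by (simp add: c_def)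
  have trig_exp: "trig h n x = exp (c * of_real x)" for x
    by (simp add: trig_def cis_conv_exp c_def ac_simps)
  have cont: "continuous_on {- pi / h..pi / h} (trig h n)"
    unfolding trig_exp[abs_def] by (intro continuous_intros)
  have "((\<lambda>z. exp (c * z) / c) has_field_derivative exp (c * z)) (at z)" for z
    using c by (auto intro!: derivative_eq_intros)
  then have der: "((\<lambda>x. exp (c * of_real x) / c) has_vector_derivative trig h n x) (at x within {- pi / h..pi / h})" for x
    unfolding trig_exp by (rule has_vector_derivative_real_field)
  have "(trig h n has_integral (exp (c * of_real (pi / h)) / c - exp (c * of_real (- pi / h)) / c)) {- pi / h..pi / h}"
    by (rule fundamental_theorem_of_calculus) (use h der in auto)
  moreover have "exp (c * of_real (pi / h)) = exp (c * of_real (- pi / h))"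
  proof -
    have "c * of_real (pi / h) = c * of_real (- pi / h) + \<i> * (of_int n * (of_real pi * 2))"
      using h by (simp add: c_def field_simps)
    then show ?thesis by (simp only: exp_plus_2pin)
  qed
  ultimately have "(trig h n has_integral 0) (freqs h)" by (simp add: freqs_def)
  moreover have "integrable (\<Omega> h) (trig h n)"
    by (rule freqs_integrable[OF trig_L2])
  ultimately show ?thesis using False lebesgue_integral_eq_integral[of "freqs h" "trig h n"]
    by (simp add: integral_unique)
qed

definition fourier_sum :: "real \<Rightarrow> (int \<Rightarrow> complex) \<Rightarrow> int set \<Rightarrow> real \<Rightarrow> complex" where
  "fourier_sum h v F x = of_real (h / sqrt (2 * pi)) * (\<Sum>n\<in>F. trig h (- n) x * v n)"

lemma fourier_sum_L2: "finite F \<Longrightarrow> fourier_sum h v F \<in> L2 (freqs h)"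
  unfolding fourier_sum_def[abs_def]
  by (intro L2_cmult L2_sum) (auto simp: mult.commute[of "trig _ _ _"] intro!: L2_cmult)

text \<open>The cosine rule in L^2, which lets the induction in \<open>sqint_fourier_sum\<close>
  take off one exponential at a time.\<close>

lemma sqint_diff_cmult:
  assumes H: "H \<in> L2 S" "E \<in> L2 S"
  shows "sqint S (\<lambda>x. H x - a * E x)
    = sqint S H - 2 * Re (cnj a * (LINT x|lebesgue_on S. cnj (E x) * H x)) + (cmod a)^2 * sqint S E"
proof -
  have cE: "(\<lambda>x. cnj (E x)) \<in> L2 S"
    using H(2) measurable_compose[OF _ borel_measurable_continuous_onI[of cnj], of E]
    by (auto simp: L2_def continuous_on_cnj)
  have i: "integrable (lebesgue_on S) (\<lambda>x. cnj (E x) * H x)" by (rule L2_mult[OF cE H(1)])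
  define K where "K x = Re (cnj a * (cnj (E x) * H x))" for x
  have eq: "(cmod (H x - a * E x))^2 = (cmod (H x))^2 - 2 * K x + (cmod a)^2 * (cmod (E x))^2" for x
    unfolding K_def by (simp add: cmod_power2) (simp add: power2_eq_square algebra_simps)
  have iK: "integrable (lebesgue_on S) (\<lambda>x. cnj a * (cnj (E x) * H x))" using i by simp
  have K: "integrable (lebesgue_on S) K" unfolding K_def by (rule integrable_Re[OF iK])
  have K_int: "(LINT x|lebesgue_on S. K x) = Re (cnj a * (LINT x|lebesgue_on S. cnj (E x) * H x))"
    unfolding K_def by (simp only: integral_Re[OF iK] integral_mult_right_zero)
  show ?thesis unfolding sqint_def eq K_int[symmetric] using H K
    by (simp add: L2_def)
qed

text \<open>One identity with two specializations: \<open>G = 0\<close> is Parseval's identity for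
  finite sums, and \<open>v = idft h G\<close> gives Bessel's inequality. The induction works
  because each new exponential is orthogonal to the partial sum already removed.\<close>

lemma sqint_fourier_sum:
  assumes h: "0 < h" and G: "G \<in> L2 (freqs h)" and F: "finite F"
  shows "sqint (freqs h) (\<lambda>x. G x - fourier_sum h v F x)
    = sqint (freqs h) G - 2 * h * (\<Sum>n\<in>F. Re (cnj (v n) * idft h G n)) + h * (\<Sum>n\<in>F. (cmod (v n))^2)"
  using F
proof (induction F rule: finite_induct)
  case empty
  then show ?case by (simp add: fourier_sum_def)
next
  case (insert m F)
  define k where "k = h / sqrt (2 * pi)"
  let ?H = "\<lambda>x. G x - fourier_sum h v F x"
  let ?a = "of_real k * v m"
  have eq: "G x - fourier_sum h v (insert m F) x = ?H x - ?a * trig h (- m) x" for x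
    using insert by (simp add: fourier_sum_def k_def algebra_simps)
  have H: "?H \<in> L2 (freqs h)" using G insert fourier_sum_L2 by (intro L2_diff) auto
  have trig0: "sqint (freqs h) (trig h (- m)) = 2 * pi / h"
    using h by (simp add: sqint_def freqs_def measure_restrict_space)
  have cnj: "cnj (trig h (- m) x) = trig h m x" for x
    by (simp add: trig_def cis_cnj)
  note int = freqs_integrable[of _ h]
  have "(LINT x|\<Omega> h. trig h m x * fourier_sum h v F x)
      = (LINT x|\<Omega> h. (\<Sum>n\<in>F. (of_real k * v n) * trig h (m - n) x))"
  proof (rule arg_cong[where f = "integral\<^sup>L (\<Omega> h)"], rule ext)
    fix x
    have "trig h (m - n) x = trig h m x * trig h (- n) x" for n
      using trig_add[of h m "- n" x] by simp
    then show "trig h m x * fourier_sum h v F x = (\<Sum>n\<in>F. (of_real k * v n) * trig h (m - n) x)"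
      by (simp add: fourier_sum_def k_def sum_distrib_left ac_simps)
  qed
  also have "\<dots> = (\<Sum>n\<in>F. (of_real k * v n) * (LINT x|\<Omega> h. trig h (m - n) x))"
    by (subst Bochner_Integration.integral_sum) (auto intro!: int L2_cmult)
  also have "\<dots> = 0"
    using insert(2) by (intro sum.neutral) (auto simp: trig_orthogonal[OF h])
  finally have cross0: "(LINT x|\<Omega> h. trig h m x * fourier_sum h v F x) = 0" .
  have "(LINT x|\<Omega> h. trig h m x * ?H x) = (LINT x|\<Omega> h. trig h m x * G x)"
    using cross0 int[OF trig_mult_L2[OF G]] int[OF trig_mult_L2[OF fourier_sum_L2[OF insert(1)]]]
    by (simp add: right_diff_distrib)
  also have "\<dots> = of_real (sqrt (2 * pi)) * idft h G m"
    by (simp add: idft_trig flip: of_real_mult)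
  finally have cross: "(LINT x|\<Omega> h. cnj (trig h (- m) x) * ?H x) = of_real (sqrt (2 * pi)) * idft h G m"
    by (simp add: cnj)
  have k1: "k * sqrt (2 * pi) = h" by (simp add: k_def)
  have k2: "k^2 * (2 * pi / h) = h" using h by (simp add: k_def power_divide power2_eq_square)
  have "sqint (freqs h) (\<lambda>x. G x - fourier_sum h v (insert m F) x)
     = sqint (freqs h) ?H - 2 * Re (cnj ?a * (of_real (sqrt (2 * pi)) * idft h G m)) + (cmod ?a)^2 * (2 * pi / h)"
    unfolding eq sqint_diff_cmult[OF H trig_L2] cross trig0 ..
  also have "cnj ?a * (of_real (sqrt (2 * pi)) * idft h G m) = of_real (k * sqrt (2 * pi)) * (cnj (v m) * idft h G m)"
    by simp
  also have "(cmod ?a)^2 * (2 * pi / h) = (k^2 * (2 * pi / h)) * (cmod (v m))^2"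
    by (simp add: norm_mult power_mult_distrib)
  finally show ?case using insert unfolding k1 k2 by (simp add: algebra_simps)
qed

lemma sqint_fourier_sum_eq:
  "0 < h \<Longrightarrow> finite F \<Longrightarrow> sqint (freqs h) (fourier_sum h v F) = h * (\<Sum>n\<in>F. (cmod (v n))^2)"
  using sqint_fourier_sum[of h "\<lambda>_. 0" F v] by (simp add: L2_zero sqint_def idft_def)

lemma bessel:
  assumes "0 < h" "G \<in> L2 (freqs h)" "finite F"
  shows "h * (\<Sum>n\<in>F. (cmod (idft h G n))^2) \<le> sqint (freqs h) G"
proof -
  have "Re (cnj z * z) = (cmod z)^2" for z unfolding cmod_power2 by (simp add: power2_eq_square)
  then have "sqint (freqs h) (\<lambda>x. G x - fourier_sum h (idft h G) F x)
    = sqint (freqs h) G - h * (\<Sum>n\<in>F. (cmod (idft h G n))^2)"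
    using sqint_fourier_sum[OF assms, of "idft h G"] by simp
  then show ?thesis using sqint_nonneg by (metis diff_ge_0_iff_ge)
qed

lemma idft_ell2:
  assumes "0 < h" "G \<in> L2 (freqs h)"
  shows "idft h G \<in> ell2" and "ell2_norm h (idft h G) \<le> ennreal (sqrt (sqint (freqs h) G))"
proof -
  have b: "(\<Sum>n\<in>F. (cmod (idft h G n))^2) \<le> sqint (freqs h) G / h" if "finite F" for F
    using bessel[OF assms that] assms by (simp add: field_simps)
  have s: "(\<lambda>n. (cmod (idft h G n))^2) summable_on UNIV"
    by (rule nonneg_bdd_above_summable_on) (use b in \<open>auto intro!: bdd_aboveI2\<close>)
  then show e: "idft h G \<in> ell2" by (simp add: ell2_def)
  have "(\<Sum>\<^sub>\<infinity>n. (cmod (idft h G n))^2) \<le> sqint (freqs h) G / h"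
    by (rule infsum_le_finite_sums[OF s b])
  then have "h * (\<Sum>\<^sub>\<infinity>n. (cmod (idft h G n))^2) \<le> sqint (freqs h) G"
    using assms by (simp add: field_simps)
  then show "ell2_norm h (idft h G) \<le> ennreal (sqrt (sqint (freqs h) G))"
    using e by (simp add: ell2_norm_def ennreal_leI)
qed

lemma has_dft_eq:
  "has_dft h v g \<longleftrightarrow> g \<in> L2 (freqs h) \<and>
     ((\<lambda>N. \<integral>\<^sup>+ x. ennreal ((cmod (fourier_sum h v {- int N..int N} x - g x))^2) \<partial>\<Omega> h) \<longlonglongrightarrow> 0)"
  unfolding has_dft_def tendsto_L2_def fourier_sum_def trig_def by simp

lemma has_dft_sqint:
  assumes "has_dft h v g"
  shows "(\<lambda>N. sqint (freqs h) (\<lambda>x. fourier_sum h v {- int N..int N} x - g x)) \<longlonglongrightarrow> 0"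
proof -
  have "(\<lambda>x. fourier_sum h v {- int N..int N} x - g x) \<in> L2 (freqs h)" for N
    using assms fourier_sum_L2 by (intro L2_diff) (auto simp: has_dft_eq)
  then have "(\<lambda>N. ennreal (sqint (freqs h) (\<lambda>x. fourier_sum h v {- int N..int N} x - g x))) \<longlonglongrightarrow> ennreal 0"
    using assms by (simp add: has_dft_eq nn_integral_L2)
  then show ?thesis by (simp only: tendsto_ennreal_iff sqint_nonneg order_refl eventually_True)
qed

text \<open>Pointwise \<open>y \<le> d + y^2 / d\<close>, integrated over an interval of length
  \<open>2 * pi / h\<close>. The free parameter \<open>d\<close> is tuned at the point of use and
  replaces the Cauchy-Schwarz inequality.\<close>

lemma L1_le_L2:
  assumes f: "f \<in> L2 (freqs h)" and h: "0 < h" and d: "0 < d"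
  shows "(LINT x|\<Omega> h. cmod (f x)) \<le> d * (2 * pi / h) + sqint (freqs h) f / d"
proof -
  have i: "integrable (\<Omega> h) f" by (rule freqs_integrable[OF f])
  have "(LINT x|\<Omega> h. cmod (f x)) \<le> (LINT x|\<Omega> h. d + (cmod (f x))^2 / d)"
  proof (rule integral_mono)
    show "integrable (\<Omega> h) (\<lambda>x. d + (cmod (f x))^2 / d)"
      using f finite_measure.integrable_const[OF finite_measure_freqs, of h d] by (auto simp: L2_def)
    show "cmod (f x) \<le> d + (cmod (f x))^2 / d" for x
    proof -
      have "0 \<le> (cmod (f x) - d)^2 + d * cmod (f x)" using d by simp
      then have "d * cmod (f x) \<le> d * d + (cmod (f x))^2" by (simp add: power2_eq_square algebra_simps)
      then show ?thesis using d by (simp add: field_simps power2_eq_square)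
    qed
  qed (use i in auto)
  also have "\<dots> = d * (2 * pi / h) + sqint (freqs h) f / d"
  proof -
    have "measure (\<Omega> h) (freqs h) = 2 * pi / h"
      using h by (simp add: freqs_def measure_restrict_space)
    then show ?thesis
      using f finite_measure.integrable_const[OF finite_measure_freqs, of h d] by (auto simp: L2_def sqint_def)
  qed
  finally show ?thesis .
qed

text \<open>The symmetric partial sum has \<open>n\<close>-th coefficient exactly \<open>v n\<close>
  as soon as \<open>N\<close> reaches \<open>\<bar>n\<bar>\<close>. Bessel's inequality for the
  single index \<open>n\<close> then bounds \<open>v n - idft h g n\<close> by the L^2 distance of
  that partial sum from \<open>g\<close>, which tends to 0.\<close>

lemma idft_has_dft:
  assumes h: "0 < h" and g: "has_dft h v g"
  shows "idft h g n = v n"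
proof -
  have gL: "g \<in> L2 (freqs h)" using g by (simp add: has_dft_eq)
  define D where "D N = sqint (freqs h) (\<lambda>x. fourier_sum h v {- int N..int N} x - g x)" for N
  have lim: "D \<longlonglongrightarrow> 0" unfolding D_def using has_dft_sqint[OF g] .
  have b: "(cmod (v n - idft h g n))^2 \<le> D N / h" if N: "nat \<bar>n\<bar> \<le> N" for N
  proof -
    let ?S = "fourier_sum h v {- int N..int N}"
    have S: "?S \<in> L2 (freqs h)" by (simp add: fourier_sum_L2)
    note int = freqs_integrable[of _ h]
    define k where "k = complex_of_real (h / sqrt (2 * pi))"
    have "idft h ?S n = of_real (1 / sqrt (2 * pi)) * (LINT x|\<Omega> h. (\<Sum>m\<in>{- int N..int N}. (k * v m) * trig h (n - m) x))"
    proof -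
      have "trig h n x * ?S x = (\<Sum>m\<in>{- int N..int N}. (k * v m) * trig h (n - m) x)" for x
        using trig_add[of h n "- _" x] by (simp only: fourier_sum_def k_def[symmetric] sum_distrib_left) (simp add: ac_simps)
      then show ?thesis by (simp add: idft_trig)
    qed
    also have "\<dots> = of_real (1 / sqrt (2 * pi)) * (\<Sum>m\<in>{- int N..int N}. if m = n then (k * v m) * of_real (2 * pi / h) else 0)"
    proof -
      have "(LINT x|\<Omega> h. (\<Sum>m\<in>{- int N..int N}. (k * v m) * trig h (n - m) x))
          = (\<Sum>m\<in>{- int N..int N}. (k * v m) * (LINT x|\<Omega> h. trig h (n - m) x))"
        by (subst Bochner_Integration.integral_sum) (auto intro!: int L2_cmult)
      also have "\<dots> = (\<Sum>m\<in>{- int N..int N}. if m = n then (k * v m) * of_real (2 * pi / h) else 0)"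
        by (intro sum.cong refl) (simp add: trig_orthogonal[OF h])
      finally show ?thesis by (rule arg_cong)
    qed
    also have "\<dots> = of_real ((1 / sqrt (2 * pi)) * (h / sqrt (2 * pi)) * (2 * pi / h)) * v n"
    proof -
      have "n \<in> {- int N..int N}" using N by auto
      then have "(\<Sum>m\<in>{- int N..int N}. if m = n then (k * v m) * of_real (2 * pi / h) else 0)
          = (k * v n) * of_real (2 * pi / h)" by (simp only: sum.delta' sum.delta finite_atLeastAtMost_int if_True)
      then show ?thesis by (simp only: k_def of_real_mult ac_simps)
    qed
    also have "(1 / sqrt (2 * pi)) * (h / sqrt (2 * pi)) * (2 * pi / h) = 1" using h by simp
    finally have Sn: "idft h ?S n = v n" by simp
    have eq: "v n - idft h g n = idft h (\<lambda>x. ?S x - g x) n"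
      unfolding Sn[symmetric] idft_trig
      using int[OF trig_mult_L2[OF S, of h n]] int[OF trig_mult_L2[OF gL, of h n]] by (simp add: right_diff_distrib)
    then show ?thesis using bessel[OF h L2_diff[OF S gL], of "{n}"] h
      unfolding eq D_def by (simp add: field_simps)
  qed
  have "(cmod (v n - idft h g n))^2 \<le> 0 / h"
    using tendsto_divide[OF lim tendsto_const[of h]] h b
    by (intro LIMSEQ_le_const[of "\<lambda>N. D N / h"]) auto
  then show ?thesis by simp
qed

lemma idft_inject_AE:
  assumes h: "0 < h" and fg: "f \<in> L2 (freqs h)" "g \<in> L2 (freqs h)" and eq: "\<And>n. idft h f n = idft h g n"
  shows "AE x in \<Omega> h. f x = g x"
proof -
  note int = freqs_integrable[of _ h]
  have "(LINT x|\<Omega> h. trig h n x * (f x - g x)) = 0" for n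
    using eq[of n] int[OF trig_mult_L2[OF fg(1), of h n]] int[OF trig_mult_L2[OF fg(2), of h n]]
    by (simp add: idft_trig right_diff_distrib)
  from coefficients_zero_imp_AE_zero[OF h int[OF L2_diff[OF fg]] this]
  show ?thesis by simp
qed

text \<open>The Riesz-Fischer theorem. The partial sums are Cauchy in L^2 with squared error
  \<open>\<tau> N\<close>; an almost everywhere limit of a subsequence is found through L^1, and
  Fatou's lemma carries the same error over to that limit.\<close>

lemma has_dft_exists:
  assumes h: "0 < h" and v: "v \<in> ell2"
  shows "\<exists>g. has_dft h v g"
proof -
  define S where "S N = fourier_sum h v {- int N..int N}" for N
  have S: "S N \<in> L2 (freqs h)" for N by (simp add: S_def fourier_sum_L2)
  note int = freqs_integrable[of _ h]
  have sm: "(\<lambda>n. (cmod (v n))^2) summable_on UNIV" using v by (simp add: ell2_def)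
  define V where "V = (\<Sum>\<^sub>\<infinity>n. (cmod (v n))^2)"
  \<comment> \<open>This is \<open>h\<close> times the tail of the series outside [-N, N]. By
    Parseval it bounds the squared distance from \<open>S N\<close> to every later partial
    sum.\<close>
  define \<tau> where "\<tau> N = h * (V - (\<Sum>n\<in>{- int N..int N}. (cmod (v n))^2))" for N
  have "((\<lambda>n. (cmod (v n))^2) has_sum V) UNIV" unfolding V_def using sm by (rule has_sum_infsum)
  then have lim0: "(sum (\<lambda>n. (cmod (v n))^2) \<longlongrightarrow> V) (finite_subsets_at_top UNIV)"
    by (simp add: has_sum_def)
  have "filterlim (\<lambda>N. {- int N..int N}) (finite_subsets_at_top UNIV) sequentially"
    unfolding filterlim_finite_subsets_at_top
  proof (intro allI impI)
    fix X :: "int set" assume "finite X \<and> X \<subseteq> UNIV"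
    then have "\<forall>x\<in>X. \<bar>x\<bar> \<le> Max (abs ` X)" by simp
    then obtain B where "\<forall>x\<in>X. \<bar>x\<bar> \<le> B" by blast
    then show "\<forall>\<^sub>F N in sequentially. finite {- int N..int N} \<and> X \<subseteq> {- int N..int N} \<and> {- int N..int N} \<subseteq> UNIV"
      by (intro eventually_sequentiallyI[of "nat B"]) force
  qed
  from filterlim_compose[OF lim0 this]
  have "(\<lambda>N. V - (\<Sum>n\<in>{- int N..int N}. (cmod (v n))^2)) \<longlonglongrightarrow> V - V"
    by (intro tendsto_diff tendsto_const)
  then have \<tau>_lim: "\<tau> \<longlonglongrightarrow> 0" unfolding \<tau>_def[abs_def]
    using tendsto_mult[OF tendsto_const[of h], of _ 0 sequentially] by simp
  have \<tau>_nonneg: "0 \<le> \<tau> N" for N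
    unfolding \<tau>_def V_def using h finite_sum_le_infsum[OF sm, of "{- int N..int N}"] by simp
  have SS: "sqint (freqs h) (\<lambda>x. S M x - S N x) \<le> \<tau> N" if "N \<le> M" for M N
  proof -
    have sub: "{- int N..int N} \<subseteq> {- int M..int M}" using that by auto
    have "S M x - S N x = fourier_sum h v ({- int M..int M} - {- int N..int N}) x" for x
      using sum_diff[OF _ sub, of "\<lambda>n. trig h (- n) x * v n"]
      by (simp add: S_def fourier_sum_def right_diff_distrib[symmetric] del: of_real_divide)
    then have "sqint (freqs h) (\<lambda>x. S M x - S N x) = h * (\<Sum>n\<in>{- int M..int M} - {- int N..int N}. (cmod (v n))^2)"
      using sqint_fourier_sum_eq[OF h] by simp
    also have "\<dots> = h * ((\<Sum>n\<in>{- int M..int M}. (cmod (v n))^2) - (\<Sum>n\<in>{- int N..int N}. (cmod (v n))^2))"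
      using sub by (simp add: sum_diff)
    also have "\<dots> \<le> \<tau> N"
      unfolding \<tau>_def V_def using h finite_sum_le_infsum[OF sm, of "{- int M..int M}"] by simp
    finally show ?thesis .
  qed
  have SS2: "sqint (freqs h) (\<lambda>x. S M x - S N x) \<le> max (\<tau> N) (\<tau> M)" for M N
  proof (cases "N \<le> M")
    case False
    have "sqint (freqs h) (\<lambda>x. S M x - S N x) = sqint (freqs h) (\<lambda>x. S N x - S M x)"
      by (simp add: sqint_def norm_minus_commute)
    then show ?thesis using SS[of M N] False by simp
  qed (use SS in \<open>simp add: max.coboundedI1\<close>)
  have cauchy: "\<exists>N. \<forall>i\<ge>N. \<forall>j\<ge>N. (LINT x|\<Omega> h. norm (S i x - S j x)) < e" if e: "0 < e" for e :: real
  proof -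
    \<comment> \<open>Chosen so that both terms of \<open>L1_le_L2\<close> are at most
      \<open>e / 4\<close>: the first by this value of \<open>d\<close>, the second once the tail is
      below \<open>d * (e / 4)\<close>.\<close>
    define d where "d = e * h / (8 * pi)"
    have d: "0 < d" using e h by (simp add: d_def)
    have dm: "d * (2 * pi / h) = e / 4" using h by (simp add: d_def)
    have "\<forall>\<^sub>F N in sequentially. \<tau> N < d * (e / 4)"
      using \<tau>_lim d e by (intro order_tendstoD(2)) auto
    then obtain N where N: "\<And>n. N \<le> n \<Longrightarrow> \<tau> n < d * (e / 4)" by (auto simp: eventually_sequentially)
    have "(LINT x|\<Omega> h. norm (S i x - S j x)) < e" if "N \<le> i" "N \<le> j" for i j
    proof -
      have "sqint (freqs h) (\<lambda>x. S i x - S j x) / d \<le> e / 4"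
        using SS2[of i j] N[OF that(1)] N[OF that(2)] d by (simp add: field_simps)
      then show ?thesis using L1_le_L2[OF L2_diff[OF S S] h d, of i j] e unfolding dm by linarith
    qed
    then show ?thesis by blast
  qed
  obtain r where r: "strict_mono r" "AE x in \<Omega> h. Cauchy (\<lambda>i. S (r i) x)"
    by (rule cauchy_L1_AE_cauchy_subseq[of "\<Omega> h" S]) (use int[OF S] cauchy in auto)
  define G where "G x = lim (\<lambda>i. S (r i) x)" for x
  have S_meas: "S N \<in> borel_measurable (\<Omega> h)" for N using S by (simp add: L2_def)
  have G_meas: "G \<in> borel_measurable (\<Omega> h)"
    unfolding G_def[abs_def] by (rule borel_measurable_lim_metric) (rule S_meas)
  have G_lim: "AE x in \<Omega> h. (\<lambda>i. S (r i) x) \<longlonglongrightarrow> G x"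
    using r(2) by eventually_elim (simp add: G_def Cauchy_convergent_iff convergent_LIMSEQ_iff)
  let ?I = "\<lambda>N. \<integral>\<^sup>+ x. ennreal ((cmod (S N x - G x))^2) \<partial>\<Omega> h"
  have bound: "?I N \<le> ennreal (\<tau> N)" for N
  proof -
    have "?I N
        = (\<integral>\<^sup>+ x. liminf (\<lambda>i. ennreal ((cmod (S N x - S (r i) x))^2)) \<partial>\<Omega> h)"
    proof (rule nn_integral_cong_AE, use G_lim in eventually_elim)
      case (elim x)
      then have "(\<lambda>i. ennreal ((cmod (S N x - S (r i) x))^2)) \<longlonglongrightarrow> ennreal ((cmod (S N x - G x))^2)"
        by (intro tendsto_ennrealI tendsto_intros)
      then show ?case by (intro lim_imp_Liminf[symmetric]) auto
    qed
    also have "\<dots> \<le> liminf (\<lambda>i. \<integral>\<^sup>+ x. ennreal ((cmod (S N x - S (r i) x))^2) \<partial>\<Omega> h)"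
      using S_meas by (intro nn_integral_liminf) measurable
    also have "\<dots> \<le> ennreal (\<tau> N)"
    proof (rule Liminf_le)
      have "(\<integral>\<^sup>+ x. ennreal ((cmod (S N x - S (r i) x))^2) \<partial>\<Omega> h) \<le> ennreal (\<tau> N)" if "N \<le> i" for i
      proof -
        have "N \<le> r i" using that seq_suble[OF r(1), of i] by simp
        then have "sqint (freqs h) (\<lambda>x. S N x - S (r i) x) \<le> \<tau> N"
          using SS[of N "r i"] by (simp add: sqint_def norm_minus_commute)
        then show ?thesis using nn_integral_L2[OF L2_diff[OF S S]] by (simp add: ennreal_leI)
      qed
      then show "\<forall>\<^sub>F i in sequentially. (\<integral>\<^sup>+ x. ennreal ((cmod (S N x - S (r i) x))^2) \<partial>\<Omega> h) \<le> ennreal (\<tau> N)"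
        by (intro eventually_sequentiallyI)
    qed simp
    finally show ?thesis .
  qed
  \<comment> \<open>The Fatou bound at \<open>N = 0\<close> is already finite, so \<open>G\<close>
    differs from a function in L^2 by a function in L^2.\<close>
  have diff: "(\<lambda>x. S 0 x - G x) \<in> L2 (freqs h)"
    unfolding L2_def using bound[of 0] S_meas[of 0] G_meas
    by (auto intro!: integrableI_nonneg intro: le_less_trans)
  have G: "G \<in> L2 (freqs h)" using L2_diff[OF S[of 0] diff] by simp
  have "?I \<longlonglongrightarrow> 0"
  proof (rule tendsto_sandwich[where f = "\<lambda>_. 0" and h = "\<lambda>N. ennreal (\<tau> N)"])
    show "\<forall>\<^sub>F N in sequentially. ?I N \<le> ennreal (\<tau> N)"
      using bound by simp
    show "(\<lambda>N. ennreal (\<tau> N)) \<longlonglongrightarrow> 0" using tendsto_ennrealI[OF \<tau>_lim] by simp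
  qed auto
  then have "has_dft h v G" using G by (simp add: has_dft_eq S_def)
  then show ?thesis by blast
qed

text \<open>\<open>dft\<close> is a Hilbert choice, so a transform must exist before anything is
  known about it. It then has the same coefficients as \<open>g\<close>, and completeness turns this
  into equality almost everywhere. This is what makes \<open>localize\<close> computable on
  synthesized sequences.\<close>

lemma dft_idft:
  assumes h: "0 < h" and g: "g \<in> L2 (freqs h)"
  shows "dft h (idft h g) \<in> L2 (freqs h)" and "AE x in \<Omega> h. dft h (idft h g) x = g x"
proof -
  have *: "has_dft h (idft h g) (dft h (idft h g))"
    unfolding dft_def using has_dft_exists[OF h idft_ell2(1)[OF h g]] by (rule someI_ex)
  then show "dft h (idft h g) \<in> L2 (freqs h)" by (simp add: has_dft_eq)
  then show "AE x in \<Omega> h. dft h (idft h g) x = g x"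
    using idft_has_dft[OF h *] by (intro idft_inject_AE[OF h _ g]) auto
qed

section \<open>The Fourier transform on the line\<close>

definition fourier_partial :: "(real \<Rightarrow> complex) \<Rightarrow> real \<Rightarrow> real \<Rightarrow> complex" where
  "fourier_partial v R y = of_real (1 / sqrt (2 * pi)) * (LINT x|lebesgue_on {- R..R}. cis (- (y * x)) * v x)"

lemma cis_mult_integrable:
  assumes "v \<in> L2 UNIV"
  shows "integrable (lebesgue_on {- R..R}) v" "integrable (lebesgue_on {- R..R}) (\<lambda>x. cis (- (y * x)) * v x)"
proof -
  show v: "integrable (lebesgue_on {- R..R}) v"
    using L2_mono[OF assms, of "{- R..R}"] by (intro L2_integrable) (auto simp: finite_measure_lebesgue_on)
  have "continuous_on UNIV (\<lambda>x. cis (- (y * x)))"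
    unfolding cis_conv_exp by (intro continuous_intros)
  then have "(\<lambda>x. cis (- (y * x))) \<in> borel_measurable (lebesgue_on {- R..R})"
    by (intro continuous_imp_measurable_on_sets_lebesgue) (auto intro: continuous_on_subset)
  then show "integrable (lebesgue_on {- R..R}) (\<lambda>x. cis (- (y * x)) * v x)"
    using v by (intro Bochner_Integration.integrable_bound[OF v]) (auto simp: norm_mult)
qed

text \<open>Continuity is wanted for measurability in the frequency, on which splitting the squared
  L^2 distance of a sum depends.\<close>

lemma fourier_partial_continuous:
  assumes "v \<in> L2 UNIV"
  shows "continuous_on UNIV (fourier_partial v R)"
proof -
  have "(\<lambda>n. LINT x|lebesgue_on {- R..R}. cis (- (X n * x)) * v x) \<longlonglongrightarrow> (LINT x|lebesgue_on {- R..R}. cis (- (y * x)) * v x)"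
    if "X \<longlonglongrightarrow> y" for X y
  proof (rule integral_dominated_convergence[where w = "\<lambda>x. cmod (v x)"])
    show "AE x in lebesgue_on {- R..R}. (\<lambda>n. cis (- (X n * x)) * v x) \<longlonglongrightarrow> cis (- (y * x)) * v x"
      unfolding cis_conv_exp by (intro AE_I2 tendsto_intros that)
  qed (use cis_mult_integrable[OF assms, of R] in \<open>auto simp: norm_mult\<close>)
  then have "continuous_on UNIV (\<lambda>y. LINT x|lebesgue_on {- R..R}. cis (- (y * x)) * v x)"
    unfolding continuous_on_eq_continuous_at[OF open_UNIV] continuous_at_sequentially by (auto simp: o_def)
  then show ?thesis unfolding fourier_partial_def[abs_def] by (intro continuous_intros)
qed

lemma fourier_partial_measurable:
  "v \<in> L2 UNIV \<Longrightarrow> fourier_partial v R \<in> borel_measurable (lebesgue_on UNIV)"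
  using fourier_partial_continuous by (intro continuous_imp_measurable_on_sets_lebesgue) auto

lemma fourier_partial_lincomb:
  assumes "v \<in> L2 UNIV" "w \<in> L2 UNIV"
  shows "fourier_partial (\<lambda>x. a * v x + b * w x) R y = a * fourier_partial v R y + b * fourier_partial w R y"
proof -
  have "cis (- (y * x)) * (a * v x + b * w x) = a * (cis (- (y * x)) * v x) + b * (cis (- (y * x)) * w x)" for x
    by (simp add: algebra_simps)
  note eq = this
  show ?thesis
    unfolding fourier_partial_def eq
    using cis_mult_integrable(2)[OF assms(1), of R y] cis_mult_integrable(2)[OF assms(2), of R y]
    by (simp add: distrib_left)
qed

lemma has_fourier_eq:
  "has_fourier v g \<longleftrightarrow> g \<in> L2 UNIV \<and>
    ((\<lambda>R. \<integral>\<^sup>+ x. ennreal ((cmod (fourier_partial v R x - g x))^2) \<partial>lebesgue_on UNIV) \<longlongrightarrow> 0) at_top"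
  by (simp add: has_fourier_def tendsto_L2_def fourier_partial_def)

lemma nn_integral_add_square_le:
  assumes "f \<in> borel_measurable M" "g \<in> borel_measurable M"
  shows "(\<integral>\<^sup>+ x. ennreal ((cmod (f x + g x))^2) \<partial>M)
    \<le> 2 * (\<integral>\<^sup>+ x. ennreal ((cmod (f x))^2) \<partial>M) + 2 * (\<integral>\<^sup>+ x. ennreal ((cmod (g x))^2) \<partial>M)"
proof -
  have "(\<integral>\<^sup>+ x. ennreal ((cmod (f x + g x))^2) \<partial>M) \<le> (\<integral>\<^sup>+ x. 2 * ennreal ((cmod (f x))^2) + 2 * ennreal ((cmod (g x))^2) \<partial>M)"
  proof (rule nn_integral_mono)
    fix x
    have "ennreal ((cmod (f x + g x))^2) \<le> ennreal (2 * (cmod (f x))^2 + 2 * (cmod (g x))^2)"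
      by (intro ennreal_leI cmod_add_square_le)
    then show "ennreal ((cmod (f x + g x))^2) \<le> 2 * ennreal ((cmod (f x))^2) + 2 * ennreal ((cmod (g x))^2)"
      by (simp add: ennreal_plus ennreal_mult)
  qed
  also have "\<dots> = 2 * (\<integral>\<^sup>+ x. ennreal ((cmod (f x))^2) \<partial>M) + 2 * (\<integral>\<^sup>+ x. ennreal ((cmod (g x))^2) \<partial>M)"
    using assms by (subst nn_integral_add) (auto simp: nn_integral_cmult)
  finally show ?thesis .
qed

text \<open>This bypasses Plancherel's theorem: \<open>sobolev\<close> already carries a transform
  of each datum, and linearity of \<open>fourier_partial\<close> produces one for their
  combinations.\<close>

lemma has_fourier_lincomb:
  assumes v: "v \<in> L2 UNIV" "w \<in> L2 UNIV" and f: "has_fourier v f" "has_fourier w g"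
  shows "has_fourier (\<lambda>x. a * v x + b * w x) (\<lambda>y. a * f y + b * g y)"
proof -
  let ?I = "\<lambda>f. \<integral>\<^sup>+ y. ennreal ((cmod (f y))^2) \<partial>lebesgue_on UNIV"
  let ?V = "\<lambda>R y. fourier_partial v R y - f y" and ?W = "\<lambda>R y. fourier_partial w R y - g y"
  let ?U = "\<lambda>R y. fourier_partial (\<lambda>x. a * v x + b * w x) R y - (a * f y + b * g y)"
  have L: "f \<in> L2 UNIV" "g \<in> L2 UNIV" using f by (auto simp: has_fourier_eq)
  have lim: "((\<lambda>R. ?I (?V R)) \<longlongrightarrow> 0) at_top"
    "((\<lambda>R. ?I (?W R)) \<longlongrightarrow> 0) at_top" using f by (auto simp: has_fourier_eq)
  have m: "(?V R) \<in> borel_measurable (lebesgue_on UNIV)"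
    "(?W R) \<in> borel_measurable (lebesgue_on UNIV)" for R
    using fourier_partial_measurable[OF v(1)] fourier_partial_measurable[OF v(2)] L by (auto simp: L2_def)
  have scale: "?I (\<lambda>y. c * k y) = ennreal ((cmod c)^2) * ?I k" if "k \<in> borel_measurable (lebesgue_on UNIV)" for c k
    using that by (simp add: norm_mult power_mult_distrib ennreal_mult nn_integral_cmult)
  have "((\<lambda>R. ?I (?U R)) \<longlongrightarrow> 0) at_top"
  proof (rule tendsto_sandwich[where f = "\<lambda>_. 0"])
    show "\<forall>\<^sub>F R in at_top. ?I (?U R)
      \<le> 2 * (ennreal ((cmod a)^2) * ?I (?V R)) + 2 * (ennreal ((cmod b)^2) * ?I (?W R))"
    proof (intro always_eventually allI)
      fix R
      have "?U R y
          = a * ?V R y + b * ?W R y" for y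
        by (simp add: fourier_partial_lincomb[OF v] algebra_simps)
      then show "?I (?U R)
      \<le> 2 * (ennreal ((cmod a)^2) * ?I (?V R)) + 2 * (ennreal ((cmod b)^2) * ?I (?W R))"
        using nn_integral_add_square_le[of "\<lambda>y. a * ?V R y" "lebesgue_on UNIV" "\<lambda>y. b * ?W R y"] m[of R]
        by (simp only: scale[OF m(1)] scale[OF m(2)] borel_measurable_times borel_measurable_const)
    qed
    show "((\<lambda>R. 2 * (ennreal ((cmod a)^2) * ?I (?V R)) + 2 * (ennreal ((cmod b)^2) * ?I (?W R))) \<longlongrightarrow> 0) at_top"
    proof -
      have z: "((\<lambda>R. 2 * (ennreal c * F R)) \<longlongrightarrow> 0) at_top" if "(F \<longlongrightarrow> (0 :: ennreal)) at_top" for c and F :: "real \<Rightarrow> ennreal"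
        using ennreal_tendsto_cmult[OF _ ennreal_tendsto_cmult[OF _ that], of 2 "ennreal c"] by simp
      show ?thesis using tendsto_add[OF z[OF lim(1)] z[OF lim(2)]] by simp
    qed
  qed auto
  then show ?thesis using L2_add[OF L2_cmult[OF L(1)] L2_cmult[OF L(2)]] by (simp add: has_fourier_eq)
qed

text \<open>By linearity the zero function has transform \<open>f - g\<close>, while all its partial
  transforms vanish. The L^2 norm of \<open>f - g\<close> is thus a constant tending to 0.\<close>

lemma has_fourier_unique:
  assumes v: "v \<in> L2 UNIV" and f: "has_fourier v f" "has_fourier v g"
  shows "AE y in lebesgue. f y = g y"
proof -
  have "has_fourier (\<lambda>x. 1 * v x + (- 1) * v x) (\<lambda>y. 1 * f y + (- 1) * g y)"
    by (rule has_fourier_lincomb[OF v v f])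
  then have fg: "(\<lambda>y. f y - g y) \<in> L2 UNIV"
    "((\<lambda>R. \<integral>\<^sup>+ y. ennreal ((cmod (fourier_partial (\<lambda>x. 0) R y - (f y - g y)))^2) \<partial>lebesgue_on UNIV) \<longlongrightarrow> 0) (at_top :: real filter)"
    by (simp_all add: has_fourier_eq)
  have "fourier_partial (\<lambda>x. 0) R y - (f y - g y) = - (f y - g y)" for R y
    by (simp add: fourier_partial_def)
  then have "((\<lambda>R :: real. \<integral>\<^sup>+ y. ennreal ((cmod (f y - g y))^2) \<partial>lebesgue_on UNIV) \<longlongrightarrow> 0) at_top"
    using fg(2) by (simp only: norm_minus_cancel)
  then have "(\<integral>\<^sup>+ y. ennreal ((cmod (f y - g y))^2) \<partial>lebesgue_on UNIV) = 0"
    by (simp only: tendsto_const_iff trivial_limit_at_top_linorder not_False_eq_True)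
  moreover have "(\<lambda>y. ennreal ((cmod (f y - g y))^2)) \<in> borel_measurable (lebesgue_on UNIV)"
  proof -
    have "integrable (lebesgue_on UNIV) (\<lambda>y. (cmod (f y - g y))^2)" using fg(1) by (simp add: L2_def)
    from borel_measurable_integrable[OF this] show ?thesis by simp
  qed
  ultimately have "AE y in lebesgue_on UNIV. ennreal ((cmod (f y - g y))^2) = 0"
    by (subst (asm) nn_integral_0_iff_AE)
  then have "AE y in lebesgue_on UNIV. f y = g y" by simp
  then show ?thesis by (simp only: lebesgue_on_UNIV_eq)
qed

lemma has_fourier_fourier: "has_fourier v g \<Longrightarrow> has_fourier v (fourier v)"
  unfolding fourier_def by (rule someI[of "has_fourier v"])

lemma fourier_lincomb:
  assumes v: "v \<in> sobolev r" "w \<in> sobolev q"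
  shows "has_fourier (\<lambda>x. a * v x + b * w x) (fourier (\<lambda>x. a * v x + b * w x))"
    and "AE y in lebesgue. fourier (\<lambda>x. a * v x + b * w x) y = a * fourier v y + b * fourier w y"
proof -
  have vw: "v \<in> L2 UNIV" "w \<in> L2 UNIV" using v by (auto simp: sobolev_def)
  have *: "has_fourier (\<lambda>x. a * v x + b * w x) (\<lambda>y. a * fourier v y + b * fourier w y)"
    using v by (intro has_fourier_lincomb vw) (auto simp: sobolev_def)
  then show **: "has_fourier (\<lambda>x. a * v x + b * w x) (fourier (\<lambda>x. a * v x + b * w x))"
    by (rule has_fourier_fourier)
  show "AE y in lebesgue. fourier (\<lambda>x. a * v x + b * w x) y = a * fourier v y + b * fourier w y"
    by (rule has_fourier_unique[OF _ ** *]) (intro L2_add L2_cmult vw)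
qed

lemma bessel_weight_measurable: "(\<lambda>x :: real. (1 + x^2) powr r) \<in> borel_measurable lebesgue"
proof -
  have "continuous_on UNIV (\<lambda>x :: real. (1 + x^2) powr r)"
    by (rule continuous_on_powr, intro continuous_intros, intro continuous_intros)
      (auto simp: add_nonneg_eq_0_iff)
  then show ?thesis by (simp add: measurable_completion borel_measurable_continuous_onI)
qed

lemma sobolev_mono:
  assumes v: "v \<in> sobolev r" and q: "q \<le> r"
  shows "v \<in> sobolev q"
proof -
  have "integrable lebesgue (\<lambda>x. (1 + x^2) powr q * (cmod (fourier v x))^2)"
  proof (rule Bochner_Integration.integrable_bound)
    show "integrable lebesgue (\<lambda>x. (1 + x^2) powr r * (cmod (fourier v x))^2)" using v by (simp add: sobolev_def)
    have "fourier v \<in> borel_measurable lebesgue"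
      using v by (simp add: sobolev_def has_fourier_def L2_def lebesgue_on_UNIV_eq)
    moreover note bessel_weight_measurable[of q]
    ultimately show "(\<lambda>x. (1 + x^2) powr q * (cmod (fourier v x))^2) \<in> borel_measurable lebesgue" by simp
    show "AE x in lebesgue. norm ((1 + x^2) powr q * (cmod (fourier v x))^2) \<le> norm ((1 + x^2) powr r * (cmod (fourier v x))^2)"
      using q by (auto intro!: AE_I2 mult_right_mono powr_mono)
  qed
  then show ?thesis using v by (simp add: sobolev_def)
qed

section \<open>The damped system at a fixed frequency\<close>

text \<open>The damped mode has the characteristic roots \<open>- 1 / (2 e\<^sup>2) \<plusminus> d\<close> with \<open>d = damp_disc e k\<close>;
  \<open>sinhc\<close> also covers the double root \<open>d = 0\<close>.\<close>

definition sinhc :: "complex \<Rightarrow> complex \<Rightarrow> complex" where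
  "sinhc d z = (if d = 0 then z else sinh (d * z) / d)"

lemma DERIV_sinhc: "(sinhc d has_field_derivative cosh (d * z)) (at z)"
  unfolding sinhc_def by (cases "d = 0") (auto intro!: derivative_eq_intros)

lemma DERIV_cosh_scaled:
  "((\<lambda>z. cosh (d * z)) has_field_derivative d^2 * sinhc d z) (at z)"
  unfolding sinhc_def by (cases "d = 0") (auto intro!: derivative_eq_intros simp: power2_eq_square)

lemma sinhc_times_square: "sinhc d z * d^2 = d * sinh (d * z)"
  by (simp add: sinhc_def power2_eq_square)

definition damp_disc :: "real \<Rightarrow> real \<Rightarrow> complex" where
  "damp_disc e k = csqrt (of_real ((1 / (2 * e^2))^2 - k^2 / e^2))"

text \<open>The coefficient of \<open>sinhc\<close> is the initial slope of the factor next to the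
  exponential: \<open>- \<i> * of_real k * u\<close> is the derivative of the density at 0, and
  \<open>r / of_real (2 * e^2)\<close> undoes the slope of the exponential. \<open>damp_u\<close> is
  built in the same way.\<close>

definition damp_rho :: "real \<Rightarrow> real \<Rightarrow> complex \<Rightarrow> complex \<Rightarrow> real \<Rightarrow> complex" where
  "damp_rho e k r u t =
     exp (- of_real t / of_real (2 * e^2)) *
       (cosh (damp_disc e k * of_real t) * r
        + sinhc (damp_disc e k) (of_real t) * (r / of_real (2 * e^2) - \<i> * of_real k * u))"

definition damp_u :: "real \<Rightarrow> real \<Rightarrow> complex \<Rightarrow> complex \<Rightarrow> real \<Rightarrow> complex" where
  "damp_u e k r u t =
     exp (- of_real t / of_real (2 * e^2)) *
       (cosh (damp_disc e k * of_real t) * u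
        - sinhc (damp_disc e k) (of_real t) * (u / of_real (2 * e^2) + \<i> * of_real k * r / of_real (e^2)))"

lemma damp_0 [simp]: "damp_rho e k r u 0 = r" "damp_u e k r u 0 = u"
  by (simp_all add: damp_rho_def damp_u_def sinhc_def)

lemma damp_mode_deriv:
  fixes m :: complex
  assumes m: "m \<noteq> 0"
  shows "((\<lambda>t. exp (- of_real t / m) * (cosh (d * of_real t) * p + sinhc d (of_real t) * q)) has_vector_derivative
      exp (- of_real t / m) * (d^2 * sinhc d (of_real t) * p + cosh (d * of_real t) * q)
      - exp (- of_real t / m) * (cosh (d * of_real t) * p + sinhc d (of_real t) * q) / m) (at t)"
proof (rule has_vector_derivative_real_field)
  show "((\<lambda>z. exp (- z / m) * (cosh (d * z) * p + sinhc d z * q)) has_field_derivative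
      exp (- z / m) * (d^2 * sinhc d z * p + cosh (d * z) * q)
      - exp (- z / m) * (cosh (d * z) * p + sinhc d z * q) / m) (at z)" for z
    using m by (auto intro!: derivative_eq_intros DERIV_sinhc DERIV_cosh_scaled simp: field_simps sinhc_times_square)
qed

context
  fixes e k :: real and d m :: complex
  assumes e: "e \<noteq> 0"
  defines "d \<equiv> damp_disc e k" and "m \<equiv> complex_of_real (2 * e^2)"
begin

lemma damp_parameters: "m \<noteq> 0" "complex_of_real (e^2) = m / 2" "d^2 = (1 / m)^2 - 2 * (of_real k)^2 / m"
  using e unfolding d_def damp_disc_def m_def by (auto simp: field_simps)

lemma damp_rho_deriv:
  "(damp_rho e k r u has_vector_derivative - \<i> * of_real k * damp_u e k r u t) (at t)"
  unfolding damp_rho_def[abs_def] damp_u_def d_def[symmetric] m_def[symmetric] damp_parameters(2)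
  by (rule has_vector_derivative_eq_rhs[OF damp_mode_deriv[OF damp_parameters(1)]])
    (simp only: damp_parameters(3), simp add: damp_parameters(1) field_simps power2_eq_square)

lemma damp_u_deriv:
  "(damp_u e k r u has_vector_derivative
     - (\<i> * of_real k * damp_rho e k r u t + damp_u e k r u t) / of_real (e^2)) (at t)"
proof -
  have eq: "p * u - q * c = p * u + q * (- c)" for p q c :: complex by simp
  show ?thesis
    unfolding damp_rho_def damp_u_def[abs_def] d_def[symmetric] m_def[symmetric] damp_parameters(2) eq
    by (rule has_vector_derivative_eq_rhs[OF damp_mode_deriv[OF damp_parameters(1)]])
      (simp only: damp_parameters(3), simp add: damp_parameters(1) field_simps power2_eq_square)
qed

end

text \<open>The decay estimates are derived from the differential equations alone. The explicit
  formula serves only to provide a solution and its measurability in the frequency.\<close>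

locale damped_mode =
  fixes e k :: real and r u :: "real \<Rightarrow> complex"
  assumes eps: "0 < e"
    and r_deriv: "(r has_vector_derivative - \<i> * of_real k * u t) (at t)"
    and u_deriv: "(u has_vector_derivative - (\<i> * of_real k * r t + u t) / of_real (e^2)) (at t)"
begin

lemma component_derivs:
  "((\<lambda>t. Re (r t)) has_real_derivative k * Im (u t)) (at t)"
  "((\<lambda>t. Im (r t)) has_real_derivative - k * Re (u t)) (at t)"
  "((\<lambda>t. Re (u t)) has_real_derivative (k * Im (r t) - Re (u t)) / e^2) (at t)"
  "((\<lambda>t. Im (u t)) has_real_derivative (- k * Re (r t) - Im (u t)) / e^2) (at t)"
proof -
  note * = bounded_linear.has_vector_derivative[OF bounded_linear_Re r_deriv, of t]
    bounded_linear.has_vector_derivative[OF bounded_linear_Im r_deriv, of t]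
    bounded_linear.has_vector_derivative[OF bounded_linear_Re u_deriv, of t]
    bounded_linear.has_vector_derivative[OF bounded_linear_Im u_deriv, of t]
  have d: "Re (z / complex_of_real (e^2)) = Re z / e^2" "Im (z / complex_of_real (e^2)) = Im z / e^2" for z
    by (simp_all only: Re_divide_of_real Im_divide_of_real)
  show "((\<lambda>t. Re (r t)) has_real_derivative k * Im (u t)) (at t)"
    "((\<lambda>t. Im (r t)) has_real_derivative - k * Re (u t)) (at t)"
    "((\<lambda>t. Re (u t)) has_real_derivative (k * Im (r t) - Re (u t)) / e^2) (at t)"
    "((\<lambda>t. Im (u t)) has_real_derivative (- k * Re (r t) - Im (u t)) / e^2) (at t)"
    using * unfolding has_real_derivative_iff_has_vector_derivative d by simp_all
qed

section \<open>Energy and hypocoercive decay\<close>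

definition "energy t = (cmod (r t))^2 + e^2 * (cmod (u t))^2"

text \<open>With the velocity weighted by \<open>e^2\<close> the coupling through \<open>k\<close>
  is skew and cancels, so only the friction survives.\<close>

lemma energy_deriv: "(energy has_real_derivative - 2 * (cmod (u t))^2) (at t)"
proof -
  define x1 x2 y1 y2 where "x1 = (\<lambda>t. Re (r t))" and "x2 = (\<lambda>t. Im (r t))"
    and "y1 = (\<lambda>t. Re (u t))" and "y2 = (\<lambda>t. Im (u t))"
  note defs = this
  note d = component_derivs[folded defs, folded defs[THEN fun_cong]]
  have "((\<lambda>t. (x1 t)^2 + (x2 t)^2 + e^2 * ((y1 t)^2 + (y2 t)^2)) has_real_derivative
      - 2 * ((y1 t)^2 + (y2 t)^2)) (at t)"
    using eps by (auto intro!: derivative_eq_intros d simp: field_simps power2_eq_square)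
  then show ?thesis by (simp add: energy_def[abs_def] cmod_power2 defs)
qed

lemma energy_le: "0 \<le> t \<Longrightarrow> energy t \<le> energy 0"
  by (erule DERIV_nonpos_imp_nonincreasing) (intro exI conjI, rule energy_deriv, simp)

lemma norm_le_energy: "cmod (r t) + e * cmod (u t) \<le> sqrt (2 * energy t)"
proof (rule real_le_rsqrt)
  show "(cmod (r t) + e * cmod (u t))^2 \<le> 2 * energy t"
    using zero_le_power2[of "cmod (r t) - e * cmod (u t)"]
    by (simp add: energy_def power2_eq_square algebra_simps)
qed

lemma energy_0_le: "sqrt (energy 0) \<le> cmod (r 0) + e * cmod (u 0)"
proof (rule real_le_lsqrt)
  show "energy 0 \<le> (cmod (r 0) + e * cmod (u 0))^2"
    using eps by (simp add: energy_def power2_sum power_mult_distrib)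
qed (use eps in auto)

text \<open>Holds at every frequency with constants free of \<open>k\<close>, at the price of no
  decay. It supplies the dominating functions for the synthesized solutions.\<close>

lemma energy_bound: "0 \<le> t \<Longrightarrow> cmod (r t) + e * cmod (u t) \<le> 2 * (cmod (r 0) + e * cmod (u 0))"
proof -
  assume "0 \<le> t"
  have "sqrt (2 * energy t) \<le> sqrt (2^2 * energy 0)"
  proof (rule real_sqrt_le_mono)
    have "0 \<le> energy 0" by (simp add: energy_def)
    then show "2 * energy t \<le> 2^2 * energy 0" using energy_le[OF \<open>0 \<le> t\<close>] by simp
  qed
  also have "\<dots> = 2 * sqrt (energy 0)" by (simp add: real_sqrt_mult)
  also have "\<dots> \<le> 2 * (cmod (r 0) + e * cmod (u 0))"
    using energy_0_le by (intro mult_left_mono) auto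
  finally show ?thesis using norm_le_energy[of t] by (rule order_trans[rotated])
qed

text \<open>Hypocoercivity: for \<open>e * \<bar>k\<bar>\<close> bounded below, the cross term \<open>Im (cnj r * u)\<close>
  transfers the damping of \<open>u\<close> to \<open>r\<close>.\<close>

lemma energy_decay:
  assumes k: "1 / 4 \<le> e * \<bar>k\<bar>" and t: "0 \<le> t"
  shows "energy t \<le> 5 / 3 * exp (- t / (20 * e^2)) * energy 0"
proof -
  have k0: "k \<noteq> 0" using k by auto
  \<comment> \<open>The factor 8 matches the threshold 1/4: from
    \<open>1 \<le> 4 * (e * \<bar>k\<bar>)\<close> one gets
    \<open>1 / (8 * \<bar>k\<bar>) \<le> e / 2\<close>, and then \<open>X\<close> is at most a
    quarter of the energy. So \<open>L\<close> lies between 3/4 and 5/4 of the energy, and the 5/3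
    in the claim is the ratio of these.\<close>
  define X where "X t = (Re (r t) * Im (u t) - Im (r t) * Re (u t)) / (8 * k)" for t
  define L where "L t = energy t + X t" for t
  have X_le: "\<bar>X t\<bar> \<le> (cmod (r t))^2 / 16 + e^2 * (cmod (u t))^2" "\<bar>X t\<bar> \<le> energy t / 4" for t
  proof -
    have "\<bar>Re (r t) * Im (u t) - Im (r t) * Re (u t)\<bar> = \<bar>Im (cnj (r t) * u t)\<bar>"
      by (simp add: algebra_simps)
    also have "\<dots> \<le> cmod (cnj (r t) * u t)" by (rule abs_Im_le_cmod)
    finally have A: "\<bar>Re (r t) * Im (u t) - Im (r t) * Re (u t)\<bar> \<le> cmod (r t) * cmod (u t)"
      by (simp add: norm_mult)
    have B: "1 / (8 * \<bar>k\<bar>) \<le> e / 2" using k k0 by (simp add: field_simps)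
    have "\<bar>X t\<bar> = \<bar>Re (r t) * Im (u t) - Im (r t) * Re (u t)\<bar> * (1 / (8 * \<bar>k\<bar>))"
      by (simp add: X_def abs_mult)
    also have "\<dots> \<le> (cmod (r t) * cmod (u t)) * (e / 2)"
      by (intro mult_mono A B) auto
    finally have C: "\<bar>X t\<bar> \<le> cmod (r t) * (e * cmod (u t)) / 2" by (simp add: ac_simps)
    show "\<bar>X t\<bar> \<le> (cmod (r t))^2 / 16 + e^2 * (cmod (u t))^2"
      using C zero_le_power2[of "cmod (r t) / 4 - e * cmod (u t)"]
      by (simp add: power2_eq_square algebra_simps)
    show "\<bar>X t\<bar> \<le> energy t / 4"
      using C zero_le_power2[of "cmod (r t) - e * cmod (u t)"]
      by (simp add: power2_eq_square algebra_simps energy_def)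
  qed
  have X': "(X has_real_derivative ((cmod (u t))^2 - (cmod (r t))^2 / e^2) / 8 - X t / e^2) (at t)" for t
  proof -
    define x1 x2 y1 y2 where "x1 = (\<lambda>t. Re (r t))" and "x2 = (\<lambda>t. Im (r t))"
      and "y1 = (\<lambda>t. Re (u t))" and "y2 = (\<lambda>t. Im (u t))"
    note defs = this
    note d = component_derivs[folded defs, folded defs[THEN fun_cong]]
    have "((\<lambda>t. (x1 t * y2 t - x2 t * y1 t) / (8 * k)) has_real_derivative
        (((y1 t)^2 + (y2 t)^2) - ((x1 t)^2 + (x2 t)^2) / e^2) / 8
        - (x1 t * y2 t - x2 t * y1 t) / (8 * k) / e^2) (at t)"
      using eps k0 by (auto intro!: derivative_eq_intros d simp: field_simps power2_eq_square)
    then show ?thesis by (simp add: X_def[abs_def] cmod_power2 defs)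
  qed
  have "exp (t / (20 * e^2)) * L t \<le> exp (0 / (20 * e^2)) * L 0"
  proof (rule DERIV_nonpos_imp_nonincreasing[OF t])
    fix x
    let ?d = "- 2 * (cmod (u x))^2 + (((cmod (u x))^2 - (cmod (r x))^2 / e^2) / 8 - X x / e^2)" and ?f = "L x / 20 - 2 * (e^2 * (cmod (u x))^2) + (e^2 * (cmod (u x))^2 - (cmod (r x))^2) / 8 - X x"
    let ?D = "exp (x / (20 * e^2)) * (L x / (20 * e^2) + ?d)"
    have D: "((\<lambda>t. exp (t / (20 * e^2)) * L t) has_real_derivative ?D) (at x)"
      unfolding L_def using eps
      by (auto intro!: derivative_eq_intros energy_deriv X' simp: field_simps)
    have "L x / (20 * e^2) + ?d
      = ?f / e^2"
      using eps by (simp add: field_simps)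
    \<comment> \<open>After inserting the first bound on \<open>- X x\<close>, the coefficient of
      \<open>(cmod (r x))^2\<close> is 1/20 - 1/8 + (19/20)/16 = -1/64 and that of
      \<open>e^2 * (cmod (u x))^2\<close> is 1/20 - 2 + 1/8 + 19/20 = -7/8. This is what makes the
      rate 1/20 admissible.\<close>
    moreover have "?f \<le> 0"
    proof -
      have "0 \<le> (cmod (r x))^2" "0 \<le> e^2 * (cmod (u x))^2" by auto
      moreover have "- X x \<le> (cmod (r x))^2 / 16 + e^2 * (cmod (u x))^2"
        using X_le(1)[of x] by linarith
      ultimately show ?thesis unfolding L_def energy_def by argo
    qed
    ultimately have "?D \<le> 0"
      by (simp only:) (intro mult_nonneg_nonpos divide_nonpos_nonneg, auto)
    then show "\<exists>y. ((\<lambda>t. exp (t / (20 * e^2)) * L t) has_real_derivative y) (at x) \<and> y \<le> 0"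
      using D by blast
  qed
  then have "exp (t / (20 * e^2)) * L t \<le> L 0" by simp
  moreover have "L 0 \<le> 5 / 4 * energy 0" "3 / 4 * energy t \<le> L t"
    using X_le(2)[of 0] X_le(2)[of t] by (auto simp: L_def)
  ultimately have "exp (t / (20 * e^2)) * (3 / 4 * energy t) \<le> 5 / 4 * energy 0"
    by (meson exp_ge_zero mult_left_mono order_trans)
  then show ?thesis by (simp add: exp_minus field_simps)
qed

text \<open>Taking the square root of the energy halves the rate 1/20; this is the origin of the 40
  in every later layer term.\<close>

lemma high_frequency_decay:
  assumes "1 / 4 \<le> e * \<bar>k\<bar>" and "0 \<le> t"
  shows "cmod (r t) + e * cmod (u t) \<le> 2 * exp (- t / (40 * e^2)) * (cmod (r 0) + e * cmod (u 0))"
proof -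
  let ?E = "exp (- t / (40 * e^2))"
  have "energy 0 \<ge> 0" by (simp add: energy_def)
  have "2 * energy t \<le> 4 * ?E^2 * energy 0"
  proof -
    have "?E^2 = exp (- t / (20 * e^2))"
      by (simp add: power2_eq_square flip: exp_add)
    moreover have "0 \<le> exp (- t / (20 * e^2)) * energy 0" using \<open>energy 0 \<ge> 0\<close> by simp
    moreover have "energy t \<le> 5 / 3 * (exp (- t / (20 * e^2)) * energy 0)"
      using energy_decay[OF assms] by (simp only: mult.assoc)
    ultimately show ?thesis by (simp only: mult.assoc)
  qed
  then have "sqrt (2 * energy t) \<le> sqrt (4 * ?E^2 * energy 0)" by simp
  also have "\<dots> = 2 * ?E * sqrt (energy 0)" by (simp add: real_sqrt_mult)
  also have "\<dots> \<le> 2 * ?E * (cmod (r 0) + e * cmod (u 0))"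
    using energy_0_le by (intro mult_left_mono) auto
  finally show ?thesis using norm_le_energy[of t] by linarith
qed

text \<open>\<open>- a\<close> and \<open>- b\<close> are the characteristic roots, so \<open>y\<close> is \<open>r' + a r\<close>.\<close>

lemma linear_combination_decay:
  assumes y: "\<And>t. y t = of_real a * r t - \<i> * of_real k * u t"
    and ab: "a + b = 1 / e^2" "a * b = k^2 / e^2"
  shows "y t = exp (- of_real (b * t)) * y 0"
proof -
  define G where "G t = exp (of_real (b * t)) * y t" for t
  have ab': "of_real a + of_real b = 1 / (of_real e :: complex)^2" "of_real a * of_real b = (of_real k)^2 / (of_real e :: complex)^2"
    using arg_cong[OF ab(1), of complex_of_real] arg_cong[OF ab(2), of complex_of_real] by auto
  have E: "((\<lambda>t. exp (complex_of_real (b * t))) has_vector_derivative of_real b * exp (of_real (b * t))) (at t)" for t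
  proof -
    have "((\<lambda>z. exp (complex_of_real b * z)) has_field_derivative of_real b * exp (of_real b * of_real t)) (at (of_real t))"
      by (auto intro!: derivative_eq_intros)
    from has_vector_derivative_real_field[OF this] show ?thesis by simp
  qed
  have G': "(G has_vector_derivative 0) (at t)" for t
  proof -
    let ?Y = "of_real a * (- \<i> * of_real k * u t) - \<i> * of_real k * (- (\<i> * of_real k * r t + u t) / of_real (e^2))"
    have y': "(y has_vector_derivative ?Y) (at t)"
      unfolding y[abs_def] by (intro derivative_intros r_deriv u_deriv)
    have eq: "?Y = - of_real b * y t"
    proof -
      have "- of_real b * y t = - (of_real a * of_real b) * r t
          + \<i> * of_real k * u t * (of_real a + of_real b) - of_real a * \<i> * of_real k * u t"
        unfolding y by (simp add: algebra_simps)
      also have "\<dots> = ?Y"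
        unfolding ab' using eps by (simp add: field_simps power2_eq_square)
      finally show ?thesis by simp
    qed
    show ?thesis
      unfolding G_def[abs_def]
      by (rule has_vector_derivative_eq_rhs[OF has_vector_derivative_mult[OF E y']])
         (simp only: eq, simp only: mult_minus_left mult_minus_right ac_simps, simp)
  qed
  obtain c where "\<And>t. t \<in> UNIV \<Longrightarrow> G t = c"
    by (rule has_vector_derivative_zero_constant[of UNIV G]) (auto simp: G')
  then have "G t = G 0" by simp
  then have "exp (of_real (b * t)) * y t = y 0" by (simp add: G_def)
  then show ?thesis by (simp add: exp_minus field_simps)
qed

section \<open>Low frequencies: fast and slow mode\<close>

lemma low_frequency_square: "e * \<bar>k\<bar> \<le> 1 / 4 \<Longrightarrow> e^2 * k^2 \<le> 1 / 16"
  using power_mono[of "e * \<bar>k\<bar>" "1 / 4" 2] eps by (simp add: power_mult_distrib power_divide)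

text \<open>The combination \<open>y\<close> decays with the fast root \<open>b\<close>, which is
  between \<open>1 / (2 * e^2)\<close> and \<open>1 / e^2\<close>; \<open>z\<close> decays with the
  slow root \<open>a\<close>, which is between \<open>k^2\<close> and \<open>2 * k^2\<close>. In the
  damped variable \<open>z\<close> appears only with the factor
  \<open>a - k^2 = a * a * e^2\<close>: the slow root almost equals the heat rate, and this is the
  source of the gain \<open>e^2 * k^2\<close>.\<close>

lemma low_frequency_decay:
  assumes k: "e * \<bar>k\<bar> \<le> 1 / 4" and k0: "k \<noteq> 0" and t: "0 \<le> t"
  defines "M \<equiv> cmod (u 0) + \<bar>k\<bar> * cmod (r 0)"
  shows "cmod (\<i> * of_real k * r t + u t) \<le>
     5 * M * (exp (- t / (2 * e^2)) + e^2 * k^2 * exp (- k\<^sup>2 * t))"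
proof -
  let ?E = "exp (- t / (2 * e^2))"
  and ?H = "exp (- k\<^sup>2 * t)"
  have e2: "0 < e^2" using eps by simp
  note K = low_frequency_square[OF k]
  \<comment> \<open>The square root of the rescaled discriminant. The threshold 1/4 keeps the
    quantity under the root at least 3/4, so \<open>D \<ge> 4 / 5\<close> and the two roots stay
    well separated.\<close>
  define D where "D = sqrt (1 - 4 * (e^2 * k^2))"
  have D2: "D * D = 1 - 4 * (e^2 * k^2)" using K by (simp add: D_def)
  have D1: "D \<le> 1" unfolding D_def by (rule real_le_lsqrt) auto
  have D4: "4 / 5 \<le> D" unfolding D_def by (rule real_le_rsqrt) (use K in \<open>simp add: power2_eq_square\<close>)
  define a b where "a = (1 - D) / (2 * e^2)" and "b = (1 + D) / (2 * e^2)"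
  have apb: "a + b = 1 / e^2" and bma: "b - a = D / e^2"
    unfolding a_def b_def using e2 by (simp_all add: field_simps)
  have "a * b = (1 - D * D) / (4 * e^2 * e^2)"
    unfolding a_def b_def using e2 by (simp add: field_simps)
  then have atb: "a * b = k^2 / e^2" unfolding D2 using eps by (simp add: power2_eq_square)
  have a0: "0 \<le> a" unfolding a_def using D1 e2 by simp
  have b_ge: "1 / (2 * e^2) \<le> b" and b_le: "b \<le> 1 / e^2"
    unfolding b_def using e2 D1 D4 by (simp_all add: field_simps)
  have aE: "a * (b * e^2) = k^2"
  proof -
    have "a * (b * e^2) = a * b * e^2" by simp
    also have "\<dots> = k^2" unfolding atb using e2 by simp
    finally show ?thesis .
  qed
  have bE: "1 / 2 \<le> b * e^2" "b * e^2 \<le> 1" using b_ge b_le e2 by (simp_all add: field_simps)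
  have a_le: "a \<le> 2 * k^2" using mult_left_mono[OF bE(1) a0] aE by linarith
  have a_ge: "k^2 \<le> a" using mult_left_mono[OF bE(2) a0] aE by linarith
  have "b * e^2 = 1 - a * e^2" using apb e2 by (simp add: field_simps)
  then have "k^2 = a * (1 - a * e^2)" using aE by simp
  then have amE: "a - k^2 = a * a * e^2" by (simp add: algebra_simps)
  have am_le: "a - k^2 \<le> 4 * k^2 * k^2 * e^2"
  proof -
    have "a * a \<le> (2 * k^2) * (2 * k^2)" by (intro mult_mono a_le a0) auto
    from mult_right_mono[OF this, of "e^2"] e2 show ?thesis unfolding amE by simp
  qed
  have bm: "0 \<le> b - k^2" "b - k^2 \<le> 1 / e^2"
  proof -
    have "k^2 \<le> 1 / (2 * e^2)" using K e2 by (simp add: field_simps)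
    then show "0 \<le> b - k^2" using b_ge by linarith
    show "b - k^2 \<le> 1 / e^2" using b_le by (smt (verit) zero_le_power2)
  qed
  define y z where "y t = of_real a * r t - \<i> * of_real k * u t"
    and "z t = of_real b * r t - \<i> * of_real k * u t" for t
  have yt: "y t = exp (- of_real (b * t)) * y 0"
    by (rule linear_combination_decay[OF y_def apb atb])
  have zt: "z t = exp (- of_real (a * t)) * z 0"
    by (rule linear_combination_decay[OF z_def]) (use apb atb in \<open>simp_all add: ac_simps\<close>)
  have cexp: "cmod (exp (- of_real x)) = exp (- x)" for x by (simp add: norm_exp_eq_Re)
  have M0: "0 \<le> M" by (simp add: M_def)
  have e1: "exp (- (b * t)) \<le> ?E"
    using mult_right_mono[OF b_ge t] by simp
  have e3: "exp (- (a * t)) \<le> ?H"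
    using mult_right_mono[OF a_ge t] by simp
  have y0: "cmod (y 0) \<le> 2 * \<bar>k\<bar> * M"
  proof -
    have "cmod (y 0) \<le> a * cmod (r 0) + \<bar>k\<bar> * cmod (u 0)"
      unfolding y_def using norm_triangle_ineq4[of "of_real a * r 0" "\<i> * of_real k * u 0"] a0
      by (simp add: norm_mult)
    also have "\<dots> \<le> 2 * k^2 * cmod (r 0) + 2 * \<bar>k\<bar> * cmod (u 0)"
      by (intro add_mono mult_right_mono a_le) auto
    also have "\<dots> = 2 * \<bar>k\<bar> * M" by (cases "0 \<le> k") (simp_all add: M_def power2_eq_square algebra_simps)
    finally show ?thesis .
  qed
  have z0: "e^2 * cmod (z 0) * \<bar>k\<bar> \<le> M"
  proof -
    have "cmod (z 0) \<le> b * cmod (r 0) + \<bar>k\<bar> * cmod (u 0)"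
      unfolding z_def using norm_triangle_ineq4[of "of_real b * r 0" "\<i> * of_real k * u 0"] b_ge e2
      by (simp add: norm_mult) (smt (verit) b_ge e2 divide_pos_pos)
    then have "e^2 * cmod (z 0) * \<bar>k\<bar> \<le> e^2 * (b * cmod (r 0) + \<bar>k\<bar> * cmod (u 0)) * \<bar>k\<bar>"
      using e2 by (intro mult_right_mono mult_left_mono) auto
    also have "\<dots> = (b * e^2) * (\<bar>k\<bar> * cmod (r 0)) + (e^2 * k^2) * cmod (u 0)"
      by (cases "0 \<le> k") (simp_all add: algebra_simps power2_eq_square)
    also have "\<dots> \<le> 1 * (\<bar>k\<bar> * cmod (r 0)) + 1 * cmod (u 0)"
      using bE K by (intro add_mono mult_right_mono) auto
    finally show ?thesis by (simp add: M_def)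
  qed
  define w where "w = \<i> * of_real k * r t + u t"
  \<comment> \<open>Eliminates \<open>r t\<close> and \<open>u t\<close> in favour of the two
    decaying modes. The common factor \<open>\<bar>k\<bar>\<close> is cancelled at the very end,
    which is where \<open>k \<noteq> 0\<close> enters.\<close>
  have "of_real (b - a) * (\<i> * of_real k * w) = of_real (k^2 - b) * y t + of_real (a - k^2) * z t"
    unfolding w_def y_def z_def by (simp add: algebra_simps power2_eq_square)
  then have "cmod (of_real (b - a) * (\<i> * of_real k * w)) \<le> cmod (of_real (k^2 - b) * y t) + cmod (of_real (a - k^2) * z t)"
    by (metis norm_triangle_ineq)
  moreover have "cmod (of_real (b - a)) = D / e^2" "cmod (of_real (k^2 - b)) = b - k^2" "cmod (of_real (a - k^2)) = a - k^2"
    unfolding norm_of_real bma using bm a_ge D4 e2 by auto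
  ultimately have "(D / e^2) * (\<bar>k\<bar> * cmod w) \<le> (b - k^2) * cmod (y t) + (a - k^2) * cmod (z t)"
    unfolding norm_mult by simp
  also have "\<dots> \<le> (1 / e^2) * (?E * (2 * \<bar>k\<bar> * M))
      + (4 * k^2 * k^2 * e^2) * (?H * cmod (z 0))"
    unfolding yt zt norm_mult cexp
    using bm am_le e1 e3 y0 a_ge by (intro add_mono mult_mono) auto
  finally have "e^2 * ((D / e^2) * (\<bar>k\<bar> * cmod w)) \<le> e^2 * ((1 / e^2) * (?E * (2 * \<bar>k\<bar> * M))
      + (4 * k^2 * k^2 * e^2) * (?H * cmod (z 0)))"
    using e2 by (intro mult_left_mono) auto
  also have "\<dots> = ?E * (2 * \<bar>k\<bar> * M) + 4 * e^2 * k^2 * \<bar>k\<bar> * ?H * (e^2 * cmod (z 0) * \<bar>k\<bar>)"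
    using eps by (cases "0 \<le> k") (simp_all add: field_simps power2_eq_square)
  also have "\<dots> \<le> ?E * (2 * \<bar>k\<bar> * M) + 4 * e^2 * k^2 * \<bar>k\<bar> * ?H * M"
    using z0 by (intro add_left_mono mult_left_mono) auto
  finally have "\<bar>k\<bar> * (D * cmod w) \<le> \<bar>k\<bar> * (M * (2 * ?E + 4 * e^2 * k^2 * ?H))"
    using e2 by (simp add: algebra_simps)
  then have "D * cmod w \<le> M * (2 * ?E + 4 * e^2 * k^2 * ?H)"
    by (rule mult_left_le_imp_le) (use k0 in simp)
  moreover have "4 / 5 * cmod w \<le> D * cmod w" using D4 by (intro mult_right_mono) auto
  moreover have "M * (2 * ?E + 4 * e^2 * k^2 * ?H)
      \<le> M * (4 * ?E + 4 * e^2 * k^2 * ?H)"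
    using M0 by (intro mult_left_mono) auto
  ultimately have "cmod w \<le> 5 * M * (?E + e^2 * k^2 * ?H)"
    by (simp add: algebra_simps)
  then show ?thesis by (simp add: w_def)
qed

text \<open>Duhamel's formula through the integrating factor \<open>exp (k^2 * t)\<close>: since r'
  + k^2 r = - i k (i k r + u), the derivative of \<open>G\<close> contains only the damped variable.
  Its integral grows like \<open>k^2 * t\<close>, and half of the heat decay is spent on absorbing
  this growth, leaving \<open>exp (- k\<^sup>2 * t / 2)\<close>.\<close>

lemma low_frequency_heat:
  assumes k: "e * \<bar>k\<bar> \<le> 1 / 4" and k0: "k \<noteq> 0" and t: "0 \<le> t"
  defines "M \<equiv> cmod (u 0) + \<bar>k\<bar> * cmod (r 0)"
  shows "cmod (r t - of_real (exp (- k\<^sup>2 * t)) * r 0) \<le> 12 * e^2 * \<bar>k\<bar> * M * exp (- k\<^sup>2 * t / 2)"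
proof (cases "t = 0")
  case True
  then show ?thesis by (simp add: M_def)
next
  case False
  then have t: "0 < t" using t by simp
  have e2: "0 < e^2" using eps by simp
  note K = low_frequency_square[OF k]
  have M0: "0 \<le> M" by (simp add: M_def)
  let ?g = "\<lambda>x. exp (k^2 * x)" and ?c = "5 * \<bar>k\<bar> * M"
  \<comment> \<open>Multiplied by the integrating factor, the slow exponential of
    \<open>low_frequency_decay\<close> becomes 1 and the fast one becomes
    \<open>exp (- \<beta> * x)\<close>. \<open>\<Phi>\<close> is an antiderivative of the resulting
    bound, and \<open>\<beta>\<close> is still of order \<open>1 / e^2\<close>.\<close>
  define \<beta> where "\<beta> = 1 / (2 * e^2) - k^2"
  have \<beta>: "7 / 16 \<le> \<beta> * e^2"
  proof -
    have "\<beta> * e^2 = 1 / 2 - e^2 * k^2" using e2 by (simp add: \<beta>_def left_diff_distrib)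
    then show ?thesis using K by linarith
  qed
  have "0 < \<beta> * e^2" using \<beta> by (rule less_le_trans[rotated]) simp
  then have \<beta>0: "0 < \<beta>" using e2 by (simp add: zero_less_mult_iff)
  define \<Phi> where "\<Phi> x = ?c * (e^2 * k^2 * x - exp (- \<beta> * x) / \<beta>)" for x
  define G where "G x = of_real (?g x) * r x" for x
  have E: "((\<lambda>x. complex_of_real (?g x)) has_vector_derivative of_real (k^2 * ?g x)) (at x)" for x
    by (intro has_vector_derivative_of_real) (auto intro!: derivative_eq_intros)
  have G': "(G has_vector_derivative - \<i> * of_real k * of_real (?g x) * (\<i> * of_real k * r x + u x)) (at x)" for x
    unfolding G_def[abs_def]
    by (rule has_vector_derivative_eq_rhs[OF has_vector_derivative_mult[OF E r_deriv]])
       (simp add: algebra_simps power2_eq_square)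
  have \<Phi>': "(\<Phi> has_vector_derivative ?c * (e^2 * k^2 + exp (- \<beta> * x))) (at x)" for x
    unfolding \<Phi>_def[abs_def] has_real_derivative_iff_has_vector_derivative[symmetric]
    using \<beta>0 by (auto intro!: derivative_eq_intros simp: field_simps)
  have "cmod (G t - G 0) \<le> \<Phi> t - \<Phi> 0"
  proof (rule differentiable_bound_general[OF t _ _ G' \<Phi>'])
    show "continuous_on {0..t} G" "continuous_on {0..t} \<Phi>"
      using G' \<Phi>' by (meson has_vector_derivative_continuous continuous_at_imp_continuous_on)+
    fix x assume x: "0 < x" "x < t"
    have 1: "?g x * exp (- x / (2 * e^2)) = exp (- \<beta> * x)"
      by (simp add: \<beta>_def algebra_simps flip: exp_add)
    have 2: "?g x * exp (- k\<^sup>2 * x) = 1" by (simp flip: exp_add)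
    have "cmod (- \<i> * of_real k * of_real (?g x) * (\<i> * of_real k * r x + u x))
        = \<bar>k\<bar> * ?g x * cmod (\<i> * of_real k * r x + u x)"
      by (simp add: norm_mult)
    also have "\<dots> \<le> \<bar>k\<bar> * ?g x * (5 * M * (exp (- x / (2 * e^2)) + e^2 * k^2 * exp (- k\<^sup>2 * x)))"
      unfolding M_def using x by (intro mult_left_mono low_frequency_decay[OF k k0]) auto
    also have "\<dots> = ?c * ((?g x * exp (- x / (2 * e^2))) + e^2 * k^2 * (?g x * exp (- k\<^sup>2 * x)))"
      by (simp add: algebra_simps)
    also have "\<dots> = ?c * (e^2 * k^2 + exp (- \<beta> * x))"
      unfolding 1 2 by simp
    finally show "cmod (- \<i> * of_real k * of_real (?g x) * (\<i> * of_real k * r x + u x))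
        \<le> ?c * (e^2 * k^2 + exp (- \<beta> * x))" .
  qed
  also have "\<Phi> t - \<Phi> 0 = ?c * (e^2 * k^2 * t + (1 / \<beta> - exp (- \<beta> * t) / \<beta>))"
    by (simp add: \<Phi>_def algebra_simps)
  also have "\<dots> \<le> ?c * (12 / 5 * e^2 * exp (k^2 * t / 2))"
  proof (rule mult_left_mono)
    have "1 / \<beta> - exp (- \<beta> * t) / \<beta> \<le> 1 / \<beta>" using \<beta>0 by simp
    also have "\<dots> \<le> 16 / 7 * e^2" using \<beta> \<beta>0 by (simp add: field_simps)
    finally have "e^2 * k^2 * t + (1 / \<beta> - exp (- \<beta> * t) / \<beta>) \<le> e^2 * (k^2 * t + 16 / 7)"
      by (simp add: algebra_simps)
    also have "\<dots> \<le> e^2 * (12 / 5 * exp (k^2 * t / 2))"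
    proof (rule mult_left_mono)
      have "0 \<le> k^2 * t" using t by simp
      then show "k^2 * t + 16 / 7 \<le> 12 / 5 * exp (k^2 * t / 2)"
        using exp_ge_add_one_self[of "k^2 * t / 2"] by linarith
    qed (use e2 in auto)
    finally show "e^2 * k^2 * t + (1 / \<beta> - exp (- \<beta> * t) / \<beta>) \<le> 12 / 5 * e^2 * exp (k^2 * t / 2)"
      by (simp add: ac_simps)
  qed (use M0 in auto)
  finally have B: "cmod (G t - G 0) \<le> 12 * e^2 * \<bar>k\<bar> * M * exp (k^2 * t / 2)" by (simp add: ac_simps)
  have "r t - of_real (exp (- k\<^sup>2 * t)) * r 0 = of_real (exp (- k\<^sup>2 * t)) * (G t - G 0)"
    by (simp add: G_def algebra_simps flip: exp_add of_real_mult mult.assoc)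
  then have "cmod (r t - of_real (exp (- k\<^sup>2 * t)) * r 0) = exp (- k\<^sup>2 * t) * cmod (G t - G 0)"
    by (simp add: norm_mult)
  also have "\<dots> \<le> exp (- k\<^sup>2 * t) * (12 * e^2 * \<bar>k\<bar> * M * exp (k^2 * t / 2))"
    by (intro mult_left_mono B) auto
  also have "\<dots> = 12 * e^2 * \<bar>k\<bar> * M * (exp (- k\<^sup>2 * t) * exp (k^2 * t / 2))" by (simp add: ac_simps)
  also have "exp (- k\<^sup>2 * t) * exp (k^2 * t / 2) = exp (- k\<^sup>2 * t / 2)" by (simp flip: exp_add)
  finally show ?thesis .
qed

section \<open>Bounds at every nonzero frequency\<close>

context
  fixes P N :: real
  assumes k0: "k \<noteq> 0"
  defines "N \<equiv> cmod (r 0) + e * cmod (u 0)"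
  defines "P \<equiv> cmod (u 0) + \<bar>k\<bar> * N"
begin

text \<open>Above the threshold, \<open>1 \<le> 4 * (e * \<bar>k\<bar>)\<close> allows
  \<open>cmod (u t)\<close> to be replaced by \<open>4 * \<bar>k\<bar> * (e * cmod (u t))\<close>.
  Then \<open>4 * \<bar>k\<bar>\<close> times the quantity of \<open>high_frequency_decay\<close>
  covers density and velocity at once.\<close>

lemma damped_mode_decay:
  assumes t: "0 \<le> t"
  shows "cmod (\<i> * of_real k * r t + u t) \<le>
     8 * P * (exp (- t / (40 * e^2)) + e^2 * k^2 * exp (- k\<^sup>2 * t))"
proof -
  let ?E = "exp (- t / (40 * e^2))" and ?H = "exp (- k\<^sup>2 * t)"
  show ?thesis
  proof (cases "e * \<bar>k\<bar> \<le> 1 / 4")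
  case True
  have "exp (- t / (2 * e^2)) \<le> ?E"
    using t eps by (simp add: field_simps)
  moreover have "cmod (u 0) + \<bar>k\<bar> * cmod (r 0) \<le> P"
    using eps by (simp add: P_def N_def algebra_simps)
  moreover from this have "0 \<le> P" by (rule order_trans[rotated]) simp
  ultimately have "5 * (cmod (u 0) + \<bar>k\<bar> * cmod (r 0)) * (exp (- t / (2 * e^2)) + e^2 * k^2 * ?H)
     \<le> 8 * P * (?E + e^2 * k^2 * ?H)"
    by (intro mult_mono add_mono) (auto intro!: add_nonneg_nonneg)
  then show ?thesis using low_frequency_decay[OF True k0 t] by linarith
next
  case False
  then have F: "1 / 4 \<le> e * \<bar>k\<bar>" by simp
  have "1 * cmod (u t) \<le> (4 * (e * \<bar>k\<bar>)) * cmod (u t)" using F by (intro mult_right_mono) auto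
  moreover have "cmod (\<i> * of_real k * r t + u t) \<le> \<bar>k\<bar> * cmod (r t) + cmod (u t)"
    using norm_triangle_ineq[of "\<i> * of_real k * r t" "u t"] by (simp add: norm_mult)
  moreover have "0 \<le> \<bar>k\<bar> * cmod (r t)" by simp
  ultimately have "cmod (\<i> * of_real k * r t + u t) \<le> 4 * (\<bar>k\<bar> * cmod (r t)) + (4 * (e * \<bar>k\<bar>)) * cmod (u t)"
    by linarith
  also have "\<dots> = 4 * \<bar>k\<bar> * (cmod (r t) + e * cmod (u t))" by (simp add: algebra_simps)
  also have "\<dots> \<le> 4 * \<bar>k\<bar> * (2 * ?E * N)"
    unfolding N_def by (intro mult_left_mono high_frequency_decay[OF F t]) auto
  also have "\<dots> = 8 * (\<bar>k\<bar> * N) * ?E" by simp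
  also have "\<dots> \<le> 8 * P * (?E + e^2 * k^2 * ?H)"
    using eps by (intro mult_mono) (auto simp: P_def N_def)
  finally show ?thesis .
qed
qed

text \<open>The factor \<open>e^2\<close> is bought here with
  \<open>1 \<le> 16 * (e^2 * k^2)\<close>. It allows \<open>heat_error\<close> to estimate the
  damped density and the heat flow separately at high frequency, instead of comparing them.\<close>

lemma high_frequency_data:
  assumes "1 / 4 \<le> e * \<bar>k\<bar>"
  shows "N \<le> 16 * e^2 * \<bar>k\<bar> * P"
proof -
  have N0: "0 \<le> N" using eps by (simp add: N_def)
  have "1 \<le> 16 * (e^2 * k^2)"
    using power_mono[OF assms, of 2] by (simp add: power_mult_distrib power_divide)
  then have "1 * N \<le> 16 * (e^2 * k^2) * N" by (intro mult_right_mono N0)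
  also have "\<dots> = 16 * e^2 * \<bar>k\<bar> * (\<bar>k\<bar> * N)"
    by (cases "0 \<le> k") (simp_all add: power2_eq_square)
  also have "\<dots> \<le> 16 * e^2 * \<bar>k\<bar> * P" by (intro mult_left_mono) (auto simp: P_def)
  finally show ?thesis by simp
qed

text \<open>The first bound is meant for integration in time: its layer term carries
  \<open>N\<close> without \<open>e^2\<close>, which the integral supplies. The second is meant for
  a fixed time and must already be of order \<open>e^2\<close>, so at high frequency
  \<open>N\<close> is traded by \<open>high_frequency_data\<close>.\<close>

lemma heat_error:
  assumes t: "0 \<le> t"
  shows "cmod (r t - of_real (exp (- k\<^sup>2 * t)) * r 0) \<le>
      16 * e^2 * \<bar>k\<bar> * P * exp (- k\<^sup>2 * t / 2) + 2 * N * exp (- t / (40 * e^2))" (is ?th1)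
    and "cmod (r t - of_real (exp (- k\<^sup>2 * t)) * r 0) \<le> 48 * e^2 * \<bar>k\<bar> * P" (is ?th2)
proof -
  let ?d = "cmod (r t - of_real (exp (- k\<^sup>2 * t)) * r 0)"
  and ?H = "exp (- k\<^sup>2 * t / 2)"
  and ?E = "exp (- t / (40 * e^2))"
  have N0: "0 \<le> N" using eps by (simp add: N_def)
  have P0: "0 \<le> P" using N0 by (simp add: P_def)
  define Q where "Q = e^2 * \<bar>k\<bar> * P"
  have Q0: "0 \<le> Q" using P0 by (simp add: Q_def)
  have Q: "16 * e^2 * \<bar>k\<bar> * P = 16 * Q" "48 * e^2 * \<bar>k\<bar> * P = 48 * Q" by (simp_all add: Q_def)
  have X: "exp (- k\<^sup>2 * t) \<le> ?H" "?H \<le> 1" using t by simp_all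
  have QX: "Q * ?H \<le> Q * 1" by (intro mult_left_mono X Q0)
  have "?th1 \<and> ?th2"
  proof (cases "e * \<bar>k\<bar> \<le> 1 / 4")
    case True
    have "?d
        \<le> 12 * e^2 * \<bar>k\<bar> * (cmod (u 0) + \<bar>k\<bar> * cmod (r 0)) * ?H"
      by (rule low_frequency_heat[OF True k0 t])
    also have "\<dots> \<le> 16 * e^2 * \<bar>k\<bar> * P * ?H"
    proof (intro mult_right_mono mult_mono)
      show "cmod (u 0) + \<bar>k\<bar> * cmod (r 0) \<le> P" using eps by (simp add: P_def N_def distrib_left)
    qed (use P0 in auto)
    finally have "?d \<le> 16 * (Q * ?H)"
      unfolding Q by (simp only: mult.assoc)
    moreover have "0 \<le> 2 * N * ?E" using N0 by simp
    ultimately show ?thesis using QX Q0 unfolding Q by (simp only: mult.assoc) linarith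
  next
    case False
    then have F: "1 / 4 \<le> e * \<bar>k\<bar>" by simp
    note NQ = high_frequency_data[OF F, unfolded Q]
    have "cmod (r t) \<le> cmod (r t) + e * cmod (u t)" using eps by simp
    also have "\<dots> \<le> 2 * ?E * N"
      unfolding N_def by (rule high_frequency_decay[OF F t])
    finally have R: "cmod (r t) \<le> 2 * (N * ?E)" by (simp only: ac_simps)
    have "cmod (r 0) \<le> 16 * Q" using eps NQ by (intro order_trans[OF _ NQ]) (simp add: N_def)
    then have r0: "exp (- k\<^sup>2 * t) * cmod (r 0) \<le> ?H * (16 * Q)"
      by (intro mult_mono X) auto
    have T: "?d \<le> cmod (r t) + exp (- k\<^sup>2 * t) * cmod (r 0)"
      using norm_triangle_ineq4[of "r t" "of_real (exp (- k\<^sup>2 * t)) * r 0"] by (simp add: norm_mult)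
    also have "\<dots> \<le> 2 * (N * ?E) + ?H * (16 * Q)"
      by (intro add_mono R r0)
    finally have A: "?d
        \<le> 2 * (N * ?E) + 16 * (Q * ?H)" by (simp only: ac_simps)
    have "N * ?E \<le> N * 1" using N0 t by (intro mult_left_mono) auto
    then show ?thesis using A QX NQ unfolding Q by (simp only: mult.assoc) linarith
  qed
  then show ?th1 ?th2 by auto
qed

end

text \<open>Replaces \<open>k\<close> by the size \<open>X\<close> of its shell, so that every
  coefficient is constant on the shell and can leave the frequency integral. Each loss is a power of
  8/3: 160 covers 8 (8/3)^3, 342 covers 48 (8/3)^2 and 114 covers 16 (8/3)^2, while (3/4)^2 \<ge>
  1/2 gives the exponents.\<close>

lemma block_bounds:
  assumes X: "0 < X" "3 / 4 * X \<le> \<bar>k\<bar>" "\<bar>k\<bar> \<le> 8 / 3 * X" and t: "0 \<le> t"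
  defines "Q \<equiv> X * cmod (r 0) + (1 + e * X) * cmod (u 0)"
  shows "cmod (\<i> * of_real k * r t + u t)
      \<le> 160 * (exp (- t / (40 * e^2)) + e^2 * X^2 * exp (- (X^2 / 2 * t))) * Q" (is ?w)
    and "cmod (r t - of_real (exp (- k\<^sup>2 * t)) * l) \<le> cmod (r 0 - l) + 342 * e^2 * X * Q" (is ?s1)
    and "cmod (r t - of_real (exp (- k\<^sup>2 * t)) * l) \<le> exp (- (X^2 / 2 * t)) * cmod (r 0 - l)
      + 114 * e^2 * X * Q * exp (- (X^2 / 4 * t)) + 2 * (cmod (r 0) + e * cmod (u 0)) * exp (- t / (40 * e^2))" (is ?s2)
proof -
  let ?d = "cmod (r t - of_real (exp (- k\<^sup>2 * t)) * r 0)"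
  and ?H = "exp (- k\<^sup>2 * t)"
  and ?E = "exp (- t / (40 * e^2))"
  have k0: "k \<noteq> 0" using X by auto
  define P where "P = cmod (u 0) + \<bar>k\<bar> * (cmod (r 0) + e * cmod (u 0))"
  have Q0: "0 \<le> Q" and P0: "0 \<le> P" unfolding Q_def P_def using X eps by auto
  have PQ: "P \<le> 8 / 3 * Q"
  proof -
    have "P \<le> cmod (u 0) + (8 / 3 * X) * (cmod (r 0) + e * cmod (u 0))"
      unfolding P_def using X eps by (intro add_left_mono mult_right_mono) auto
    also have "\<dots> = 8 / 3 * Q - 5 / 3 * cmod (u 0)" by (simp add: Q_def algebra_simps)
    also have "\<dots> \<le> 8 / 3 * Q" by simp
    finally show ?thesis .
  qed
  have k2: "9 / 16 * X^2 \<le> k^2" "k^2 \<le> 64 / 9 * X^2"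
    using power_mono[OF X(2), of 2] power_mono[OF X(3), of 2] X(1) by (simp_all add: power_mult_distrib power_divide)
  have "X^2 / 2 \<le> k^2" using k2(1) zero_le_power2[of X] by linarith
  then have "X^2 / 2 * t \<le> k^2 * t" using t by (rule mult_right_mono)
  then have "- k\<^sup>2 * t \<le> - (X^2 / 2 * t)" "- k\<^sup>2 * t / 2 \<le> - (X^2 / 4 * t)" by linarith+
  then have e1: "?H \<le> exp (- (X^2 / 2 * t))" and e2: "exp (- k\<^sup>2 * t / 2) \<le> exp (- (X^2 / 4 * t))"
    by (simp_all only: exp_le_cancel_iff)
  have e3: "exp (- (X^2 / 2 * t)) \<le> 1" using t by simp
  show ?w
  proof -
    have "cmod (\<i> * of_real k * r t + u t) \<le> 8 * P * (?E + e^2 * k^2 * ?H)"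
      unfolding P_def by (rule damped_mode_decay[OF k0 t])
    also have "\<dots> \<le> 8 * (8 / 3 * Q) * (64 / 9 * ?E + e^2 * (64 / 9 * X^2) * exp (- (X^2 / 2 * t)))"
      using PQ P0 Q0 k2 e1 by (intro mult_mono add_mono mult_left_mono) auto
    also have "\<dots> = (4096 / 27) * ((?E + e^2 * X^2 * exp (- (X^2 / 2 * t))) * Q)"
      by (simp add: algebra_simps)
    also have "\<dots> \<le> 160 * ((?E + e^2 * X^2 * exp (- (X^2 / 2 * t))) * Q)"
      using Q0 by (intro mult_right_mono mult_nonneg_nonneg) auto
    finally show ?thesis by (simp only: mult.assoc)
  qed
  have split: "cmod (r t - of_real (?H) * l)
      \<le> ?d + ?H * cmod (r 0 - l)"
  proof -
    have "r t - of_real (?H) * l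
        = (r t - of_real (?H) * r 0) + of_real (?H) * (r 0 - l)"
      by (simp add: algebra_simps)
    then have "cmod (r t - of_real (?H) * l)
        \<le> ?d + cmod (of_real (?H) * (r 0 - l))"
      by (metis norm_triangle_ineq)
    then show ?thesis by (simp only: norm_mult norm_of_real abs_exp_cancel)
  qed
  have XQ: "e^2 * \<bar>k\<bar> * P \<le> e^2 * (8 / 3 * X) * (8 / 3 * Q)"
    using X PQ P0 by (intro mult_mono) auto
  show ?s1
  proof -
    have "?d \<le> 48 * (e^2 * \<bar>k\<bar> * P)"
      using heat_error(2)[OF k0 t] unfolding P_def by (simp only: mult.assoc)
    also have "\<dots> \<le> 48 * (e^2 * (8 / 3 * X) * (8 / 3 * Q))" by (intro mult_left_mono XQ) simp
    also have "\<dots> = (1024 / 3) * (e^2 * X * Q)" by simp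
    also have "\<dots> \<le> 342 * (e^2 * X * Q)" using X Q0 by (intro mult_right_mono mult_nonneg_nonneg) auto
    finally have "?d \<le> 342 * e^2 * X * Q" by (simp only: mult.assoc)
    moreover have "?H * cmod (r 0 - l) \<le> 1 * cmod (r 0 - l)"
      using e1 e3 by (intro mult_right_mono) auto
    ultimately show ?thesis using split by linarith
  qed
  show ?s2
  proof -
    have "?d
        \<le> 16 * (e^2 * \<bar>k\<bar> * P) * exp (- k\<^sup>2 * t / 2) + 2 * (cmod (r 0) + e * cmod (u 0)) * ?E"
      using heat_error(1)[OF k0 t] unfolding P_def by (simp only: mult.assoc)
    also have "16 * (e^2 * \<bar>k\<bar> * P) * exp (- k\<^sup>2 * t / 2) \<le> 16 * (e^2 * (8 / 3 * X) * (8 / 3 * Q)) * exp (- (X^2 / 4 * t))"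
      using X Q0 by (intro mult_mono[OF mult_left_mono[OF XQ] e2]) auto
    also have "\<dots> = (1024 / 9) * (e^2 * X * Q * exp (- (X^2 / 4 * t)))" by simp
    also have "\<dots> \<le> 114 * (e^2 * X * Q * exp (- (X^2 / 4 * t)))" using X Q0 by (intro mult_right_mono mult_nonneg_nonneg) auto
    finally have "?d
        \<le> 114 * e^2 * X * Q * exp (- (X^2 / 4 * t)) + 2 * (cmod (r 0) + e * cmod (u 0)) * ?E"
      by (simp only: mult.assoc add_le_cancel_right)
    moreover have "?H * cmod (r 0 - l) \<le> exp (- (X^2 / 2 * t)) * cmod (r 0 - l)"
      using e1 by (intro mult_right_mono) auto
    ultimately show ?thesis using split by linarith
  qed
qed

end

section \<open>Lattice evolution equations\<close>

lemma ell2_component_le: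
  assumes h: "0 < h" and d: "0 \<le> d" and v: "ell2_norm h v \<le> ennreal d"
  shows "cmod (v n) \<le> d / sqrt h"
proof -
  have e: "v \<in> ell2" using v by (auto simp: ell2_norm_def top_unique split: if_splits)
  then have sm: "(\<lambda>n. (cmod (v n))^2) summable_on UNIV" by (simp add: ell2_def)
  have "(cmod (v n))^2 \<le> (\<Sum>\<^sub>\<infinity>n. (cmod (v n))^2)"
    using finite_sum_le_infsum[OF sm, of "{n}"] by simp
  then have "sqrt (h * (cmod (v n))^2) \<le> sqrt (h * (\<Sum>\<^sub>\<infinity>n. (cmod (v n))^2))"
    using h by simp
  also have "\<dots> \<le> d" using v e d by (simp add: ell2_norm_def)
  finally show ?thesis using h by (simp add: real_sqrt_mult field_simps)
qed

lemma ell2_tendsto_uniform: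
  assumes h: "0 < h" and lim: "((\<lambda>r. ell2_norm h (v r)) \<longlongrightarrow> 0) F" and e: "0 < e"
  shows "\<forall>\<^sub>F r in F. \<forall>n. cmod (v r n) \<le> e"
proof -
  have "\<forall>\<^sub>F r in F. ell2_norm h (v r) < ennreal (e * sqrt h)"
    using h e by (intro order_tendstoD(2)[OF lim]) simp
  then show ?thesis
  proof eventually_elim
    case (elim r)
    then show ?case
      using ell2_component_le[OF h, of "e * sqrt h" "v r"] h e by (auto simp: less_imp_le)
  qed
qed

lemma has_vector_derivative_iff_quotient:
  fixes f :: "real \<Rightarrow> complex"
  shows "(f has_vector_derivative f') (at t within S) \<longleftrightarrow>
    ((\<lambda>r. (f r - f t) / of_real (r - t) - f') \<longlongrightarrow> 0) (at t within S)"
proof -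
  let ?q = "\<lambda>r. (f r - f t) / of_real (r - t) - f'" and ?p = "\<lambda>r. f r - f t - (r - t) *\<^sub>R f'"
  have "\<forall>\<^sub>F r in at t within S. norm (?p r) / norm (r - t)
      = norm (?q r)"
    unfolding eventually_at_filter
  proof (intro always_eventually allI impI)
    fix r assume "r \<noteq> t"
    then have "?q r = (?p r) / of_real (r - t)"
      by (simp add: diff_divide_distrib scaleR_conv_of_real del: of_real_diff)
    then show "norm (?p r) / norm (r - t) = norm (?q r)"
      by (simp only: norm_divide norm_of_real real_norm_def)
  qed
  then show ?thesis
    unfolding has_vector_derivative_def has_derivative_iff_norm
    by (simp only: tendsto_cong tendsto_norm_zero_iff bounded_linear_scaleR_left simp_thms)
qed

lemma C1_ell2_deriv:
  assumes h: "0 < h" and v: "C1_ell2 h v v'" and t: "0 \<le> t"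
  shows "((\<lambda>t. v t n) has_vector_derivative v' t n) (at t within {0..})"
  unfolding has_vector_derivative_iff_quotient tendsto_iff
proof (intro allI impI)
  fix e :: real assume e: "0 < e"
  have "((\<lambda>r. ell2_norm h (\<lambda>n. (v r n - v t n) / of_real (r - t) - v' t n)) \<longlongrightarrow> 0) (at t within {0..})"
    using v t by (simp add: C1_ell2_def)
  from ell2_tendsto_uniform[OF h this half_gt_zero[OF e]]
  show "\<forall>\<^sub>F r in at t within {0..}. dist ((v r n - v t n) / of_real (r - t) - v' t n) 0 < e"
  proof eventually_elim
    case (elim r)
    then show ?case using e by (simp add: order.strict_trans1[of _ "e / 2" e])
  qed
qed

lemma ell2_bounded:
  fixes h :: real
  assumes h: "0 < h" and v: "v \<in> ell2"
  obtains B where "\<And>n. cmod (v n) \<le> B"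
proof -
  let ?d = "sqrt (h * (\<Sum>\<^sub>\<infinity>n. (cmod (v n))^2))"
  have "0 \<le> ?d" using h by (simp add: infsum_nonneg)
  moreover have "ell2_norm h v \<le> ennreal ?d" using v by (simp add: ell2_norm_def)
  ultimately have "cmod (v n) \<le> ?d / sqrt h" for n by (rule ell2_component_le[OF h])
  then show ?thesis using that by blast
qed

text \<open>The sup norm over the lattice is dominated by the \<open>\<ell>\<^sup>2\<close> norm, hence is continuous in time.\<close>

lemma C1_ell2_bounded:
  assumes h: "0 < h" and v: "C1_ell2 h v v'"
  obtains B where "\<And>t n. 0 \<le> t \<Longrightarrow> t \<le> T \<Longrightarrow> cmod (v t n) \<le> B"
proof -
  define f where "f t = (SUP n. cmod (v t n))" for t
  have bdd: "bdd_above (range (\<lambda>n. cmod (v t n)))" if "0 \<le> t" for t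
  proof -
    have "v t \<in> ell2" using v that by (simp add: C1_ell2_def)
    then obtain B where "\<And>n. cmod (v t n) \<le> B" using ell2_bounded[OF h] by blast
    then show ?thesis by (auto intro!: bdd_aboveI2)
  qed
  have cont: "continuous (at t within {0..}) f" if t: "0 \<le> t" for t
    unfolding continuous_within tendsto_iff
  proof (intro allI impI)
    fix e :: real assume e: "0 < e"
    have "v' t \<in> ell2" using v t by (simp add: C1_ell2_def)
    then obtain M where M: "\<And>n. cmod (v' t n) \<le> M" using ell2_bounded[OF h] by blast
    have M0: "0 \<le> M" using M[of 0] by (rule order_trans[OF norm_ge_zero])
    have "((\<lambda>r. ell2_norm h (\<lambda>n. (v r n - v t n) / of_real (r - t) - v' t n)) \<longlongrightarrow> 0) (at t within {0..})"
      using v t by (simp add: C1_ell2_def)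
    from ell2_tendsto_uniform[OF h this zero_less_one]
    have "\<forall>\<^sub>F r in at t within {0..}. \<forall>n. cmod ((v r n - v t n) / of_real (r - t) - v' t n) \<le> 1" .
    moreover have "\<forall>\<^sub>F r in at t within {0..}. \<bar>r - t\<bar> < e / (2 * (M + 1))"
      using e M0 tendsto_iff[of "\<lambda>r. r" t "at t within {0..}"] by (simp add: dist_real_def)
    moreover have "\<forall>\<^sub>F r in at t within {0..}. r \<in> {0..} \<and> r \<noteq> t"
      by (simp add: eventually_at_filter)
    ultimately show "\<forall>\<^sub>F r in at t within {0..}. dist (f r) (f t) < e"
    proof eventually_elim
      case (elim r)
      have d: "cmod (v r n - v t n) \<le> e / 2" for n
      proof -
        have "cmod ((v r n - v t n) / of_real (r - t)) \<le> M + 1"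
          using elim(1)[rule_format, of n] M[of n] norm_triangle_sub[of "(v r n - v t n) / of_real (r - t)" "v' t n"]
          by linarith
        then have "cmod (v r n - v t n) \<le> (M + 1) * \<bar>r - t\<bar>"
          using elim(3) by (simp add: norm_divide pos_divide_le_eq flip: of_real_diff)
        also have "\<dots> \<le> (M + 1) * (e / (2 * (M + 1)))" using elim(2) M0 by (intro mult_left_mono) auto
        also have "\<dots> = e / 2" using M0 by (simp add: field_simps)
        finally show ?thesis .
      qed
      have "f r \<le> f t + e / 2"
        unfolding f_def
      proof (rule cSUP_least)
        fix n
        have "cmod (v r n) \<le> cmod (v t n) + e / 2" using d[of n] norm_triangle_sub[of "v r n" "v t n"] by linarith
        also have "cmod (v t n) \<le> (SUP n. cmod (v t n))" by (rule cSUP_upper[OF _ bdd[OF t]]) simp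
        finally show "cmod (v r n) \<le> (SUP n. cmod (v t n)) + e / 2" by simp
      qed simp
      moreover have "f t \<le> f r + e / 2"
        unfolding f_def
      proof (rule cSUP_least)
        fix n
        have "cmod (v t n) \<le> cmod (v r n) + e / 2" using d[of n] norm_triangle_sub[of "v t n" "v r n"] by (simp add: norm_minus_commute)
        also have "cmod (v r n) \<le> (SUP n. cmod (v r n))" by (rule cSUP_upper[OF _ bdd]) (use elim in auto)
        finally show "cmod (v t n) \<le> (SUP n. cmod (v r n)) + e / 2" by simp
      qed simp
      ultimately show ?case using e by (simp add: dist_real_def)
    qed
  qed
  then have "continuous_on {0..} f" by (simp add: continuous_on_eq_continuous_within)
  then have "compact (f ` {0..T})"
    by (intro compact_continuous_image) (auto intro: continuous_on_subset)
  then obtain B where "\<forall>x\<in>f ` {0..T}. norm x \<le> B" using compact_imp_bounded bounded_iff by blast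
  have "cmod (v t n) \<le> B" if "0 \<le> t" "t \<le> T" for t n
  proof -
    have "cmod (v t n) \<le> f t" unfolding f_def by (rule cSUP_upper[OF _ bdd[OF that(1)]]) simp
    also have "\<dots> \<le> B" using \<open>\<forall>x\<in>f ` {0..T}. norm x \<le> B\<close> that by force
    finally show ?thesis .
  qed
  then show ?thesis using that by blast
qed

text \<open>Iterating the mean value inequality bounds the solution by \<open>M (Kt)\<^sup>m / m!\<close> for every \<open>m\<close>.\<close>

lemma bounded_linear_ode_zero:
  fixes x x' :: "'i \<Rightarrow> real \<Rightarrow> complex"
  assumes x0: "\<And>i. x i 0 = 0"
    and der: "\<And>i t. 0 \<le> t \<Longrightarrow> (x i has_vector_derivative x' i t) (at t within {0..})"
    and bound: "\<And>i t. 0 \<le> t \<Longrightarrow> t \<le> T \<Longrightarrow> cmod (x i t) \<le> M"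
    and lin: "\<And>t B i. 0 \<le> t \<Longrightarrow> (\<And>i. cmod (x i t) \<le> B) \<Longrightarrow> cmod (x' i t) \<le> K * B"
    and K: "0 \<le> K" and T: "0 \<le> T"
  shows "x i T = 0"
proof -
  have iter: "cmod (x i t) \<le> M * (K * t) ^ m / fact m" if "0 \<le> t" "t \<le> T" for m i t
    using that
  proof (induction m arbitrary: i t)
    case 0
    then show ?case using bound by simp
  next
    case (Suc m)
    show ?case
    proof (cases "t = 0")
      case True
      then show ?thesis by (simp add: x0)
    next
      case False
      then have t: "0 < t" using Suc by simp
      define \<Phi> where "\<Phi> s = M * (K * s) ^ Suc m / fact (Suc m)" for s
      have \<Phi>': "(\<Phi> has_vector_derivative K * (M * (K * s) ^ m / fact m)) (at s)" for s
      proof -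
        define c where "c = M * K ^ Suc m / fact (Suc m)"
        have "\<Phi> = (\<lambda>s. c * s ^ Suc m)" by (simp add: fun_eq_iff \<Phi>_def c_def power_mult_distrib)
        moreover have "((\<lambda>s. c * s ^ Suc m) has_real_derivative c * (real (Suc m) * s ^ m)) (at s)"
          using DERIV_cmult[OF DERIV_pow[of "Suc m" s], of c] by simp
        moreover have "c * (real (Suc m) * s ^ m) = K * (M * (K * s) ^ m / fact m)"
          by (simp add: c_def power_mult_distrib del: of_nat_Suc)
        ultimately show ?thesis by (simp only: has_real_derivative_iff_has_vector_derivative)
      qed
      have "norm (x i t - x i 0) \<le> \<Phi> t - \<Phi> 0"
      proof (rule differentiable_bound_general[OF t])
        have "continuous_on {0..} (x i)"
          unfolding continuous_on_eq_continuous_within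
          using der by (auto intro: has_vector_derivative_continuous)
        then show "continuous_on {0..t} (x i)" by (rule continuous_on_subset) auto
        show "continuous_on {0..t} \<Phi>"
          using \<Phi>' by (meson has_vector_derivative_continuous continuous_at_imp_continuous_on)
        show "(\<Phi> has_vector_derivative K * (M * (K * s) ^ m / fact m)) (at s)" for s by (rule \<Phi>')
        fix s assume s: "0 < s" "s < t"
        have "at s within {0..} = at s" using s by (intro at_within_interior) auto
        then show "(x i has_vector_derivative x' i s) (at s)" using der[of s i] s by simp
        show "cmod (x' i s) \<le> K * (M * (K * s) ^ m / fact m)"
          by (rule lin) (use s Suc in auto)
      qed
      then show ?thesis by (simp add: x0 \<Phi>_def)
    qed
  qed
  have "(\<lambda>m. M * ((K * T) ^ m / fact m)) \<longlonglongrightarrow> M * 0"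
    using summable_LIMSEQ_zero[OF summable_exp[of "K * T"]]
    by (intro tendsto_mult tendsto_const) (simp add: field_simps)
  then have "cmod (x i T) \<le> M * 0"
    by (rule LIMSEQ_le_const) (use iter[OF T order_refl] in auto)
  then show ?thesis by simp
qed

text \<open>One-sided differentiation under the integral sign: the mean value inequality bounds the
  difference quotients by \<open>w\<close>, so \<open>Q\<close> is dominated by twice
  \<open>w\<close>.\<close>

lemma has_vector_derivative_integral:
  fixes F F' :: "real \<Rightarrow> 'a \<Rightarrow> complex"
  assumes F: "\<And>t. 0 \<le> t \<Longrightarrow> integrable M (F t)"
    and der: "\<And>t x. x \<in> space M \<Longrightarrow> 0 \<le> t \<Longrightarrow> ((\<lambda>t. F t x) has_vector_derivative F' t x) (at t within {0..})"
    and bound: "\<And>t x. x \<in> space M \<Longrightarrow> 0 \<le> t \<Longrightarrow> cmod (F' t x) \<le> w x"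
    and w: "integrable M w" and t: "0 \<le> t"
    and F': "integrable M (F' t)"
  shows "((\<lambda>t. LINT x|M. F t x) has_vector_derivative (LINT x|M. F' t x)) (at t within {0..})"
  unfolding has_vector_derivative_iff_quotient tendsto_at_iff_sequentially
proof (intro allI impI)
  fix X assume X: "\<forall>i. X i \<in> {0..} - {t}" "X \<longlonglongrightarrow> t"
  define Q where "Q i x = (F (X i) x - F t x) / of_real (X i - t) - F' t x" for i x
  have int: "integrable M (Q i)" for i
    unfolding Q_def using F[of "X i"] F[OF t] F' X by simp
  have "(\<lambda>i. LINT x|M. Q i x) \<longlonglongrightarrow> (LINT x|M. 0)"
  proof (rule integral_dominated_convergence[where w = "\<lambda>x. w x + w x"])
    show "AE x in M. (\<lambda>i. Q i x) \<longlonglongrightarrow> 0"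
    proof (rule AE_I2)
      fix x assume "x \<in> space M"
      from der[OF this t] show "(\<lambda>i. Q i x) \<longlonglongrightarrow> 0"
        unfolding has_vector_derivative_iff_quotient tendsto_at_iff_sequentially Q_def
        using X by (simp add: o_def)
    qed
    show "AE x in M. cmod (Q i x) \<le> w x + w x" for i
    proof (rule AE_I2)
      fix x assume x: "x \<in> space M"
      have "norm (F (X i) x - F t x) \<le> w x * norm (X i - t)"
      proof (rule differentiable_bound[of "{0..}" _ "\<lambda>t h. h *\<^sub>R F' t x"])
        show "((\<lambda>t. F t x) has_derivative (\<lambda>h. h *\<^sub>R F' s x)) (at s within {0..})" if "s \<in> {0..}" for s
          using der[OF x, of s] that by (simp add: has_vector_derivative_def)
        show "onorm (\<lambda>h. h *\<^sub>R F' s x) \<le> w x" if "s \<in> {0..}" for s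
          using bound[OF x, of s] that by (intro onorm_le) (simp add: mult.commute[of "w x"] mult_left_mono)
      qed (use X t in auto)
      then have "cmod ((F (X i) x - F t x) / of_real (X i - t)) \<le> w x"
        using X by (simp add: norm_divide pos_divide_le_eq del: of_real_diff)
      then show "cmod (Q i x) \<le> w x + w x"
        unfolding Q_def using bound[OF x t] by (rule order_trans[OF norm_triangle_ineq4 add_mono])
    qed
  qed (use int w in auto)
  moreover have "(LINT x|M. Q i x) = ((LINT x|M. F (X i) x) - (LINT x|M. F t x)) / of_real (X i - t) - (LINT x|M. F' t x)" for i
    unfolding Q_def using F[of "X i"] F[OF t] F' X by simp
  ultimately show "((\<lambda>r. ((LINT x|M. F r x) - (LINT x|M. F t x)) / of_real (r - t) - (LINT x|M. F' t x)) \<circ> X) \<longlonglongrightarrow> 0"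
    by (simp add: o_def)
qed

section \<open>Besov norms by dyadic blocks\<close>

lemma ennreal_infsum_le:
  fixes f :: "'a \<Rightarrow> ennreal"
  assumes "\<And>F. finite F \<Longrightarrow> F \<subseteq> A \<Longrightarrow> sum f F \<le> B"
  shows "infsum f A \<le> B"
  using assms by (intro infsum_le_finite_sums nonneg_summable_on_complete) auto

text \<open>Turns the unordered sum over shells into a series over the naturals, the form in which
  it can be exchanged with an integral in time.\<close>

lemma ennreal_infsum_int:
  fixes f :: "int \<Rightarrow> ennreal"
  shows "(\<Sum>\<^sub>\<infinity>j. f j) = (\<Sum>n. f (int_decode n))"
proof -
  have "(\<Sum>\<^sub>\<infinity>j. f j) = (\<Sum>\<^sub>\<infinity>n. f (int_decode n))"
    using infsum_reindex_bij_betw[OF bij_int_decode, of f] by simp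
  also have "((\<lambda>n. f (int_decode n)) has_sum (\<Sum>\<^sub>\<infinity>n. f (int_decode n))) UNIV"
    by (intro has_sum_infsum nonneg_summable_on_complete) simp
  then have "(\<lambda>n. f (int_decode n)) sums (\<Sum>\<^sub>\<infinity>n. f (int_decode n))" by (rule has_sum_imp_sums)
  then have "(\<Sum>\<^sub>\<infinity>n. f (int_decode n)) = (\<Sum>n. f (int_decode n))" by (rule sums_unique)
  finally show ?thesis .
qed

lemma besov_norm_le:
  assumes b: "\<And>j. ennreal (2 powr (of_int j * r)) * ell2_norm h (localize h \<phi> j v) \<le> ennreal (B j)"
    and B: "\<And>j. 0 \<le> B j" "\<And>F. finite F \<Longrightarrow> sum B F \<le> S"
  shows "besov_norm h \<phi> r v \<le> ennreal S"
  unfolding besov_norm_def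
proof (rule ennreal_infsum_le)
  fix F :: "int set" assume F: "finite F"
  have "(\<Sum>j\<in>F. ennreal (2 powr (of_int j * r)) * ell2_norm h (localize h \<phi> j v)) \<le> (\<Sum>j\<in>F. ennreal (B j))"
    by (intro sum_mono b)
  also have "\<dots> = ennreal (sum B F)" using B by (simp add: sum_ennreal)
  also have "\<dots> \<le> ennreal S" using B(2)[OF F] by (rule ennreal_leI)
  finally show "(\<Sum>j\<in>F. ennreal (2 powr (of_int j * r)) * ell2_norm h (localize h \<phi> j v)) \<le> ennreal S" .
qed

text \<open>The integrand is replaced by the majorants \<open>K j\<close> before integrating, so
  measurability in \<open>t\<close> is asked only of these continuous functions. The sum over shells
  and the time integral are then exchanged by monotone convergence.\<close>

lemma L1_besov_norm_le:
  assumes b: "\<And>j t. 0 \<le> t \<Longrightarrow> t \<le> T \<Longrightarrow> ennreal (2 powr (of_int j * r)) * ell2_norm h (localize h \<phi> j (g t)) \<le> ennreal (K j t)"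
    and K: "\<And>j. continuous_on UNIV (K j)" "\<And>j. (\<integral>\<^sup>+ t. ennreal (K j t) \<partial>lebesgue_on {0..T}) \<le> ennreal (B j)"
    and B: "\<And>j. 0 \<le> B j" "\<And>F. finite F \<Longrightarrow> sum B F \<le> S"
  shows "L1_besov_norm h \<phi> r T g \<le> ennreal S"
proof -
  have "K j \<in> borel_measurable (lebesgue_on {0..T})" for j
    using K(1) by (intro continuous_imp_measurable_on_sets_lebesgue) (auto intro: continuous_on_subset)
  then have Km: "(\<lambda>t. ennreal (K j t)) \<in> borel_measurable (lebesgue_on {0..T})" for j by measurable
  have "L1_besov_norm h \<phi> r T g \<le> (\<integral>\<^sup>+ t. (\<Sum>n. ennreal (K (int_decode n) t)) \<partial>lebesgue_on {0..T})"
    unfolding L1_besov_norm_def besov_norm_def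
  proof (rule nn_integral_mono)
    fix t assume "t \<in> space (lebesgue_on {0..T})"
    then have t: "0 \<le> t" "t \<le> T" by auto
    have "(\<Sum>\<^sub>\<infinity>j. ennreal (2 powr (of_int j * r)) * ell2_norm h (localize h \<phi> j (g t))) \<le> (\<Sum>\<^sub>\<infinity>j. ennreal (K j t))"
      by (intro infsum_mono nonneg_summable_on_complete b t) auto
    then show "(\<Sum>\<^sub>\<infinity>j. ennreal (2 powr (of_int j * r)) * ell2_norm h (localize h \<phi> j (g t))) \<le> (\<Sum>n. ennreal (K (int_decode n) t))"
      by (simp only: ennreal_infsum_int)
  qed
  also have "\<dots> = (\<Sum>n. \<integral>\<^sup>+ t. ennreal (K (int_decode n) t) \<partial>lebesgue_on {0..T})"
    by (rule nn_integral_suminf) (rule Km)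
  also have "\<dots> \<le> (\<Sum>n. ennreal (B (int_decode n)))"
    by (intro suminf_le K) auto
  also have "\<dots> = (\<Sum>\<^sub>\<infinity>j. ennreal (B j))" by (simp only: ennreal_infsum_int)
  also have "\<dots> \<le> ennreal S"
  proof (rule ennreal_infsum_le)
    fix F :: "int set" assume "finite F"
    then show "(\<Sum>j\<in>F. ennreal (B j)) \<le> ennreal S" using B by (simp add: sum_ennreal ennreal_leI)
  qed
  finally show ?thesis .
qed

lemma nn_integral_exp_le:
  assumes a: "0 < a" and T: "0 \<le> T"
  shows "(\<integral>\<^sup>+ t. ennreal (exp (- (a * t))) \<partial>lebesgue_on {0..T}) \<le> ennreal (1 / a)"
proof -
  have "((\<lambda>t. - exp (- (a * t)) / a) has_vector_derivative exp (- (a * t))) (at t within {0..T})" for t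
    unfolding has_real_derivative_iff_has_vector_derivative[symmetric]
    using a by (auto intro!: derivative_eq_intros)
  then have I: "((\<lambda>t. exp (- (a * t))) has_integral (- exp (- (a * T)) / a - - exp (- (a * 0)) / a)) {0..T}"
    by (intro fundamental_theorem_of_calculus T)
  have int: "integrable (lebesgue_on {0..T}) (\<lambda>t. exp (- (a * t)))"
    by (intro continuous_imp_integrable_real continuous_intros)
  have "(\<integral>\<^sup>+ t. ennreal (exp (- (a * t))) \<partial>lebesgue_on {0..T}) = ennreal (LINT t|lebesgue_on {0..T}. exp (- (a * t)))"
    by (rule nn_integral_eq_integral[OF int]) simp
  also have "(LINT t|lebesgue_on {0..T}. exp (- (a * t))) = (1 - exp (- (a * T))) / a"
    using lebesgue_integral_eq_integral[OF int] I by (simp add: integral_unique diff_divide_distrib)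
  also have "\<dots> \<le> 1 / a" using a by (simp add: field_simps)
  finally show ?thesis by (simp add: ennreal_leI)
qed

section \<open>Dyadic blocks\<close>

lemma dyadic_shell_sets: "dyadic_shell h j \<in> sets lebesgue"
proof -
  have "continuous_on UNIV (\<lambda>x. \<bar>sin (x * h) / h\<bar>)"
    by (cases "h = 0") (auto intro!: continuous_intros)
  then have "closed ((\<lambda>x. \<bar>sin (x * h) / h\<bar>) -` {3 / 4 * 2 powi j..4 / 3 * 2 powi (j + 1)})"
    by (intro closed_vimage) auto
  moreover have "dyadic_shell h j = freqs h \<inter> (\<lambda>x. \<bar>sin (x * h) / h\<bar>) -` {3 / 4 * 2 powi j..4 / 3 * 2 powi (j + 1)}"
    by (auto simp: dyadic_shell_def)
  ultimately show ?thesis by auto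
qed

text \<open>Uses the indicator of the shell, which dominates \<open>\<phi> j\<close> on the
  frequency interval. No later constant can therefore depend on the chosen partition.\<close>

definition shell_norm :: "real \<Rightarrow> int \<Rightarrow> (real \<Rightarrow> complex) \<Rightarrow> real" where
  "shell_norm h j f = sqrt (sqint (freqs h) (\<lambda>x. indicator (dyadic_shell h j) x * f x))"

lemma shell_norm_nonneg [simp]: "0 \<le> shell_norm h j f"
  by (simp add: shell_norm_def)

lemma shell_L2: "f \<in> L2 (freqs h) \<Longrightarrow> (\<lambda>x. indicator (dyadic_shell h j) x * f x) \<in> L2 (freqs h)"
proof (rule L2_bounded_mult[where B = 1])
  show "(indicator (dyadic_shell h j) :: real \<Rightarrow> complex) \<in> borel_measurable (\<Omega> h)"
    using dyadic_shell_sets by (intro measurable_restrict_space1) simp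
qed (auto simp: indicator_def)

lemma sqrt_three_squares_le:
  fixes A B C :: real
  assumes "0 \<le> A" "0 \<le> B" "0 \<le> C"
  shows "sqrt (3 * (A^2 + B^2 + C^2)) \<le> 2 * (A + B + C)"
proof (rule real_le_lsqrt)
  have "0 \<le> A * B" "0 \<le> A * C" "0 \<le> B * C" using assms by auto
  moreover have eq: "(2 * (A + B + C))^2 = 4 * (A^2 + B^2 + C^2) + 8 * (A * B) + 8 * (A * C) + 8 * (B * C)"
    by (simp add: power2_eq_square algebra_simps)
  moreover have "0 \<le> A^2 + B^2 + C^2" by simp
  ultimately show "3 * (A^2 + B^2 + C^2) \<le> (2 * (A + B + C))^2"
    unfolding eq by argo
qed (use assms in auto)

text \<open>\<open>\<phi> j\<close> is at most 1 and vanishes off the shell, and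
  \<open>dft h (idft h G)\<close> is \<open>G\<close> almost everywhere; the pointwise bound is then
  squared, integrated, and returned to the lattice by Bessel's inequality. Three slots fit the data:
  the density gap, the damped density and the velocity. The factor 2 exceeds the square root of
  3.\<close>

lemma localize_le:
  assumes h: "0 < h" and \<phi>: "dyadic_partition h \<phi>"
    and G: "G \<in> L2 (freqs h)" and f: "f\<^sub>1 \<in> L2 (freqs h)" "f\<^sub>2 \<in> L2 (freqs h)" "f\<^sub>3 \<in> L2 (freqs h)"
    and c: "0 \<le> c\<^sub>1" "0 \<le> c\<^sub>2" "0 \<le> c\<^sub>3"
    and le: "\<And>x. x \<in> dyadic_shell h j \<Longrightarrow> cmod (G x) \<le> c\<^sub>1 * cmod (f\<^sub>1 x) + c\<^sub>2 * cmod (f\<^sub>2 x) + c\<^sub>3 * cmod (f\<^sub>3 x)"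
  shows "ell2_norm h (localize h \<phi> j (idft h G))
    \<le> ennreal (2 * (c\<^sub>1 * shell_norm h j f\<^sub>1 + c\<^sub>2 * shell_norm h j f\<^sub>2 + c\<^sub>3 * shell_norm h j f\<^sub>3))"
proof -
  let ?D = "dft h (idft h G)" and ?I = "indicator (dyadic_shell h j) :: real \<Rightarrow> complex"
  let ?F = "\<lambda>x. 3 * (c\<^sub>1^2 * (cmod (?I x * f\<^sub>1 x))^2 + c\<^sub>2^2 * (cmod (?I x * f\<^sub>2 x))^2 + c\<^sub>3^2 * (cmod (?I x * f\<^sub>3 x))^2)"
  have \<phi>m: "\<phi> j \<in> borel_measurable (\<Omega> h)" and \<phi>1: "\<And>x. x \<in> freqs h \<Longrightarrow> \<phi> j x \<in> {0..1}"
    and supp: "closure {x \<in> freqs h. \<phi> j x \<noteq> 0} \<subseteq> dyadic_shell h j"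
    using \<phi> unfolding dyadic_partition_def by blast+
  have \<phi>0: "\<phi> j x = 0" if "x \<in> freqs h" "x \<notin> dyadic_shell h j" for x
    using subset_trans[OF closure_subset supp] that by auto
  have L: "(\<lambda>x. ?D x * of_real (\<phi> j x)) \<in> L2 (freqs h)"
    unfolding mult.commute[of "?D _"]
    by (rule L2_bounded_mult[OF dft_idft(1)[OF h G], where B = 1]) (use \<phi>m \<phi>1 in auto)
  have S: "(\<lambda>x. ?I x * k x) \<in> L2 (freqs h)" if "k \<in> L2 (freqs h)" for k
    using that by (rule shell_L2)
  have int: "integrable (\<Omega> h) (\<lambda>x. (cmod (?I x * k x))^2)" if "k \<in> L2 (freqs h)" for k
    using S[OF that] by (simp add: L2_def)
  have "sqint (freqs h) (\<lambda>x. ?D x * of_real (\<phi> j x))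
    \<le> (LINT x|\<Omega> h. ?F x)"
    unfolding sqint_def
  proof (rule integral_mono_AE)
    show "integrable (\<Omega> h) (\<lambda>x. (cmod (?D x * of_real (\<phi> j x)))^2)" using L by (simp add: L2_def)
    show "integrable (\<Omega> h) (\<lambda>x. ?F x)"
      using int[OF f(1)] int[OF f(2)] int[OF f(3)] by (intro integrable_mult_right Bochner_Integration.integrable_add)
    show "AE x in \<Omega> h. (cmod (?D x * of_real (\<phi> j x)))^2
      \<le> ?F x"
      using dft_idft(2)[OF h G] AE_space
    proof eventually_elim
      case (elim x)
      then have x: "x \<in> freqs h" by simp
      show ?case
      proof (cases "x \<in> dyadic_shell h j")
        case True
        let ?a = "c\<^sub>1 * cmod (f\<^sub>1 x)" and ?b = "c\<^sub>2 * cmod (f\<^sub>2 x)" and ?c = "c\<^sub>3 * cmod (f\<^sub>3 x)"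
        have "cmod (?D x * of_real (\<phi> j x)) \<le> cmod (G x)"
          using elim \<phi>1[OF x] by (simp add: norm_mult mult_left_le)
        also have "\<dots> \<le> ?a + ?b + ?c" by (rule le[OF True])
        finally have "(cmod (?D x * of_real (\<phi> j x)))^2 \<le> (?a + ?b + ?c)^2" by (intro power_mono) auto
        also have "\<dots> \<le> 3 * (?a^2 + ?b^2 + ?c^2)"
          using zero_le_power2[of "?a - ?b"] zero_le_power2[of "?a - ?c"] zero_le_power2[of "?b - ?c"]
          by (simp add: power2_eq_square algebra_simps)
        finally show ?thesis using True by (simp add: power_mult_distrib)
      qed (use \<phi>0[OF x] in simp)
    qed
  qed
  also have "\<dots> = 3 * (c\<^sub>1^2 * sqint (freqs h) (\<lambda>x. ?I x * f\<^sub>1 x) + c\<^sub>2^2 * sqint (freqs h) (\<lambda>x. ?I x * f\<^sub>2 x) + c\<^sub>3^2 * sqint (freqs h) (\<lambda>x. ?I x * f\<^sub>3 x))"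
  proof -
    have "(LINT x|\<Omega> h. 3 * (c\<^sub>1^2 * k\<^sub>1 x + c\<^sub>2^2 * k\<^sub>2 x + c\<^sub>3^2 * k\<^sub>3 x))
      = 3 * (c\<^sub>1^2 * (LINT x|\<Omega> h. k\<^sub>1 x) + c\<^sub>2^2 * (LINT x|\<Omega> h. k\<^sub>2 x)
        + c\<^sub>3^2 * (LINT x|\<Omega> h. k\<^sub>3 x))"
      if "integrable (\<Omega> h) k\<^sub>1" "integrable (\<Omega> h) k\<^sub>2" "integrable (\<Omega> h) k\<^sub>3"
      for k\<^sub>1 k\<^sub>2 k\<^sub>3 :: "real \<Rightarrow> real"
      using that by simp
    from this[OF int[OF f(1)] int[OF f(2)] int[OF f(3)]] show ?thesis unfolding sqint_def .
  qed
  also have "\<dots> = 3 * ((c\<^sub>1 * shell_norm h j f\<^sub>1)^2 + (c\<^sub>2 * shell_norm h j f\<^sub>2)^2 + (c\<^sub>3 * shell_norm h j f\<^sub>3)^2)"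
    by (simp add: shell_norm_def power_mult_distrib)
  finally have "sqrt (sqint (freqs h) (\<lambda>x. ?D x * of_real (\<phi> j x)))
    \<le> sqrt (3 * ((c\<^sub>1 * shell_norm h j f\<^sub>1)^2 + (c\<^sub>2 * shell_norm h j f\<^sub>2)^2 + (c\<^sub>3 * shell_norm h j f\<^sub>3)^2))"
    by (rule real_sqrt_le_mono)
  also have "\<dots> \<le> 2 * (c\<^sub>1 * shell_norm h j f\<^sub>1 + c\<^sub>2 * shell_norm h j f\<^sub>2 + c\<^sub>3 * shell_norm h j f\<^sub>3)"
    using c by (intro sqrt_three_squares_le) auto
  finally have "ennreal (sqrt (sqint (freqs h) (\<lambda>x. ?D x * of_real (\<phi> j x))))
    \<le> ennreal (2 * (c\<^sub>1 * shell_norm h j f\<^sub>1 + c\<^sub>2 * shell_norm h j f\<^sub>2 + c\<^sub>3 * shell_norm h j f\<^sub>3))"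
    by (rule ennreal_leI)
  then show ?thesis unfolding localize_def using idft_ell2(2)[OF h L] by (rule order_trans[rotated])
qed

text \<open>The Sobolev norm as a functional of the transform itself, so that it applies to any L^2
  representative of that transform.\<close>

definition weighted_norm :: "real \<Rightarrow> (real \<Rightarrow> complex) \<Rightarrow> real" where
  "weighted_norm r f = sqrt (LINT x|lebesgue. (1 + x^2) powr r * (cmod (f x))^2)"

lemma weighted_norm_nonneg [simp]: "0 \<le> weighted_norm r f"
  by (simp add: weighted_norm_def)

text \<open>On the shell \<open>2 powr of_int j\<close> is at most 4/3 of the symbol, and \<bar>sin
  (x h) / h\<bar> \<le> \<bar>x\<bar> bounds the symbol by the true frequency, uniformly in
  \<open>h\<close>. The second estimate is sharp for large \<open>j\<close>, the first is the one
  for negative \<open>j\<close>.\<close>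

lemma shell_norm_le:
  assumes h: "0 < h" and r: "0 \<le> r" and f: "f \<in> L2 UNIV" "integrable lebesgue (\<lambda>x. (1 + x^2) powr r * (cmod (f x))^2)"
  shows "shell_norm h j f \<le> weighted_norm r f"
    and "2 powr (of_int j * r) * shell_norm h j f \<le> (4 / 3) powr r * weighted_norm r f"
proof -
  let ?I = "indicator (dyadic_shell h j) :: real \<Rightarrow> complex"
  have fL: "f \<in> L2 (freqs h)" using f(1) by (rule L2_mono) auto
  have aux: "sqrt (c * sqint (freqs h) (\<lambda>x. ?I x * f x)) \<le> sqrt (d * (LINT x|lebesgue. (1 + x^2) powr r * (cmod (f x))^2))"
    if le: "\<And>x. x \<in> dyadic_shell h j \<Longrightarrow> c \<le> d * (1 + x^2) powr r" and d: "0 \<le> d" for c d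
  proof (rule real_sqrt_le_mono)
    have i: "integrable (\<Omega> h) (\<lambda>x. c * (cmod (?I x * f x))^2)"
      using shell_L2[OF fL, of j] by (simp add: L2_def)
    have "c * sqint (freqs h) (\<lambda>x. ?I x * f x) = (LINT x|\<Omega> h. c * (cmod (?I x * f x))^2)"
      unfolding sqint_def by (rule Bochner_Integration.integral_mult_right_zero[symmetric])
    also have "\<dots> = (LINT x|lebesgue. indicator (freqs h) x *\<^sub>R (c * (cmod (?I x * f x))^2))"
      by (rule integral_restrict_space) simp
    also have "\<dots> \<le> (LINT x|lebesgue. d * ((1 + x^2) powr r * (cmod (f x))^2))"
    proof (rule integral_mono)
      show "integrable lebesgue (\<lambda>x. indicator (freqs h) x *\<^sub>R (c * (cmod (?I x * f x))^2))"
        by (rule integrable_restrict_space[THEN iffD1, OF _ i]) simp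
      show "integrable lebesgue (\<lambda>x. d * ((1 + x^2) powr r * (cmod (f x))^2))" using f(2) by simp
      fix x
      show "indicator (freqs h) x *\<^sub>R (c * (cmod (?I x * f x))^2) \<le> d * ((1 + x^2) powr r * (cmod (f x))^2)"
      proof (cases "x \<in> dyadic_shell h j")
        case True
        then have "x \<in> freqs h" by (simp add: dyadic_shell_def)
        then show ?thesis
          using True mult_right_mono[OF le[OF True], of "(cmod (f x))^2"] by (simp add: mult.assoc)
      qed (use d in simp)
    qed
    finally show "c * sqint (freqs h) (\<lambda>x. ?I x * f x) \<le> d * (LINT x|lebesgue. (1 + x^2) powr r * (cmod (f x))^2)" by simp
  qed
  show "shell_norm h j f \<le> weighted_norm r f"
    using aux[of 1 1] r by (simp add: shell_norm_def weighted_norm_def ge_one_powr_ge_zero)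
  have pw: "(x powr r)^2 = (x^2) powr r" if "0 \<le> x" for x :: real
    using that by (simp add: power2_eq_square powr_mult)
  have pos: "0 < (2 :: real) powr of_int j" by simp
  have "((2 powr of_int j) powr r)^2 \<le> ((4 / 3) powr r)^2 * (1 + x^2) powr r" if x: "x \<in> dyadic_shell h j" for x
  proof -
    have "3 / 4 * 2 powr of_int j \<le> \<bar>sin (x * h) / h\<bar>"
      using x by (simp add: dyadic_shell_def powr_real_of_int')
    also have "\<dots> \<le> \<bar>x\<bar>" using abs_sin_x_le_abs_x[of "x * h"] h by (simp add: abs_mult field_simps)
    finally have "2 powr of_int j \<le> 4 / 3 * \<bar>x\<bar>" by simp
    then have "(2 powr of_int j)^2 \<le> (4 / 3 * \<bar>x\<bar>)^2" by (intro power_mono) auto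
    also have "\<dots> = (4 / 3)^2 * x^2" by (simp only: power_mult_distrib power2_abs)
    also have "\<dots> \<le> (4 / 3)^2 * (1 + x^2)" by (intro mult_left_mono) auto
    finally have "((2 powr of_int j)^2) powr r \<le> ((4 / 3)^2 * (1 + x^2)) powr r"
      using r by (intro powr_mono2) auto
    then show ?thesis by (simp add: pw powr_mult)
  qed
  from aux[OF this] show "2 powr (of_int j * r) * shell_norm h j f \<le> (4 / 3) powr r * weighted_norm r f"
    by (simp add: shell_norm_def weighted_norm_def real_sqrt_mult powr_powr)
qed

lemma sum_geometric_int_le:
  assumes q: "0 \<le> q" "q < (1 :: real)" and F: "finite F"
  shows "(\<Sum>j\<in>F. q ^ nat \<bar>j :: int\<bar>) \<le> 2 / (1 - q)"
proof -
  define N where "N = nat (Max (insert 0 (abs ` F)))"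
  have FN: "F \<subseteq> int ` {..N} \<union> (\<lambda>k. - int k) ` {..N}"
  proof
    fix j assume "j \<in> F"
    then have "\<bar>j\<bar> \<le> Max (insert 0 (abs ` F))" using F by (intro Max_ge) auto
    then have "nat \<bar>j\<bar> \<in> {..N}" by (simp add: N_def nat_mono)
    moreover have "j = int (nat \<bar>j\<bar>) \<or> j = - int (nat \<bar>j\<bar>)" by linarith
    ultimately show "j \<in> int ` {..N} \<union> (\<lambda>k. - int k) ` {..N}" by blast
  qed
  have geo: "(\<Sum>k\<le>N. q ^ k) \<le> 1 / (1 - q)"
    using sum_le_suminf[of "\<lambda>k. q ^ k" "{..N}"] q by (simp add: suminf_geometric)
  have "(\<Sum>j\<in>F. q ^ nat \<bar>j\<bar>) \<le> (\<Sum>j\<in>int ` {..N} \<union> (\<lambda>k. - int k) ` {..N}. q ^ nat \<bar>j\<bar>)"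
    by (intro sum_mono2 FN) (use q in auto)
  also have "\<dots> \<le> (\<Sum>j\<in>int ` {..N}. q ^ nat \<bar>j\<bar>) + (\<Sum>j\<in>(\<lambda>k. - int k) ` {..N}. q ^ nat \<bar>j\<bar>)"
    by (subst sum.union_inter[symmetric]) (use q in \<open>auto intro!: sum_nonneg\<close>)
  also have "\<dots> = 2 * (\<Sum>k\<le>N. q ^ k)"
    by (subst (1 2) sum.reindex) (auto simp: inj_on_def)
  also have "\<dots> \<le> 2 / (1 - q)" using geo by simp
  finally show ?thesis .
qed

text \<open>\<open>(4 / 3) powr r'\<close> is the loss in \<open>shell_norm_le\<close>. The rest
  bounds the two-sided geometric series whose ratio is the worse of \<open>2 powr (- r)\<close> for
  low shells and \<open>2 powr (r - r')\<close> for high ones.\<close>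

definition shell_const :: "real \<Rightarrow> real \<Rightarrow> real" where
  "shell_const r r' = (4 / 3) powr r' * (2 / (1 - max (2 powr (- r)) (2 powr (r - r'))))"

context
  fixes r r' :: real
  assumes r: "0 < r" "r < r'"
begin

lemma shell_const_pos: "0 < shell_const r r'"
  using r by (simp add: shell_const_def powr_less_one)

text \<open>For negative \<open>j\<close> the factor \<open>2 powr (of_int j * r)\<close> itself
  decays because \<open>r\<close> is positive. For other \<open>j\<close> the weight of order
  \<open>r'\<close> is borrowed from the norm and leaves
  \<open>2 powr (of_int j * (r - r'))\<close>, which decays because \<open>r < r'\<close>.\<close>

lemma shell_sum_le:
  assumes h: "0 < h" and f: "f \<in> L2 UNIV" "integrable lebesgue (\<lambda>x. (1 + x^2) powr r' * (cmod (f x))^2)"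
    and F: "finite F"
  shows "(\<Sum>j\<in>F. 2 powr (of_int j * r) * shell_norm h j f) \<le> shell_const r r' * weighted_norm r' f"
proof -
  define q where "q = max (2 powr (- r)) (2 powr (r - r'))"
  have q: "0 \<le> q" "q < 1" using r by (auto simp: q_def powr_less_one le_max_iff_disj)
  define c where "c = (4 / 3 :: real) powr r'"
  have c: "1 \<le> c" unfolding c_def using r by (intro ge_one_powr_ge_zero) auto
  note S = shell_norm_le[OF h _ f, of _]
  have each: "2 powr (of_int j * r) * shell_norm h j f \<le> c * weighted_norm r' f * q ^ nat \<bar>j\<bar>" for j
  proof (cases "0 \<le> j")
    case True
    have "2 powr (of_int j * r) * shell_norm h j f = (2 powr (of_int j * r') * shell_norm h j f) * 2 powr (of_int j * (r - r'))"
      by (simp add: algebra_simps flip: powr_add)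
    also have "\<dots> \<le> (c * weighted_norm r' f) * (2 powr (r - r')) ^ nat j"
    proof -
      have "2 powr (of_int j * (r - r')) = (2 powr (r - r')) ^ nat j"
        using True by (simp add: powr_powr mult.commute flip: powr_realpow)
      then show ?thesis using S(2)[of j] r by (simp only: c_def mult_right_mono zero_le_power powr_ge_zero less_imp_le)
    qed
    also have "\<dots> \<le> (c * weighted_norm r' f) * q ^ nat j"
      using c by (intro mult_left_mono power_mono) (auto simp: q_def)
    finally show ?thesis using True by simp
  next
    case False
    have "2 powr (of_int j * r) = (2 powr (- r)) ^ nat (- j)"
      using False by (simp add: powr_powr mult.commute[of r] flip: powr_realpow)
    then have "2 powr (of_int j * r) * shell_norm h j f \<le> q ^ nat (- j) * weighted_norm r' f"
      using S(1)[of j] r q(1) by (intro mult_mono) (auto simp: q_def intro!: power_mono)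
    also have "\<dots> \<le> q ^ nat (- j) * (c * weighted_norm r' f)"
      using c q mult_right_mono[OF c, of "weighted_norm r' f"] by (intro mult_left_mono) auto
    finally show ?thesis using False by (simp add: mult.commute)
  qed
  have "(\<Sum>j\<in>F. 2 powr (of_int j * r) * shell_norm h j f) \<le> (\<Sum>j\<in>F. c * weighted_norm r' f * q ^ nat \<bar>j\<bar>)"
    by (intro sum_mono each)
  also have "\<dots> = c * weighted_norm r' f * (\<Sum>j\<in>F. q ^ nat \<bar>j\<bar>)" by (simp add: sum_distrib_left)
  also have "\<dots> \<le> c * weighted_norm r' f * (2 / (1 - q))"
    using c by (intro mult_left_mono sum_geometric_int_le q F) auto
  finally show ?thesis by (simp add: shell_const_def c_def q_def ac_simps)
qed

end

section \<open>Multipliers\<close>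

lemma L2_dominated:
  assumes "g \<in> L2 S" "f \<in> borel_measurable (lebesgue_on S)" "\<And>x. x \<in> S \<Longrightarrow> cmod (f x) \<le> cmod (g x)"
  shows "f \<in> L2 S"
  unfolding L2_def
proof safe
  show "integrable (lebesgue_on S) (\<lambda>x. (cmod (f x))^2)"
  proof (rule Bochner_Integration.integrable_bound)
    show "integrable (lebesgue_on S) (\<lambda>x. (cmod (g x))^2)" using assms(1) by (simp add: L2_def)
  qed (use assms in \<open>auto intro!: power_mono\<close>)
qed (use assms in auto)

lemma L2_norm: "f \<in> L2 S \<Longrightarrow> (\<lambda>x. complex_of_real (cmod (f x))) \<in> L2 S"
  by (rule L2_dominated[of f]) (auto simp: L2_def)

definition symb :: "real \<Rightarrow> real \<Rightarrow> real" where
  "symb h x = sin (x * h) / h"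

lemma symb_measurable [measurable]: "symb h \<in> borel_measurable (lebesgue_on S)"
proof -
  have "continuous_on UNIV (symb h)"
    unfolding symb_def[abs_def] by (cases "h = 0") (auto intro!: continuous_intros)
  then show ?thesis
    using borel_measurable_continuous_onI by (intro measurable_restrict_space1 measurable_completion) auto
qed

lemma abs_symb_le: "0 < h \<Longrightarrow> \<bar>symb h x\<bar> \<le> 1 / h"
  by (simp add: symb_def abs_mult divide_right_mono)

lemma idft_integrable:
  "g \<in> L2 (freqs h) \<Longrightarrow> integrable (\<Omega> h) (\<lambda>x. trig h n x * g x)"
  by (intro trig_mult_integrable L2_integrable finite_measure_freqs)

lemma idft_add:
  "f \<in> L2 (freqs h) \<Longrightarrow> g \<in> L2 (freqs h) \<Longrightarrow> idft h (\<lambda>x. f x + g x) n = idft h f n + idft h g n"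
  by (simp add: idft_trig distrib_left idft_integrable)

lemma idft_diff:
  "f \<in> L2 (freqs h) \<Longrightarrow> g \<in> L2 (freqs h) \<Longrightarrow> idft h (\<lambda>x. f x - g x) n = idft h f n - idft h g n"
  by (simp add: idft_trig right_diff_distrib idft_integrable)

lemma idft_cmult: "idft h (\<lambda>x. c * g x) n = c * idft h g n"
proof -
  have eq: "trig h n x * (c * g x) = c * (trig h n x * g x)" for x by simp
  show ?thesis unfolding idft_trig eq by simp
qed

lemma symb_L2: "0 < h \<Longrightarrow> g \<in> L2 (freqs h) \<Longrightarrow> (\<lambda>x. \<i> * of_real (symb h x) * g x) \<in> L2 (freqs h)"
  by (rule L2_bounded_mult[where B = "1 / h"]) (auto simp: norm_mult abs_symb_le)

lemma Dh_idft:
  assumes h: "0 < h" and g: "g \<in> L2 (freqs h)"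
  shows "Dh h (idft h g) n = idft h (\<lambda>x. \<i> * of_real (symb h x) * g x) n"
proof -
  have eq: "trig h n x * (\<i> * of_real (symb h x) * g x)
      = (trig h (n + 1) x * g x - trig h (n - 1) x * g x) / of_real (2 * h)" for x
  proof -
    have "trig h (n + 1) x - trig h (n - 1) x = trig h n x * (cis (x * h) - cis (- (x * h)))"
      using trig_add[of h n 1 x] trig_add[of h n "- 1" x] by (simp add: trig_def algebra_simps)
    also have "cis (x * h) - cis (- (x * h)) = 2 * \<i> * of_real (sin (x * h))" by (simp add: complex_eq_iff)
    finally show ?thesis using h by (simp add: symb_def field_simps)
  qed
  show ?thesis
    unfolding idft_trig Dh_def eq
    using idft_integrable[OF g, of "n + 1"] idft_integrable[OF g, of "n - 1"] by (simp add: field_simps)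
qed

lemma Dh_diff: "Dh h (\<lambda>n. v n - w n) n = Dh h v n - Dh h w n"
  by (simp add: Dh_def diff_divide_distrib)

lemma Dh_bound:
  assumes h: "0 < h" and B: "\<And>n. cmod (v n) \<le> B"
  shows "cmod (Dh h v n) \<le> B / h"
proof -
  have "cmod (v (n + 1) - v (n - 1)) \<le> B + B"
    using B by (intro order_trans[OF norm_triangle_ineq4 add_mono])
  then show ?thesis using h by (simp add: Dh_def norm_divide norm_mult field_simps)
qed

lemma idft_bound:
  assumes g: "g \<in> L2 (freqs h)" and le: "\<And>x. x \<in> freqs h \<Longrightarrow> cmod (g x) \<le> k x" and k: "integrable (\<Omega> h) k"
  shows "cmod (idft h g n) \<le> (LINT x|\<Omega> h. k x)"
proof -
  have sq: "1 \<le> sqrt (2 * pi)" using pi_ge_two by simp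
  have "cmod (idft h g n) \<le> 1 / sqrt (2 * pi) * (LINT x|\<Omega> h. k x)"
    unfolding idft_trig norm_mult
  proof (rule mult_mono)
    have "cmod (LINT x|\<Omega> h. trig h n x * g x) \<le> (LINT x|\<Omega> h. cmod (trig h n x * g x))"
      by (rule integral_norm_bound)
    also have "\<dots> \<le> (LINT x|\<Omega> h. k x)"
      using idft_integrable[OF g] k le by (intro integral_mono integrable_norm) (auto simp: norm_mult)
    finally show "cmod (LINT x|\<Omega> h. trig h n x * g x) \<le> (LINT x|\<Omega> h. k x)" .
    show "cmod (of_real (1 / sqrt (2 * pi))) \<le> 1 / sqrt (2 * pi)" unfolding norm_of_real by simp
  qed auto
  also have "\<dots> \<le> 1 * (LINT x|\<Omega> h. k x)"
  proof (rule mult_right_mono)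
    show "1 / sqrt (2 * pi) \<le> 1" using sq by simp
    show "0 \<le> (LINT x|\<Omega> h. k x)"
    proof (rule Bochner_Integration.integral_nonneg)
      show "0 \<le> k x" if "x \<in> space (\<Omega> h)" for x
        using that by (intro order_trans[OF norm_ge_zero le]) simp
    qed
  qed
  finally show ?thesis by simp
qed

lemma idft_has_vector_derivative:
  assumes g: "\<And>t. 0 \<le> t \<Longrightarrow> g t \<in> L2 (freqs h)" and g': "\<And>t. 0 \<le> t \<Longrightarrow> g' t \<in> L2 (freqs h)"
    and der: "\<And>x t. 0 \<le> t \<Longrightarrow> ((\<lambda>t. g t x) has_vector_derivative g' t x) (at t within {0..})"
    and le: "\<And>x t. 0 \<le> t \<Longrightarrow> x \<in> freqs h \<Longrightarrow> cmod (g' t x) \<le> k x" and k: "integrable (\<Omega> h) k"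
    and t: "0 \<le> t"
  shows "((\<lambda>t. idft h (g t) n) has_vector_derivative idft h (g' t) n) (at t within {0..})"
  unfolding idft_trig
proof (rule has_vector_derivative_mult_right, rule has_vector_derivative_integral[where w = k])
  show "((\<lambda>t. trig h n x * g t x) has_vector_derivative trig h n x * g' t x) (at t within {0..})" if "0 \<le> t" for t x
    using der[OF that, of x] by (rule has_vector_derivative_mult_right)
qed (use g g' t le k in \<open>auto intro: idft_integrable simp: norm_mult\<close>)

section \<open>The solutions in frequency\<close>

text \<open>The principal root is discontinuous across the negative axis, which the discriminant
  reaches at high frequency. On real arguments it is a case distinction between two measurable
  expressions.\<close>

lemma csqrt_of_real_measurable:
  assumes [measurable]: "f \<in> borel_measurable M"
  shows "(\<lambda>x. csqrt (of_real (f x))) \<in> borel_measurable M"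
proof -
  have "csqrt (of_real y) = (if 0 \<le> y then of_real (sqrt y) else \<i> * of_real (sqrt (- y)))" for y
    by simp
  then show ?thesis by simp
qed

lemma complex_measurable_compose:
  fixes F :: "complex \<Rightarrow> complex"
  assumes "continuous_on UNIV F" "f \<in> borel_measurable M"
  shows "(\<lambda>x. F (f x)) \<in> borel_measurable M"
  using measurable_compose[OF assms(2) borel_measurable_continuous_onI[OF assms(1)]] .

lemma damp_measurable:
  assumes [measurable]: "k \<in> borel_measurable M" "a \<in> borel_measurable M" "b \<in> borel_measurable M"
  shows "(\<lambda>x. damp_rho e (k x) (a x) (b x) t) \<in> borel_measurable M"
    and "(\<lambda>x. damp_u e (k x) (a x) (b x) t) \<in> borel_measurable M"
proof -
  have [measurable]: "(\<lambda>x. damp_disc e (k x)) \<in> borel_measurable M"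
    unfolding damp_disc_def by (rule csqrt_of_real_measurable) measurable
  have c: "continuous_on UNIV (\<lambda>z :: complex. cosh (z * of_real t))" "continuous_on UNIV (\<lambda>z :: complex. sinh (z * of_real t))"
    by (intro continuous_intros)+
  have [measurable]: "(\<lambda>x. cosh (damp_disc e (k x) * of_real t)) \<in> borel_measurable M"
    "(\<lambda>x. sinh (damp_disc e (k x) * of_real t)) \<in> borel_measurable M"
    by (rule complex_measurable_compose[OF c(1)] complex_measurable_compose[OF c(2)]; measurable)+
  show "(\<lambda>x. damp_rho e (k x) (a x) (b x) t) \<in> borel_measurable M"
    unfolding damp_rho_def sinhc_def by measurable
  show "(\<lambda>x. damp_u e (k x) (a x) (b x) t) \<in> borel_measurable M"
    unfolding damp_u_def sinhc_def by measurable
qed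

lemma damped_mode_damp: "0 < e \<Longrightarrow> damped_mode e \<eta> (damp_rho e \<eta> a b) (damp_u e \<eta> a b)"
proof
  show "(damp_rho e \<eta> a b has_vector_derivative - \<i> * of_real \<eta> * damp_u e \<eta> a b t) (at t)"
    if "0 < e" for t using that by (intro damp_rho_deriv) simp
  show "(damp_u e \<eta> a b has_vector_derivative - (\<i> * of_real \<eta> * damp_rho e \<eta> a b t + damp_u e \<eta> a b t) / of_real (e^2)) (at t)"
    if "0 < e" for t using that by (intro damp_u_deriv) simp
qed

section \<open>The damped system: synthesis and identification\<close>

context
  fixes h e :: real and a b :: "real \<Rightarrow> complex" and R U :: "real \<Rightarrow> real \<Rightarrow> complex"
  assumes h: "0 < h" and e: "0 < e" and a: "a \<in> L2 (freqs h)" and b: "b \<in> L2 (freqs h)"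
  defines "R \<equiv> \<lambda>t x. damp_rho e (symb h x) (a x) (b x) t"
    and "U \<equiv> \<lambda>t x. damp_u e (symb h x) (a x) (b x) t"
begin

lemma RU_bound:
  assumes "0 \<le> t"
  shows "cmod (R t x) \<le> 2 * (cmod (a x) + e * cmod (b x))"
    and "cmod (U t x) \<le> (2 / e) * (cmod (a x) + e * cmod (b x))"
proof -
  have *: "cmod (R t x) + e * cmod (U t x) \<le> 2 * (cmod (a x) + e * cmod (b x))"
    using damped_mode.energy_bound[OF damped_mode_damp[OF e] assms] by (simp add: R_def U_def)
  have "0 \<le> e * cmod (U t x)" using e by simp
  then show "cmod (R t x) \<le> 2 * (cmod (a x) + e * cmod (b x))" using * by argo
  have "e * cmod (U t x) \<le> 2 * (cmod (a x) + e * cmod (b x))" using * norm_ge_zero[of "R t x"] by argo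
  then show "cmod (U t x) \<le> (2 / e) * (cmod (a x) + e * cmod (b x))" using e by (simp add: field_simps)
qed

lemma data_L2: "(\<lambda>x. complex_of_real (c * (cmod (a x) + e * cmod (b x)))) \<in> L2 (freqs h)"
  using L2_cmult[OF L2_add[OF L2_norm[OF a] L2_cmult[OF L2_norm[OF b], of "of_real e"]], of "of_real c"]
  by simp

lemma RU_L2:
  assumes "0 \<le> t"
  shows "R t \<in> L2 (freqs h)" and "U t \<in> L2 (freqs h)"
proof -
  have m: "a \<in> borel_measurable (\<Omega> h)" "b \<in> borel_measurable (\<Omega> h)"
    using a b by (auto simp: L2_def)
  show "R t \<in> L2 (freqs h)"
  proof (rule L2_dominated[OF data_L2[of 2]])
    show "R t \<in> borel_measurable (\<Omega> h)"
      unfolding R_def by (intro damp_measurable m symb_measurable)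
    show "cmod (R t x) \<le> cmod (complex_of_real (2 * (cmod (a x) + e * cmod (b x))))" for x
      unfolding norm_of_real using RU_bound(1)[OF assms, of x] by linarith
  qed
  show "U t \<in> L2 (freqs h)"
  proof (rule L2_dominated[OF data_L2[of "2 / e"]])
    show "U t \<in> borel_measurable (\<Omega> h)"
      unfolding U_def by (intro damp_measurable m symb_measurable)
    show "cmod (U t x) \<le> cmod (complex_of_real ((2 / e) * (cmod (a x) + e * cmod (b x))))" for x
      unfolding norm_of_real using RU_bound(2)[OF assms, of x] by linarith
  qed
qed

lemma data_integrable: "integrable (\<Omega> h) (\<lambda>x. c * (cmod (a x) + e * cmod (b x)))"
  using freqs_integrable[OF a] freqs_integrable[OF b] by simp

lemma idft_R_deriv:
  assumes t: "0 \<le> t"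
  shows "((\<lambda>t. idft h (R t) n) has_vector_derivative - Dh h (idft h (U t)) n) (at t within {0..})"
proof -
  define R' where "R' t x = - 1 * (\<i> * of_real (symb h x) * U t x)" for t x
  have "((\<lambda>t. idft h (R t) n) has_vector_derivative idft h (R' t) n) (at t within {0..})"
  \<comment> \<open>\<open>1 / h\<close> bounds the symbol and \<open>2 / e\<close> comes from
    \<open>RU_bound\<close>. This dominating constant only serves to identify the solution, so its
    growth in small \<open>h\<close> and \<open>e\<close> is harmless.\<close>
  proof (rule idft_has_vector_derivative[OF _ _ _ _ data_integrable t, where c1 = "1 / h * (2 / e)"])
    fix t :: real and x assume t: "0 \<le> t"
    show "R t \<in> L2 (freqs h)" by (rule RU_L2[OF t])
    show "R' t \<in> L2 (freqs h)" unfolding R'_def by (intro L2_cmult symb_L2 h RU_L2 t)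
    show "((\<lambda>t. R t x) has_vector_derivative R' t x) (at t within {0..})"
      using has_vector_derivative_at_within[OF damp_rho_deriv[of e "symb h x" "a x" "b x" t]] e
      unfolding R_def R'_def U_def by simp
    have "cmod (R' t x) = \<bar>symb h x\<bar> * cmod (U t x)" by (simp add: R'_def norm_mult)
    also have "\<dots> \<le> 1 / h * ((2 / e) * (cmod (a x) + e * cmod (b x)))"
      using h by (intro mult_mono abs_symb_le RU_bound t) auto
    finally show "cmod (R' t x) \<le> 1 / h * (2 / e) * (cmod (a x) + e * cmod (b x))" by (simp only: mult.assoc)
  qed
  also have "idft h (R' t) n = - 1 * idft h (\<lambda>x. \<i> * of_real (symb h x) * U t x) n"
    unfolding R'_def by (rule idft_cmult)
  finally show ?thesis by (simp add: Dh_idft[OF h RU_L2(2)[OF t]])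
qed

lemma idft_U_deriv:
  assumes t: "0 \<le> t"
  shows "((\<lambda>t. idft h (U t) n) has_vector_derivative - (Dh h (idft h (R t)) n + idft h (U t) n) / of_real (e^2)) (at t within {0..})"
proof -
  define U' where "U' t x = (- 1 / of_real (e^2)) * (\<i> * of_real (symb h x) * R t x + U t x)" for t x
  have "((\<lambda>t. idft h (U t) n) has_vector_derivative idft h (U' t) n) (at t within {0..})"
  proof (rule idft_has_vector_derivative[OF _ _ _ _ data_integrable t, where c1 = "(1 / e^2) * (1 / h * 2 + 2 / e)"])
    fix t :: real and x assume t: "0 \<le> t"
    show "U t \<in> L2 (freqs h)" by (rule RU_L2[OF t])
    show "U' t \<in> L2 (freqs h)" unfolding U'_def by (intro L2_cmult L2_add symb_L2 h RU_L2 t)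
    show "((\<lambda>t. U t x) has_vector_derivative U' t x) (at t within {0..})"
    proof (rule has_vector_derivative_eq_rhs)
      show "((\<lambda>t. U t x) has_vector_derivative - (\<i> * of_real (symb h x) * R t x + U t x) / of_real (e^2)) (at t within {0..})"
        unfolding U_def R_def using e by (intro has_vector_derivative_at_within[OF damp_u_deriv]) simp
      have "(- 1 / c) * z = - z / c" for c z :: complex by simp
      then show "- (\<i> * of_real (symb h x) * R t x + U t x) / of_real (e^2) = U' t x" by (simp only: U'_def)
    qed
    have "cmod (U' t x) = (1 / e^2) * cmod (\<i> * of_real (symb h x) * R t x + U t x)"
      by (simp add: U'_def norm_mult norm_divide norm_power)
    also have "\<dots> \<le> (1 / e^2) * (\<bar>symb h x\<bar> * cmod (R t x) + cmod (U t x))"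
      using norm_triangle_ineq[of "\<i> * of_real (symb h x) * R t x" "U t x"]
      by (intro mult_left_mono) (auto simp: norm_mult)
    also have "\<dots> \<le> (1 / e^2) * (1 / h * (2 * (cmod (a x) + e * cmod (b x))) + (2 / e) * (cmod (a x) + e * cmod (b x)))"
      using h by (intro mult_left_mono add_mono mult_mono abs_symb_le RU_bound t) auto
    also have "\<dots> = (1 / e^2) * (1 / h * 2 + 2 / e) * (cmod (a x) + e * cmod (b x))" by (simp only: distrib_right mult.assoc)
    finally show "cmod (U' t x) \<le> (1 / e^2) * (1 / h * 2 + 2 / e) * (cmod (a x) + e * cmod (b x))" .
  qed
  also have "idft h (U' t) n = (- 1 / of_real (e^2)) * idft h (\<lambda>x. \<i> * of_real (symb h x) * R t x + U t x) n"
    unfolding U'_def by (rule idft_cmult)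
  also have "\<dots> = - (Dh h (idft h (R t)) n + idft h (U t) n) / of_real (e^2)"
  proof -
    have "(- 1 / c) * z = - z / c" for c z :: complex by simp
    then show ?thesis
      by (simp only: idft_add[OF symb_L2[OF h RU_L2(1)[OF t]] RU_L2(2)[OF t]] Dh_idft[OF h RU_L2(1)[OF t]])
  qed
  finally show ?thesis .
qed

text \<open>The synthesized candidate satisfies the equations component by component. Its difference
  from the given solution starts at 0, is bounded on [0, T] and obeys a linear equation bounded in
  the sup norm, so it vanishes.\<close>

lemma damped_solution_idft:
  assumes sol: "damped_solution h e (idft h a) (idft h b) \<rho> u" and T: "0 \<le> T"
  shows "\<rho> T = idft h (R T)" and "u T = idft h (U T)"
proof -
  obtain \<rho>' u' where C: "C1_ell2 h \<rho> \<rho>'" "C1_ell2 h u u'"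
    and eq: "\<And>t n. 0 \<le> t \<Longrightarrow> \<rho>' t n + Dh h (u t) n = 0"
      "\<And>t n. 0 \<le> t \<Longrightarrow> of_real (e^2) * u' t n + Dh h (\<rho> t) n + u t n = 0"
    and init: "\<rho> 0 = idft h a" "u 0 = idft h b"
    using sol unfolding damped_solution_def by blast
  \<comment> \<open>Both unknowns form one family, \<open>True\<close> for the density and
    \<open>False\<close> for the velocity, so that a single sup norm controls the coupled
    system.\<close>
  define x where "x = (\<lambda>(c, n) t. if c then \<rho> t n - idft h (R t) n else u t n - idft h (U t) n)"
  define x' where "x' = (\<lambda>(c, n) t. if c then - Dh h (\<lambda>n. x (False, n) t) n
      else - (Dh h (\<lambda>n. x (True, n) t) n + x (False, n) t) / of_real (e^2))"
  \<comment> \<open>The sum of the two sup-norm Lipschitz constants: \<open>1 / h\<close> for the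
    density equation and \<open>(1 / h + 1) / e^2\<close> for the velocity equation.\<close>
  define K where "K = 1 / h + (1 / h + 1) / e^2"
  obtain B1 B2 where B: "\<And>t n. 0 \<le> t \<Longrightarrow> t \<le> T \<Longrightarrow> cmod (\<rho> t n) \<le> B1" "\<And>t n. 0 \<le> t \<Longrightarrow> t \<le> T \<Longrightarrow> cmod (u t n) \<le> B2"
    using C1_ell2_bounded[OF h C(1)] C1_ell2_bounded[OF h C(2)] by metis
  define A where "A c = (LINT x|\<Omega> h. c * (cmod (a x) + e * cmod (b x)))" for c
  have RUb: "cmod (idft h (R t) n) \<le> A 2" "cmod (idft h (U t) n) \<le> A (2 / e)" if "0 \<le> t" for t n
    unfolding A_def by (rule idft_bound[OF RU_L2(1)[OF that] RU_bound(1)[OF that] data_integrable],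
      rule idft_bound[OF RU_L2(2)[OF that] RU_bound(2)[OF that] data_integrable])
  have x0: "x i T = 0" for i
  proof (rule bounded_linear_ode_zero[where x = x and x' = x' and K = K and M = "B1 + A 2 + (B2 + A (2 / e))"])
    have R0: "R 0 = a" "U 0 = b" by (simp_all add: R_def U_def)
    show "x i 0 = 0" for i
      by (cases i) (simp add: x_def init R0)
    show "(x i has_vector_derivative x' i t) (at t within {0..})" if t: "0 \<le> t" for i t
    proof (cases i)
      case (Pair c n)
      have \<rho>': "\<rho>' t n = - Dh h (u t) n" using eq(1)[OF t, of n] by (simp add: eq_neg_iff_add_eq_0)
      have u': "u' t n = - (Dh h (\<rho> t) n + u t n) / of_real (e^2)"
      proof -
        have "of_real (e^2) * u' t n = - (Dh h (\<rho> t) n + u t n)"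
          using eq(2)[OF t, of n] by (simp only: eq_neg_iff_add_eq_0 add.assoc)
        then show ?thesis using e by (simp add: field_simps)
      qed
      show ?thesis
      proof (cases c)
        case True
        have "((\<lambda>t. \<rho> t n - idft h (R t) n) has_vector_derivative \<rho>' t n - - Dh h (idft h (U t)) n) (at t within {0..})"
          by (intro has_vector_derivative_diff C1_ell2_deriv[OF h C(1)] idft_R_deriv t)
        then show ?thesis using True Pair by (simp add: x_def x'_def Dh_diff \<rho>')
      next
        case False
        have "((\<lambda>t. u t n - idft h (U t) n) has_vector_derivative u' t n - - (Dh h (idft h (R t)) n + idft h (U t) n) / of_real (e^2)) (at t within {0..})"
          by (intro has_vector_derivative_diff C1_ell2_deriv[OF h C(2)] idft_U_deriv t)
        moreover have "u' t n - - (Dh h (idft h (R t)) n + idft h (U t) n) / of_real (e^2) = x' (False, n) t"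
          unfolding u' by (simp add: x_def x'_def Dh_diff diff_divide_distrib add_divide_distrib)
        ultimately show ?thesis using False Pair by (simp add: x_def)
      qed
    qed
    show "cmod (x i t) \<le> B1 + A 2 + (B2 + A (2 / e))" if t: "0 \<le> t" "t \<le> T" for i t
    proof -
      have n: "0 \<le> B1" "0 \<le> A 2" "0 \<le> B2" "0 \<le> A (2 / e)"
        using order_trans[OF norm_ge_zero B(1)[OF t]] order_trans[OF norm_ge_zero B(2)[OF t]]
          order_trans[OF norm_ge_zero RUb(1)[OF t(1)]] order_trans[OF norm_ge_zero RUb(2)[OF t(1)]] by auto
      have "cmod (\<rho> t m - idft h (R t) m) \<le> B1 + A 2" "cmod (u t m - idft h (U t) m) \<le> B2 + A (2 / e)" for m
        using B t RUb by (intro order_trans[OF norm_triangle_ineq4 add_mono]; blast)+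
      then have "cmod (\<rho> t m - idft h (R t) m) \<le> B1 + A 2 + (B2 + A (2 / e))"
        "cmod (u t m - idft h (U t) m) \<le> B1 + A 2 + (B2 + A (2 / e))" for m
        using n by (smt (verit))+
      then show ?thesis unfolding x_def by (cases i) auto
    qed
    show "cmod (x' i t) \<le> K * B" if le: "\<And>i. cmod (x i t) \<le> B" for t B i
    proof (cases i)
      case (Pair c n)
      have B0: "0 \<le> B" using order_trans[OF norm_ge_zero le] .
      have D: "cmod (Dh h (\<lambda>n. x (c, n) t) n) \<le> B / h" for c by (intro Dh_bound h le)
      have K1: "B / h \<le> K * B" "(B / h + B) / e^2 \<le> K * B"
        unfolding K_def using B0 h e by (simp_all add: field_simps)
      have "cmod (x' (False, n) t) = cmod (Dh h (\<lambda>n. x (True, n) t) n + x (False, n) t) / e^2"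
        by (simp only: x'_def prod.case if_False norm_divide norm_minus_cancel norm_of_real) simp
      also have "\<dots> \<le> (B / h + B) / e^2"
        by (intro divide_right_mono order_trans[OF norm_triangle_ineq add_mono] D le) simp
      finally have F: "cmod (x' (False, n) t) \<le> K * B" using K1 by linarith
      have "cmod (x' (True, n) t) \<le> B / h" using D[of False] by (simp add: x'_def)
      then show ?thesis using F K1 Pair by (cases c) auto
    qed
    show "0 \<le> K" using h e by (simp add: K_def)
  qed (rule T)
  show "\<rho> T = idft h (R T)"
  proof
    fix n show "\<rho> T n = idft h (R T) n" using x0[of "(True, n)"] by (simp add: x_def)
  qed
  show "u T = idft h (U T)"
  proof
    fix n show "u T n = idft h (U T) n" using x0[of "(False, n)"] by (simp add: x_def)
  qed
qed

end

section \<open>The heat equation: synthesis and identification\<close>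

context
  fixes h :: real and a :: "real \<Rightarrow> complex" and H :: "real \<Rightarrow> real \<Rightarrow> complex"
  assumes h: "0 < h" and a: "a \<in> L2 (freqs h)"
  defines "H \<equiv> \<lambda>t x. of_real (exp (- (symb h x)\<^sup>2 * t)) * a x"
begin

lemma heat_bound: "0 \<le> t \<Longrightarrow> cmod (H t x) \<le> cmod (a x)"
  by (simp add: H_def norm_mult mult_left_le_one_le)

lemma heat_L2:
  assumes "0 \<le> t"
  shows "H t \<in> L2 (freqs h)"
proof (rule L2_dominated[OF a])
  have "a \<in> borel_measurable (\<Omega> h)" using a by (simp add: L2_def)
  then show "H t \<in> borel_measurable (\<Omega> h)" unfolding H_def by measurable
qed (rule heat_bound[OF assms])

lemma idft_heat_deriv:
  assumes t: "0 \<le> t"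
  shows "((\<lambda>t. idft h (H t) n) has_vector_derivative Dh h (Dh h (idft h (H t))) n) (at t within {0..})"
proof -
  define H' where "H' t x = \<i> * of_real (symb h x) * (\<i> * of_real (symb h x) * H t x)" for t x
  have "((\<lambda>t. idft h (H t) n) has_vector_derivative idft h (H' t) n) (at t within {0..})"
  proof (rule idft_has_vector_derivative[OF _ _ _ _ _ t])
    show "integrable (\<Omega> h) (\<lambda>x. 1 / h * (1 / h * cmod (a x)))"
      using freqs_integrable[OF a] by (intro integrable_mult_right integrable_norm)
  next
    fix t :: real and x assume t: "0 \<le> t"
    show "H t \<in> L2 (freqs h)" by (rule heat_L2[OF t])
    show "H' t \<in> L2 (freqs h)" unfolding H'_def by (intro symb_L2 h heat_L2 t)
    have "((\<lambda>t. of_real (exp (- (symb h x)\<^sup>2 * t))) has_vector_derivative of_real (- (symb h x)\<^sup>2 * exp (- (symb h x)\<^sup>2 * t))) (at t within {0..})"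
      by (intro has_vector_derivative_of_real) (auto intro!: derivative_eq_intros)
    from has_vector_derivative_mult_left[OF this, of "a x"]
    show "((\<lambda>t. H t x) has_vector_derivative H' t x) (at t within {0..})"
      unfolding H_def H'_def by (simp add: power2_eq_square algebra_simps)
    have "cmod (H' t x) = \<bar>symb h x\<bar> * (\<bar>symb h x\<bar> * cmod (H t x))" by (simp add: H'_def norm_mult)
    also have "\<dots> \<le> 1 / h * (1 / h * cmod (a x))"
      using h by (intro mult_mono abs_symb_le heat_bound t) auto
    finally show "cmod (H' t x) \<le> 1 / h * (1 / h * cmod (a x))" .
  qed
  also have "idft h (H' t) n = Dh h (Dh h (idft h (H t))) n"
  proof -
    have "Dh h (idft h (H t)) = idft h (\<lambda>x. \<i> * of_real (symb h x) * H t x)"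
      using Dh_idft[OF h heat_L2[OF t]] by (simp add: fun_eq_iff)
    then show ?thesis unfolding H'_def using Dh_idft[OF h symb_L2[OF h heat_L2[OF t]]] by simp
  qed
  finally show ?thesis .
qed

text \<open>Uniqueness in the sup norm as for the damped system; two applications of
  \<open>Dh\<close> contribute the constant \<open>1 / h / h\<close>.\<close>

lemma heat_solution_idft:
  assumes sol: "heat_solution h (idft h a) \<rho>" and T: "0 \<le> T"
  shows "\<rho> T = idft h (H T)"
proof -
  obtain \<rho>' where C: "C1_ell2 h \<rho> \<rho>'" and eq: "\<And>t n. 0 \<le> t \<Longrightarrow> \<rho>' t n - Dh h (Dh h (\<rho> t)) n = 0"
    and init: "\<rho> 0 = idft h a"
    using sol unfolding heat_solution_def by blast
  obtain B where B: "\<And>t n. 0 \<le> t \<Longrightarrow> t \<le> T \<Longrightarrow> cmod (\<rho> t n) \<le> B"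
    using C1_ell2_bounded[OF h C] by metis
  define A where "A = (LINT x|\<Omega> h. cmod (a x))"
  have Hb: "cmod (idft h (H t) n) \<le> A" if "0 \<le> t" for t n
    unfolding A_def using heat_bound[OF that] heat_L2[OF that] freqs_integrable[OF a]
    by (intro idft_bound) auto
  define x where "x n t = \<rho> t n - idft h (H t) n" for n t
  have "x n T = 0" for n
  proof (rule bounded_linear_ode_zero[where x = x and x' = "\<lambda>n t. Dh h (Dh h (\<lambda>n. x n t)) n" and K = "1 / h / h" and M = "B + A"])
    show "x n 0 = 0" for n by (simp add: x_def init H_def)
    show "(x n has_vector_derivative Dh h (Dh h (\<lambda>n. x n t)) n) (at t within {0..})" if t: "0 \<le> t" for n t
    proof -
      have "(x n has_vector_derivative \<rho>' t n - Dh h (Dh h (idft h (H t))) n) (at t within {0..})"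
        unfolding x_def[abs_def] by (intro has_vector_derivative_diff C1_ell2_deriv[OF h C] idft_heat_deriv t)
      moreover have "\<rho>' t n - Dh h (Dh h (idft h (H t))) n = Dh h (Dh h (\<lambda>n. x n t)) n"
        using eq[OF t, of n] by (simp add: x_def Dh_diff[abs_def])
      ultimately show ?thesis by simp
    qed
    show "cmod (x n t) \<le> B + A" if "0 \<le> t" "t \<le> T" for n t
      unfolding x_def using B[OF that] Hb[OF that(1)] by (intro order_trans[OF norm_triangle_ineq4 add_mono])
    show "cmod (Dh h (Dh h (\<lambda>n. x n t)) n) \<le> 1 / h / h * B" if "\<And>n. cmod (x n t) \<le> B" for n t B
      using Dh_bound[OF h Dh_bound[OF h that]] by simp
  qed (use h T in auto)
  then show ?thesis by (auto simp: x_def)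
qed

end

section \<open>Estimates on dyadic blocks\<close>

lemma shell_symb:
  assumes "0 < h" "x \<in> dyadic_shell h j"
  shows "3 / 4 * 2 powr of_int j \<le> \<bar>symb h x\<bar>" and "\<bar>symb h x\<bar> \<le> 8 / 3 * 2 powr of_int j"
proof -
  have "2 powi (j + 1) = 2 * (2 powi j :: real)" by (simp add: power_int_add)
  then show "3 / 4 * 2 powr of_int j \<le> \<bar>symb h x\<bar>" "\<bar>symb h x\<bar> \<le> 8 / 3 * 2 powr of_int j"
    using assms(2) by (simp_all add: dyadic_shell_def symb_def powr_real_of_int')
qed

lemma nn_integral_exp3_le:
  assumes "0 \<le> p" "0 \<le> q" "0 \<le> w" "0 < a" "0 < b" "0 < c" "0 \<le> T"
  shows "(\<integral>\<^sup>+ t. ennreal (p * exp (- (a * t)) + q * exp (- (b * t)) + w * exp (- (c * t))) \<partial>lebesgue_on {0..T})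
    \<le> ennreal (p / a + q / b + w / c)"
proof -
  have m: "(\<lambda>t. ennreal (exp (- (d * t)))) \<in> borel_measurable (lebesgue_on {0..T})" for d :: real
  proof -
    have "(\<lambda>t. exp (- (d * t))) \<in> borel_measurable (lebesgue_on {0..T})"
      by (intro continuous_imp_measurable_on_sets_lebesgue continuous_intros) auto
    then show ?thesis by measurable
  qed
  have one: "ennreal k * (\<integral>\<^sup>+ t. ennreal (exp (- (d * t))) \<partial>lebesgue_on {0..T}) \<le> ennreal (k / d)" if "0 \<le> k" "0 < d" for k d
    using mult_left_mono[OF nn_integral_exp_le[OF that(2) assms(7)], of "ennreal k"] that
    by (simp add: ennreal_mult[symmetric])
  have "(\<integral>\<^sup>+ t. ennreal (p * exp (- (a * t)) + q * exp (- (b * t)) + w * exp (- (c * t))) \<partial>lebesgue_on {0..T})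
    = (\<integral>\<^sup>+ t. ennreal p * ennreal (exp (- (a * t))) + ennreal q * ennreal (exp (- (b * t))) + ennreal w * ennreal (exp (- (c * t))) \<partial>lebesgue_on {0..T})"
    using assms by (simp add: ennreal_plus ennreal_mult)
  also have "\<dots> = ennreal p * (\<integral>\<^sup>+ t. ennreal (exp (- (a * t))) \<partial>lebesgue_on {0..T})
      + ennreal q * (\<integral>\<^sup>+ t. ennreal (exp (- (b * t))) \<partial>lebesgue_on {0..T})
      + ennreal w * (\<integral>\<^sup>+ t. ennreal (exp (- (c * t))) \<partial>lebesgue_on {0..T})"
    using m by (simp add: nn_integral_add nn_integral_cmult)
  also have "\<dots> \<le> ennreal (p / a) + ennreal (q / b) + ennreal (w / c)"
    using assms by (intro add_mono one) auto
  also have "\<dots> = ennreal (p / a + q / b + w / c)" using assms by (simp add: ennreal_plus)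
  finally show ?thesis .
qed

lemma mult_ennreal_le:
  assumes "z \<le> ennreal c" "0 \<le> k" "k * c \<le> d"
  shows "ennreal k * z \<le> ennreal d"
proof -
  have "ennreal k * z \<le> ennreal k * ennreal c" by (intro mult_left_mono assms) simp
  also have "\<dots> = ennreal (k * c)" using assms(2) by (simp add: ennreal_mult')
  also have "\<dots> \<le> ennreal d" using assms(3) by (rule ennreal_leI)
  finally show ?thesis .
qed

text \<open>\<open>D j\<close> is the share of block \<open>j\<close> in the final right-hand side.
  The gap of the initial densities needs no \<open>e^2\<close> in front, since the data assumption
  makes it of that order. The remaining weights are those matched by the H^s' norm of the density,
  the H^(s'-1) norm of the velocity and \<open>e\<close> times its H^s' norm.\<close>

context
  fixes h e s :: real and \<phi> :: "int \<Rightarrow> real \<Rightarrow> real" and a b l :: "real \<Rightarrow> complex"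
    and v w \<rho> :: "real \<Rightarrow> int \<Rightarrow> complex" and D :: "int \<Rightarrow> real" and \<Sigma> :: real
  assumes h: "0 < h" and e: "0 < e" and \<phi>: "dyadic_partition h \<phi>"
    and abl: "a \<in> L2 (freqs h)" "b \<in> L2 (freqs h)" "l \<in> L2 (freqs h)"
    and damped: "damped_solution h e (idft h a) (idft h b) v w"
    and heat: "heat_solution h (idft h l) \<rho>"
  defines "D \<equiv> \<lambda>j. 2 powr (of_int j * (s - 2)) * shell_norm h j (\<lambda>x. a x - l x)
      + e^2 * (2 powr (of_int j * s) * shell_norm h j a + 2 powr (of_int j * (s - 1)) * shell_norm h j b
        + e * (2 powr (of_int j * s) * shell_norm h j b))"
  assumes \<Sigma>: "\<And>F. finite F \<Longrightarrow> sum D F \<le> \<Sigma>"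
begin

abbreviation "R t x \<equiv> damp_rho e (symb h x) (a x) (b x) t"
abbreviation "U t x \<equiv> damp_u e (symb h x) (a x) (b x) t"
abbreviation "H t x \<equiv> of_real (exp (- (symb h x)\<^sup>2 * t)) * l x"

lemma diff_L2: "(\<lambda>x. a x - l x) \<in> L2 (freqs h)"
  using abl by (intro L2_diff)

lemma D_nonneg: "0 \<le> D j"
  unfolding D_def using e by (intro add_nonneg_nonneg mult_nonneg_nonneg) auto

lemma D_scaled: "0 \<le> 13440 * D j" "finite F \<Longrightarrow> (\<Sum>j\<in>F. 13440 * D j) \<le> 13440 * \<Sigma>"
  using D_nonneg \<Sigma> by (simp_all flip: sum_distrib_left)

lemma density_error:
  assumes "0 \<le> t"
  shows "(\<lambda>n. v t n - \<rho> t n) = idft h (\<lambda>x. R t x - H t x)"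
    and "(\<lambda>x. R t x - H t x) \<in> L2 (freqs h)"
proof -
  note L = RU_L2(1)[OF h e abl(1,2) assms] heat_L2[OF h abl(3) assms]
  show "(\<lambda>n. v t n - \<rho> t n) = idft h (\<lambda>x. R t x - H t x)"
    using damped_solution_idft(1)[OF h e abl(1,2) damped assms] heat_solution_idft[OF h abl(3) heat assms] idft_diff[OF L]
    by (simp add: fun_eq_iff)
  show "(\<lambda>x. R t x - H t x) \<in> L2 (freqs h)" by (rule L2_diff[OF L])
qed

lemma flux_error:
  assumes "0 \<le> t"
  shows "(\<lambda>n. Dh h (v t) n + w t n) = idft h (\<lambda>x. \<i> * of_real (symb h x) * R t x + U t x)"
    and "(\<lambda>x. \<i> * of_real (symb h x) * R t x + U t x) \<in> L2 (freqs h)" (is "?W \<in> _")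
proof -
  note L = RU_L2[OF h e abl(1,2) assms]
  show "(\<lambda>n. Dh h (v t) n + w t n) = idft h ?W"
    by (rule ext) (simp only: damped_solution_idft[OF h e abl(1,2) damped assms] Dh_idft[OF h L(1)] idft_add[OF symb_L2[OF h L(1)] L(2)])
  show "?W \<in> L2 (freqs h)" by (intro L2_add symb_L2 h L)
qed

text \<open>Writes all weights through \<open>X\<close> and \<open>Y\<close> and exposes in
  \<open>D j\<close> the combination called \<open>Q\<close> in \<open>block_bounds\<close>.\<close>

lemma dyadic_weights:
  fixes j :: int
  defines "X \<equiv> 2 powr of_int j" and "Y \<equiv> 2 powr (of_int j * s)"
  shows "2 powr (of_int j * (s - 1)) = Y / X" and "2 powr (of_int j * (s - 2)) = Y / X^2"
    and "0 < X" and "0 < Y"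
    and "D j = Y / X^2 * shell_norm h j (\<lambda>x. a x - l x)
      + e^2 * (Y / X) * (X * shell_norm h j a + (1 + e * X) * shell_norm h j b)"
proof -
  show X: "0 < X" and "0 < Y" by (simp_all add: X_def Y_def)
  show 1: "2 powr (of_int j * (s - 1)) = Y / X"
    unfolding X_def Y_def by (simp add: right_diff_distrib powr_diff)
  have "X^2 = 2 powr (of_int j * 2)" by (simp add: X_def power2_eq_square mult.commute flip: powr_add)
  then show 2: "2 powr (of_int j * (s - 2)) = Y / X^2"
    unfolding Y_def by (simp only: right_diff_distrib powr_diff)
  show "D j = Y / X^2 * shell_norm h j (\<lambda>x. a x - l x)
      + e^2 * (Y / X) * (X * shell_norm h j a + (1 + e * X) * shell_norm h j b)"
    unfolding D_def 1 2 Y_def[symmetric] using X by (simp add: field_simps)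
qed

text \<open>At fixed time the blocks produce only the factors 2 and 684. The common constant 13440
  is the one that \<open>L1_flux_bound\<close> requires.\<close>

lemma besov_bound:
  assumes T: "0 \<le> T"
  shows "besov_norm h \<phi> (s - 2) (\<lambda>n. v T n - \<rho> T n) \<le> ennreal (13440 * \<Sigma>)"
proof (rule besov_norm_le[where B = "\<lambda>j. 13440 * D j"])
  fix j
  define X where "X = (2 :: real) powr of_int j"
  define Y where "Y = (2 :: real) powr (of_int j * s)"
  note W = dyadic_weights[of j, folded X_def Y_def]
  define A B L where "A = shell_norm h j a" and "B = shell_norm h j b" and "L = shell_norm h j (\<lambda>x. a x - l x)"
  have L0: "0 \<le> L" and q0: "0 \<le> X * A + (1 + e * X) * B" using W e by (auto simp: A_def B_def L_def)
  have "ell2_norm h (localize h \<phi> j (\<lambda>n. v T n - \<rho> T n))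
      \<le> ennreal (2 * (1 * L + (342 * e^2 * X * X) * A + (342 * e^2 * X * (1 + e * X)) * B))"
    (is "_ \<le> ennreal ?c")
    unfolding density_error(1)[OF T] A_def B_def L_def
  proof (rule localize_le[OF h \<phi> density_error(2)[OF T] diff_L2 abl(1,2)])
    fix x assume x: "x \<in> dyadic_shell h j"
    show "cmod (R T x - H T x) \<le> 1 * cmod (a x - l x) + (342 * e^2 * X * X) * cmod (a x) + (342 * e^2 * X * (1 + e * X)) * cmod (b x)"
      using damped_mode.block_bounds(2)[OF damped_mode_damp[OF e] W(3) shell_symb[OF h x, folded X_def] T, of "a x" "b x" "l x"]
      by (simp add: algebra_simps)
  qed (use W e in auto)
  then show "ennreal (2 powr (of_int j * (s - 2))) * ell2_norm h (localize h \<phi> j (\<lambda>n. v T n - \<rho> T n)) \<le> ennreal (13440 * D j)"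
  proof (rule mult_ennreal_le)
    have "(Y / X^2) * ?c
        = 2 * (Y / X^2 * L) + 684 * (e^2 * (Y / X) * (X * A + (1 + e * X) * B))"
      using W(3) by (simp add: field_simps power2_eq_square)
    also have "\<dots> \<le> 13440 * (Y / X^2 * L) + 13440 * (e^2 * (Y / X) * (X * A + (1 + e * X) * B))"
      using W L0 q0 by (intro add_mono mult_right_mono mult_nonneg_nonneg) auto
    also have "\<dots> = 13440 * D j" unfolding W(5) A_def B_def L_def by (simp add: distrib_left)
    finally show "2 powr (of_int j * (s - 2)) * ?c \<le> 13440 * D j"
      unfolding W(2) .
  qed simp
qed (fact D_scaled)+

text \<open>Parabolic smoothing: the weight of order \<open>s\<close> exceeds that of order
  \<open>s - 2\<close> by \<open>(X j)^2\<close>, and integrating the heat exponentials in time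
  returns a multiple of \<open>1 / (X j)^2\<close>. The layer term has no such gain, but its time
  integral supplies the missing \<open>e^2\<close>.\<close>

lemma L1_density_bound:
  assumes T: "0 \<le> T"
  shows "L1_besov_norm h \<phi> s T (\<lambda>t n. v t n - \<rho> t n) \<le> ennreal (13440 * \<Sigma>)"
proof -
  define X Y A B L where "X = (\<lambda>j :: int. (2 :: real) powr of_int j)" and "Y = (\<lambda>j :: int. (2 :: real) powr (of_int j * s))"
    and "A = (\<lambda>j. shell_norm h j a)" and "B = (\<lambda>j. shell_norm h j b)" and "L = (\<lambda>j. shell_norm h j (\<lambda>x. a x - l x))"
  note defs = X_def[THEN fun_cong, symmetric] Y_def[THEN fun_cong, symmetric]
  note W = dyadic_weights[unfolded defs]
  define q where "q j = X j * A j + (1 + e * X j) * B j" for j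
  have nn: "0 \<le> A j" "0 \<le> B j" "0 \<le> L j" "0 \<le> q j" for j
    using W(3)[of j] e by (auto simp: A_def B_def L_def q_def)
  define K where "K j t = Y j * 2 * L j * exp (- ((X j)^2 / 2 * t)) + Y j * 228 * e^2 * X j * q j * exp (- ((X j)^2 / 4 * t))
      + Y j * 4 * (A j + e * B j) * exp (- (1 / (40 * e^2) * t))" for j t
  show ?thesis
  proof (rule L1_besov_norm_le[where K = K and B = "\<lambda>j. 13440 * D j"])
    fix j and t :: real assume t: "0 \<le> t"
    let ?c1 = "exp (- ((X j)^2 / 2 * t))" and ?c2 = "114 * e^2 * X j * exp (- ((X j)^2 / 4 * t)) * X j + 2 * exp (- t / (40 * e^2))"
      and ?c3 = "114 * e^2 * X j * exp (- ((X j)^2 / 4 * t)) * (1 + e * X j) + 2 * e * exp (- t / (40 * e^2))"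
    have "ell2_norm h (localize h \<phi> j (\<lambda>n. v t n - \<rho> t n))
      \<le> ennreal (2 * (?c1 * L j
        + ?c2 * A j
        + ?c3 * B j))"
      unfolding density_error(1)[OF t] A_def B_def L_def
    proof (rule localize_le[OF h \<phi> density_error(2)[OF t] diff_L2 abl(1,2)])
      fix x assume x: "x \<in> dyadic_shell h j"
      show "cmod (R t x - H t x) \<le> ?c1 * cmod (a x - l x)
        + ?c2 * cmod (a x)
        + ?c3 * cmod (b x)"
        using damped_mode.block_bounds(3)[OF damped_mode_damp[OF e] W(3) shell_symb[OF h x, unfolded defs] t, of "a x" "b x" "l x"]
        by (simp add: algebra_simps)
    qed (use W(3)[of j] e in auto)
    then show "ennreal (2 powr (of_int j * s)) * ell2_norm h (localize h \<phi> j (\<lambda>n. v t n - \<rho> t n)) \<le> ennreal (K j t)"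
    proof (rule mult_ennreal_le, goal_cases)
      case 2
      show ?case unfolding defs K_def q_def by (simp add: algebra_simps)
    qed simp
  next
    show "continuous_on UNIV (K j)" for j unfolding K_def by (intro continuous_intros)
    show "(\<integral>\<^sup>+ t. ennreal (K j t) \<partial>lebesgue_on {0..T}) \<le> ennreal (13440 * D j)" for j
    proof -
      have "(\<integral>\<^sup>+ t. ennreal (K j t) \<partial>lebesgue_on {0..T})
        \<le> ennreal (Y j * 2 * L j / ((X j)^2 / 2) + Y j * 228 * e^2 * X j * q j / ((X j)^2 / 4) + Y j * 4 * (A j + e * B j) / (1 / (40 * e^2)))"
        (is "_ \<le> ennreal ?I")
        unfolding K_def using W(3)[of j] W(4)[of j] nn[of j] e T by (intro nn_integral_exp3_le) auto
      also have "\<dots> \<le> ennreal (13440 * D j)"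
      proof (rule ennreal_leI)
        let ?u = "Y j / (X j)^2 * L j" and ?v = "e^2 * (Y j / X j) * q j"
        \<comment> \<open>The layer carries \<open>A j + e * B j\<close>, and
          \<open>X j * (A j + e * B j)\<close> is \<open>q j - B j\<close>; it is thus absorbed by
          the same quantity as the heat term.\<close>
        have "?I = 4 * ?u + 912 * ?v + 160 * (e^2 * (Y j / X j) * (q j - B j))"
          using W(3)[of j] by (simp add: q_def field_simps power2_eq_square)
        also have "\<dots> \<le> 4 * ?u + 912 * ?v + 160 * ?v"
          using W(3)[of j] W(4)[of j] nn[of j] by (intro add_left_mono mult_left_mono) auto
        also have "\<dots> = 4 * ?u + 1072 * ?v" by simp
        also have "\<dots> \<le> 13440 * ?u + 13440 * ?v"
          using W(3)[of j] W(4)[of j] nn[of j] by (intro add_mono mult_right_mono mult_nonneg_nonneg) auto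
        also have "\<dots> = 13440 * D j" unfolding W(5) A_def B_def L_def q_def by (simp add: distrib_left)
        finally show "?I \<le> 13440 * D j" .
      qed
      finally show ?thesis .
    qed
  qed (fact D_scaled)+
qed

text \<open>The layer integrates to at most \<open>40 * e^2\<close> and the slow part to at most
  \<open>2 * e^2\<close>. With the factor 160 of \<open>block_bounds\<close> and the 2 of
  \<open>localize_le\<close> this gives 320 (40 + 2) = 13440.\<close>

lemma L1_flux_bound:
  assumes T: "0 \<le> T"
  shows "L1_besov_norm h \<phi> (s - 1) T (\<lambda>t n. Dh h (v t) n + w t n) \<le> ennreal (13440 * \<Sigma>)"
proof -
  define X Y A B where "X = (\<lambda>j :: int. (2 :: real) powr of_int j)" and "Y = (\<lambda>j :: int. (2 :: real) powr (of_int j * s))"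
    and "A = (\<lambda>j. shell_norm h j a)" and "B = (\<lambda>j. shell_norm h j b)"
  note defs = X_def[THEN fun_cong, symmetric] Y_def[THEN fun_cong, symmetric]
  note W = dyadic_weights[unfolded defs]
  define q where "q j = X j * A j + (1 + e * X j) * B j" for j
  have nn: "0 \<le> A j" "0 \<le> B j" "0 \<le> q j" for j
    using W(3)[of j] e by (auto simp: A_def B_def q_def)
  \<comment> \<open>The zero third term only brings the majorant into the three-exponential form of
    \<open>nn_integral_exp3_le\<close>.\<close>
  define K where "K j t = Y j / X j * 320 * q j * exp (- (1 / (40 * e^2) * t))
      + Y j / X j * 320 * e^2 * (X j)^2 * q j * exp (- ((X j)^2 / 2 * t)) + 0 * exp (- (1 * t))" for j t
  show ?thesis
  proof (rule L1_besov_norm_le[where K = K and B = "\<lambda>j. 13440 * D j"])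
    fix j and t :: real assume t: "0 \<le> t"
    define G where "G = 160 * (exp (- t / (40 * e^2)) + e^2 * (X j)^2 * exp (- ((X j)^2 / 2 * t)))"
    \<comment> \<open>The flux does not involve the heat solution, so the slot of the density gap is
      filled with coefficient 0.\<close>
    have "ell2_norm h (localize h \<phi> j (\<lambda>n. Dh h (v t) n + w t n))
      \<le> ennreal (2 * (0 * shell_norm h j (\<lambda>x. a x - l x) + (G * X j) * A j + (G * (1 + e * X j)) * B j))"
      (is "_ \<le> ennreal ?c")
      unfolding flux_error(1)[OF t] A_def B_def
    proof (rule localize_le[OF h \<phi> flux_error(2)[OF t] diff_L2 abl(1,2)])
      fix x assume x: "x \<in> dyadic_shell h j"
      show "cmod (\<i> * of_real (symb h x) * R t x + U t x) \<le> 0 * cmod (a x - l x) + (G * X j) * cmod (a x) + (G * (1 + e * X j)) * cmod (b x)"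
        using damped_mode.block_bounds(1)[OF damped_mode_damp[OF e] W(3) shell_symb[OF h x, unfolded defs] t, of "a x" "b x"]
        unfolding G_def[symmetric] by (simp add: algebra_simps)
    qed (use W(3)[of j] e in \<open>auto simp: G_def\<close>)
    then show "ennreal (2 powr (of_int j * (s - 1))) * ell2_norm h (localize h \<phi> j (\<lambda>n. Dh h (v t) n + w t n)) \<le> ennreal (K j t)"
    proof (rule mult_ennreal_le)
      have "Y j / X j * ?c = Y j / X j * (2 * (G * q j))"
        by (simp add: q_def distrib_left mult.assoc)
      also have "\<dots> = K j t" by (simp add: K_def G_def algebra_simps)
      finally show "2 powr (of_int j * (s - 1)) * ?c \<le> K j t"
        unfolding W(1) by simp
    qed simp
  next
    show "continuous_on UNIV (K j)" for j unfolding K_def by (intro continuous_intros)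
    show "(\<integral>\<^sup>+ t. ennreal (K j t) \<partial>lebesgue_on {0..T}) \<le> ennreal (13440 * D j)" for j
    proof -
      have "(\<integral>\<^sup>+ t. ennreal (K j t) \<partial>lebesgue_on {0..T})
        \<le> ennreal (Y j / X j * 320 * q j / (1 / (40 * e^2)) + Y j / X j * 320 * e^2 * (X j)^2 * q j / ((X j)^2 / 2) + 0 / 1)"
        (is "_ \<le> ennreal ?I")
        unfolding K_def using W(3)[of j] W(4)[of j] nn[of j] e T by (intro nn_integral_exp3_le) auto
      also have "\<dots> \<le> ennreal (13440 * D j)"
      proof (rule ennreal_leI)
        have "?I = 13440 * (e^2 * (Y j / X j) * q j)"
          using W(3)[of j] by (simp add: field_simps)
        also have "\<dots> \<le> 13440 * D j"
          unfolding W(5) using W(3)[of j] W(4)[of j] by (simp add: q_def A_def B_def)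
        finally show "?I \<le> 13440 * D j" .
      qed
      finally show ?thesis .
    qed
  qed (fact D_scaled)+
qed

end

section \<open>Sobolev norms on the Fourier side and the final assembly\<close>

lemma weighted_norm_cong:
  assumes "f \<in> L2 UNIV" "g \<in> L2 UNIV" "AE x in lebesgue. cmod (f x) = cmod (g x)"
  shows "weighted_norm r f = weighted_norm r g"
proof -
  note w = bessel_weight_measurable[of r]
  have "f \<in> borel_measurable lebesgue" "g \<in> borel_measurable lebesgue"
    using assms by (simp_all add: L2_def lebesgue_on_UNIV_eq)
  then have "(LINT x|lebesgue. (1 + x^2) powr r * (cmod (f x))^2) = (LINT x|lebesgue. (1 + x^2) powr r * (cmod (g x))^2)"
    using w assms(3) by (intro integral_cong_AE) auto
  then show ?thesis by (simp add: weighted_norm_def)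
qed

lemma fourier_L2: "v \<in> sobolev r \<Longrightarrow> fourier v \<in> L2 UNIV"
  by (simp add: sobolev_def has_fourier_def)

text \<open>\<open>fourier\<close> is linear only almost everywhere, which the integral does not
  notice. The order of subtraction is reversed because the data compare the heat density with the
  damped one, while \<open>D j\<close> uses the opposite sign. Two orders \<open>r\<close> and
  \<open>q\<close> are allowed since these densities lie in different Sobolev spaces.\<close>

lemma sobolev_norm_diff:
  assumes v: "v \<in> sobolev r" and w: "w \<in> sobolev q"
  shows "sobolev_norm p (\<lambda>x. v x - w x) = weighted_norm p (\<lambda>\<xi>. fourier w \<xi> - fourier v \<xi>)"
proof -
  note L = fourier_L2[OF v] fourier_L2[OF w]
  have F: "has_fourier (\<lambda>x. v x - w x) (fourier (\<lambda>x. v x - w x))"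
    "AE \<xi> in lebesgue. fourier (\<lambda>x. v x - w x) \<xi> = fourier v \<xi> - fourier w \<xi>"
    using fourier_lincomb[OF v w, of 1 "- 1"] by simp_all
  have "AE \<xi> in lebesgue. cmod (fourier (\<lambda>x. v x - w x) \<xi>) = cmod (fourier w \<xi> - fourier v \<xi>)"
    using F(2) by eventually_elim (simp add: norm_minus_commute)
  then have "weighted_norm p (fourier (\<lambda>x. v x - w x)) = weighted_norm p (\<lambda>\<xi>. fourier w \<xi> - fourier v \<xi>)"
    using F(1) L2_diff[OF L(2,1)] by (intro weighted_norm_cong) (auto simp: has_fourier_def)
  then show ?thesis by (simp add: sobolev_norm_def weighted_norm_def)
qed

lemma sobolev_norm_cmult:
  assumes v: "v \<in> sobolev r"
  shows "sobolev_norm p (\<lambda>x. c * v x) = cmod c * sobolev_norm p v"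
proof -
  have F: "has_fourier (\<lambda>x. c * v x) (fourier (\<lambda>x. c * v x))"
    "AE \<xi> in lebesgue. fourier (\<lambda>x. c * v x) \<xi> = c * fourier v \<xi>"
    using fourier_lincomb[OF v v, of c 0] by simp_all
  have "weighted_norm p (fourier (\<lambda>x. c * v x)) = weighted_norm p (\<lambda>\<xi>. c * fourier v \<xi>)"
    using F L2_cmult[OF fourier_L2[OF v]] by (intro weighted_norm_cong) (auto simp: has_fourier_def)
  also have "\<dots> = sqrt ((cmod c)^2 * (LINT \<xi>|lebesgue. (1 + \<xi>^2) powr p * (cmod (fourier v \<xi>))^2))"
  proof -
    have eq: "(1 + \<xi>^2) powr p * (cmod (c * fourier v \<xi>))^2 = (cmod c)^2 * ((1 + \<xi>^2) powr p * (cmod (fourier v \<xi>))^2)" for \<xi>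
      by (simp add: norm_mult power_mult_distrib)
    show ?thesis unfolding weighted_norm_def eq by simp
  qed
  finally show ?thesis by (simp add: sobolev_norm_def weighted_norm_def real_sqrt_mult)
qed

text \<open>Moves the weight into the function, so that weighted integrability of a difference
  follows from L^2 being closed under subtraction.\<close>

lemma weighted_L2_iff:
  assumes "f \<in> L2 UNIV"
  shows "integrable lebesgue (\<lambda>x. (1 + x^2) powr r * (cmod (f x))^2) \<longleftrightarrow>
    (\<lambda>x. of_real ((1 + x^2) powr (r / 2)) * f x) \<in> L2 UNIV"
proof -
  have "((1 + x^2) powr (r / 2))^2 = (1 + x^2) powr r" for x :: real
    by (simp add: power2_eq_square flip: powr_add)
  then have eq: "(cmod (of_real ((1 + x^2) powr (r / 2)) * f x))^2 = (1 + x^2) powr r * (cmod (f x))^2" for x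
    by (simp add: norm_mult power_mult_distrib)
  have "f \<in> borel_measurable lebesgue" using assms by (simp add: L2_def lebesgue_on_UNIV_eq)
  moreover have "(\<lambda>x :: real. complex_of_real ((1 + x^2) powr (r / 2))) \<in> borel_measurable lebesgue"
    using measurable_compose[OF bessel_weight_measurable borel_measurable_of_real] .
  ultimately have "(\<lambda>x. of_real ((1 + x^2) powr (r / 2)) * f x) \<in> borel_measurable lebesgue"
    by (intro borel_measurable_times)
  then show ?thesis unfolding L2_def mem_Collect_eq eq lebesgue_on_UNIV_eq by blast
qed

lemma sobolev_diff_integrable:
  assumes v: "v \<in> sobolev r" and w: "w \<in> sobolev r"
  shows "integrable lebesgue (\<lambda>x. (1 + x^2) powr r * (cmod (fourier v x - fourier w x))^2)"
proof -
  note L = fourier_L2[OF v] fourier_L2[OF w]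
  show ?thesis
    using v w L2_diff[of _ UNIV "\<lambda>x. of_real ((1 + x^2) powr (r / 2)) * fourier w x"]
    unfolding weighted_L2_iff[OF L2_diff[OF L]] sobolev_def weighted_L2_iff[OF L(1)] weighted_L2_iff[OF L(2)]
    by (simp add: right_diff_distrib weighted_L2_iff[OF L(1)] weighted_L2_iff[OF L(2)])
qed

theorem theorem2p6:
  fixes s s' :: real and \<phi> :: "real \<Rightarrow> int \<Rightarrow> real \<Rightarrow> real"
  assumes "2 < s'" and "s \<in> {2<..<s'}"
    and "\<And>h. 0 < h \<Longrightarrow> dyadic_partition h (\<phi> h)"
  shows "\<exists>C\<^sub>1>0. \<forall>\<epsilon> h. \<forall>\<rho>i ui \<rho>l \<rho>I uI \<rho>L \<rho>\<epsilon> u\<epsilon> \<rho>.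
           0 < \<epsilon> \<longrightarrow> 0 < h \<longrightarrow>
           truncated_data s' h \<epsilon> \<rho>i ui \<rho>l \<rho>I uI \<rho>L \<longrightarrow>
           damped_solution h \<epsilon> \<rho>i ui \<rho>\<epsilon> u\<epsilon> \<longrightarrow>
           heat_solution h \<rho>l \<rho> \<longrightarrow>
           (\<forall>T>0.
              besov_norm h (\<phi> h) (s - 2) (\<lambda>n. \<rho>\<epsilon> T n - \<rho> T n)
              + L1_besov_norm h (\<phi> h) s T (\<lambda>t n. \<rho>\<epsilon> t n - \<rho> t n)
              + L1_besov_norm h (\<phi> h) (s - 1) T (\<lambda>t n. Dh h (\<rho>\<epsilon> t) n + u\<epsilon> t n)
              \<le> ennreal
                  (C\<^sub>1 * (1 + (sobolev_norm s' \<rho>I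
                              + sobolev_norm s' (\<lambda>x. complex_of_real \<epsilon> * uI x))
                           + sobolev_norm (s' - 1) uI) * \<epsilon>\<^sup>2))"
proof -
  \<comment> \<open>One constant for each regularity pair in \<open>D j\<close>. The pair
    \<open>s - 2\<close>, \<open>s' - 2\<close> is the one that requires \<open>2 < s\<close>. All
    three depend on \<open>s\<close> and \<open>s'\<close> only, hence so does the final constant,
    in particular not on the partition.\<close>
  define C0 C1 C2 where "C0 = shell_const s s'" and "C1 = shell_const (s - 1) (s' - 1)" and "C2 = shell_const (s - 2) (s' - 2)"
  define C where "C = C0 + C1 + C2"
  have "0 < C0" "0 < C1" "0 < C2" unfolding C0_def C1_def C2_def using assms(2) by (auto intro: shell_const_pos)
  then have C: "0 < C" "C0 \<le> C" "C1 \<le> C" "C2 \<le> C" "0 \<le> C0" "0 \<le> C1" "0 \<le> C2" by (auto simp: C_def)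
  show ?thesis
  proof (intro exI[of _ "40320 * C"] conjI allI impI)
    show "0 < 40320 * C" using C by simp
    fix e h T :: real and \<rho>i ui \<rho>l \<rho>I uI \<rho>L v w \<rho>
    assume e: "0 < e" and h: "0 < h" and data: "truncated_data s' h e \<rho>i ui \<rho>l \<rho>I uI \<rho>L"
      and damped: "damped_solution h e \<rho>i ui v w" and heat: "heat_solution h \<rho>l \<rho>" and T: "0 < T"
    have sob: "\<rho>L \<in> sobolev (s' - 2)" "\<rho>I \<in> sobolev s'" "uI \<in> sobolev s'"
      and close: "sobolev_norm (s' - 2) (\<lambda>x. \<rho>L x - \<rho>I x) < e^2"
      and init: "\<rho>l = idft h (fourier \<rho>L)" "\<rho>i = idft h (fourier \<rho>I)" "ui = idft h (fourier uI)"
      using data by (auto simp: truncated_data_def truncation_def)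
    define a b l where "a = fourier \<rho>I" and "b = fourier uI" and "l = fourier \<rho>L"
    have L: "a \<in> L2 UNIV" "b \<in> L2 UNIV" "l \<in> L2 UNIV"
      using sob by (auto simp: a_def b_def l_def intro: fourier_L2)
    have Lf: "a \<in> L2 (freqs h)" "b \<in> L2 (freqs h)" "l \<in> L2 (freqs h)"
      using L by (auto intro: L2_mono)
    have int: "integrable lebesgue (\<lambda>x. (1 + x^2) powr s' * (cmod (a x))^2)"
      "integrable lebesgue (\<lambda>x. (1 + x^2) powr s' * (cmod (b x))^2)"
      "integrable lebesgue (\<lambda>x. (1 + x^2) powr (s' - 1) * (cmod (b x))^2)"
      "integrable lebesgue (\<lambda>x. (1 + x^2) powr (s' - 2) * (cmod (a x - l x))^2)"
      using sob sobolev_mono[OF sob(3), of "s' - 1"] sobolev_diff_integrable[OF sobolev_mono[OF sob(2), of "s' - 2"] sob(1)]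
      by (auto simp: sobolev_def a_def b_def l_def)
    \<comment> \<open>The closeness of the two initial densities accounts for the summand 1 in the
      constant of the theorem.\<close>
    have N: "weighted_norm (s' - 2) (\<lambda>x. a x - l x) \<le> e^2"
      using close unfolding sobolev_norm_diff[OF sob(1,2)] a_def l_def by simp
    have norms: "sobolev_norm s' \<rho>I = weighted_norm s' a" "sobolev_norm (s' - 1) uI = weighted_norm (s' - 1) b"
      "sobolev_norm s' (\<lambda>x. complex_of_real e * uI x) = e * weighted_norm s' b"
      using e unfolding sobolev_norm_cmult[OF sob(3)] by (simp_all add: sobolev_norm_def weighted_norm_def a_def b_def)
    let ?A = "weighted_norm s' a" and ?B = "weighted_norm s' b" and ?B' = "weighted_norm (s' - 1) b"
    let ?\<alpha> = "\<lambda>j. 2 powr (of_int j * s) * shell_norm h j a" and ?\<beta> = "\<lambda>j. 2 powr (of_int j * s) * shell_norm h j b"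
      and ?\<beta>' = "\<lambda>j. 2 powr (of_int j * (s - 1)) * shell_norm h j b"
    define S where "S = C * (1 + (?A + e * ?B) + ?B') * e^2"
    have sum_le: "(\<Sum>j\<in>F. 2 powr (of_int j * (s - 2)) * shell_norm h j (\<lambda>x. a x - l x)
        + e^2 * (?\<alpha> j + ?\<beta>' j
          + e * (?\<beta> j))) \<le> S" (is "?D \<le> S") if F: "finite F" for F
    proof -
      have "?D = (\<Sum>j\<in>F. 2 powr (of_int j * (s - 2)) * shell_norm h j (\<lambda>x. a x - l x))
        + e^2 * ((\<Sum>j\<in>F. ?\<alpha> j) + (\<Sum>j\<in>F. ?\<beta>' j)
          + e * (\<Sum>j\<in>F. ?\<beta> j))"
        by (simp only: sum.distrib sum_distrib_left[symmetric])
      also have "\<dots> \<le> C2 * weighted_norm (s' - 2) (\<lambda>x. a x - l x)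
        + e^2 * (C0 * ?A + C1 * ?B' + e * (C0 * ?B))"
        unfolding C0_def C1_def C2_def using e assms(2) by (intro add_mono mult_left_mono shell_sum_le h F L int L2_diff) auto
      also have "\<dots> \<le> C * e^2
        + e^2 * (C * ?A + C * ?B' + e * (C * ?B))"
        using e C N by (intro add_mono mult_left_mono mult_mono mult_right_mono) auto
      also have "\<dots> = S" by (simp add: S_def algebra_simps)
      finally show ?thesis .
    qed
    note bounds = besov_bound L1_density_bound L1_flux_bound
    note est = bounds[OF h e assms(3)[OF h] Lf damped[unfolded init, folded a_def b_def] heat[unfolded init, folded l_def] sum_le less_imp_le[OF T]]
    have S0: "0 \<le> S" unfolding S_def using e C by (intro mult_nonneg_nonneg add_nonneg_nonneg) auto
    \<comment> \<open>The three norms are bounded by the same number, so 40320 is three times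
      13440.\<close>
    have eq: "ennreal (13440 * S) + ennreal (13440 * S) + ennreal (13440 * S)
        = ennreal (40320 * C * (1 + (?A + e * ?B) + ?B') * e^2)"
      (is "_ = ennreal ?E")
    proof -
      have "?E = 13440 * S + 13440 * S + 13440 * S" unfolding S_def by simp
      then show ?thesis
        using S0 by (simp only: ennreal_plus[symmetric] mult_nonneg_nonneg add_nonneg_nonneg zero_le_numeral)
    qed
    show "besov_norm h (\<phi> h) (s - 2) (\<lambda>n. v T n - \<rho> T n)
        + L1_besov_norm h (\<phi> h) s T (\<lambda>t n. v t n - \<rho> t n)
        + L1_besov_norm h (\<phi> h) (s - 1) T (\<lambda>t n. Dh h (v t) n + w t n)
          \<le> ennreal (40320 * C * (1 + (sobolev_norm s' \<rho>I + sobolev_norm s' (\<lambda>x. complex_of_real e * uI x))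
                           + sobolev_norm (s' - 1) uI) * e^2)"
      unfolding norms eq[symmetric] by (intro add_mono est)
  qed
qed

end
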